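(* Let $E/\mathbb{Q}$ be an elliptic curve. Then the second Lattès map $L_2$ attached to $E$ is arithmetically exceptional if and only if $E$ has no nontrivial rational $2$-torsion point.
   Context: Let $E/\mathbb{Q}$ be an elliptic curve given by a Weierstrass equation over $\mathbb{Q}$, and let $\mathrm{proj}:E\to\mathbb{P}^1$ be the $x$-coordinate projection (sending the point at infinity to $\infty$). The second Lattès map $L_2\in\mathbb{Q}(x)$ attached to $E$ is the unique rational function with $\mathrm{proj}\circ[2]=L_2\circ\mathrm{proj}$, where $[2]$ is multiplication by $2$ on $E$. A rational function $r(x)\in\mathbb{Q}(x)$ is called arithmetically exceptional if its reduction modulo $p$ (defined for all but finitely many primes $p$) induces a permutation of $\mathbb{P}^1(\mathbb{F}_p)$ for infinitely many primes $p$. A nontrivial rational $2$-torsion point is a point $P\in E(\mathbb{Q})$, different from the point at infinity, with $[2]P$ equal to the point at infinity. *)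

theory Defs
  imports
    Complex_Main
    "HOL-Computational_Algebra.Computational_Algebra"
    "HOL-Number_Theory.Modular_Inverse"
begin

datatype 'a proj_line = Finite 'a | Infty

text \<open>
  With \<open>F, G\<close> the homogenizations of \<open>f, g\<close> to the common degree \<open>max (degree f) (degree g)\<close>,
  this is the pair \<open>(F(P), G(P))\<close>, where \<open>P\<close> is \<open>(x : 1)\<close> or \<open>(1 : 0)\<close>.
\<close>
fun hom_values :: "'a::comm_ring_1 poly \<Rightarrow> 'a poly \<Rightarrow> 'a proj_line \<Rightarrow> 'a \<times> 'a" where
  "hom_values f g (Finite x) = (poly f x, poly g x)"
| "hom_values f g Infty =
     (let d = max (degree f) (degree g) in (coeff f d, coeff g d))"

text \<open>
  The point with homogeneous coordinates \<open>(a : b)\<close>; never used at \<open>(0 : 0)\<close>, because it is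
  only applied to values of coprime polynomials.
\<close>
definition proj_point :: "'a::field \<times> 'a \<Rightarrow> 'a proj_line" where
  "proj_point = (\<lambda>(a, b). if b = 0 then Infty else Finite (a / b))"

text \<open>
  Coprimality is that in \<open>\<int>[x]\<close>, so it also excludes a common constant factor;
  such a pair \<open>(f, g)\<close> exists and is determined by \<open>r\<close> up to a common sign, on which
  nothing below depends.
\<close>
definition lowest_terms :: "rat poly fract \<Rightarrow> int poly \<times> int poly \<Rightarrow> bool" where
  "lowest_terms r = (\<lambda>(f, g).
     g \<noteq> 0 \<and> coprime f g \<and> r = Fract (map_poly of_int f) (map_poly of_int g))"

definition num_denom :: "rat poly fract \<Rightarrow> int poly \<times> int poly" where
  "num_denom r = (SOME fg. lowest_terms r fg)"

definition eval_ratfun :: "rat poly fract \<Rightarrow> complex proj_line \<Rightarrow> complex proj_line" where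
  "eval_ratfun r P =
     (let (f, g) = num_denom r
      in proj_point (hom_values (map_poly of_int f) (map_poly of_int g) P))"

text \<open>
  The field with \<open>p\<close> elements is represented by the integers \<open>0, \<dots>, p - 1\<close>.
\<close>
definition proj_line_mod :: "nat \<Rightarrow> int proj_line set" where
  "proj_line_mod p = insert Infty (Finite ` {0..<int p})"

definition proj_point_mod :: "nat \<Rightarrow> int \<times> int \<Rightarrow> int proj_line" where
  "proj_point_mod p =
     (\<lambda>(a, b). if int p dvd b then Infty
               else Finite (a * modular_inverse (int p) b mod int p))"

text \<open>
  The homogenizations of \<open>f\<close> and \<open>g\<close> have no common zero modulo \<open>p\<close> over an algebraic closure:
  neither at infinity, nor (by the Bezout identity modulo \<open>p\<close>) at a finite point.
  For \<open>f, g\<close> in lowest terms this fails for finitely many primes only.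
\<close>
definition good_reduction :: "int poly \<Rightarrow> int poly \<Rightarrow> nat \<Rightarrow> bool" where
  "good_reduction f g p \<longleftrightarrow>
     (let d = max (degree f) (degree g) in \<not> (int p dvd coeff f d \<and> int p dvd coeff g d)) \<and>
     (\<exists>u v. [:int p:] dvd u * f + v * g - 1)"

definition permutes_mod :: "rat poly fract \<Rightarrow> nat \<Rightarrow> bool" where
  "permutes_mod r p \<longleftrightarrow>
     (let (f, g) = num_denom r
      in good_reduction f g p \<and>
         bij_betw (\<lambda>P. proj_point_mod p (hom_values f g P))
           (proj_line_mod p) (proj_line_mod p))"

definition arithmetically_exceptional :: "rat poly fract \<Rightarrow> bool" where
  "arithmetically_exceptional r \<longleftrightarrow> infinite {p. prime p \<and> permutes_mod r p}"

text \<open>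
  \<open>Weierstrass a1 a2 a3 a4 a6\<close> stands for
  \<open>y\<^sup>2 + a1 x y + a3 y = x\<^sup>3 + a2 x\<^sup>2 + a4 x + a6\<close>.
\<close>
datatype 'a weierstrass = Weierstrass 'a 'a 'a 'a 'a

fun discriminant :: "'a::comm_ring_1 weierstrass \<Rightarrow> 'a" where
  "discriminant (Weierstrass a1 a2 a3 a4 a6) =
     (let b2 = a1^2 + 4 * a2;
          b4 = 2 * a4 + a1 * a3;
          b6 = a3^2 + 4 * a6;
          b8 = a1^2 * a6 + 4 * a2 * a6 - a1 * a3 * a4 + a2 * a3^2 - a4^2
      in - (b2^2 * b8) - 8 * b4^3 - 27 * b6^2 + 9 * b2 * b4 * b6)"

definition elliptic_curve :: "'a::field weierstrass \<Rightarrow> bool" where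
  "elliptic_curve E \<longleftrightarrow> discriminant E \<noteq> 0"

datatype 'a point = Origin | Affine 'a 'a

fun on_curve :: "'a::field weierstrass \<Rightarrow> 'a point \<Rightarrow> bool" where
  "on_curve _ Origin \<longleftrightarrow> True"
| "on_curve (Weierstrass a1 a2 a3 a4 a6) (Affine x y) \<longleftrightarrow>
     y^2 + a1 * x * y + a3 * y = x^3 + a2 * x^2 + a4 * x + a6"

text \<open>
  The chord-tangent law: \<open>l\<close> and \<open>n\<close> are slope and intercept of the line through the two
  points, tangent to the curve if they coincide. It is meaningful on points of the curve only.
\<close>
fun point_add :: "'a::field weierstrass \<Rightarrow> 'a point \<Rightarrow> 'a point \<Rightarrow> 'a point" where
  "point_add _ Origin Q = Q"
| "point_add _ P Origin = P"
| "point_add (Weierstrass a1 a2 a3 a4 a6) (Affine x1 y1) (Affine x2 y2) =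
     (if x1 = x2 \<and> y1 + y2 + a1 * x2 + a3 = 0 then Origin
      else
        let l = (if x1 = x2
                 then (3 * x1^2 + 2 * a2 * x1 + a4 - a1 * y1) / (2 * y1 + a1 * x1 + a3)
                 else (y2 - y1) / (x2 - x1));
            n = y1 - l * x1;
            x3 = l^2 + a1 * l - a2 - x1 - x2
        in Affine x3 (- (l + a1) * x3 - n - a3))"

definition point_mult :: "'a::field weierstrass \<Rightarrow> nat \<Rightarrow> 'a point \<Rightarrow> 'a point" where
  "point_mult E n P = (point_add E P ^^ n) Origin"

fun proj :: "'a point \<Rightarrow> 'a proj_line" where
  "proj Origin = Infty"
| "proj (Affine x y) = Finite x"

text \<open>
  The identity \<open>proj \<circ> [n] = L \<circ> proj\<close> of morphisms is expressed on complex points, where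
  it determines \<open>L\<close> uniquely because \<open>proj\<close> is surjective there; rational points would not
  suffice.
\<close>
definition lattes_map :: "rat weierstrass \<Rightarrow> nat \<Rightarrow> rat poly fract" where
  "lattes_map E n =
     (THE L. let EC = map_weierstrass of_rat E in
        \<forall>P::complex point. on_curve EC P \<longrightarrow> proj (point_mult EC n P) = eval_ratfun L (proj P))"

end

theory Submission
  imports Defs "HOL-Number_Theory.Prime_Powers" "HOL-Analysis.Summation_Tests" "HOL-Real_Asymp.Real_Asymp"
begin

text \<open>
  In terms of the usual invariants \<open>b\<^sub>2, b\<^sub>4, b\<^sub>6, b\<^sub>8\<close> the map is \<open>L\<^sub>2 = \<phi> / \<psi>\<close> with
  \<open>\<phi> = x^4 - b\<^sub>4 x^2 - 2 b\<^sub>6 x - b\<^sub>8\<close> and the two-division polynomial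
  \<open>\<psi> = 4 x^3 + b\<^sub>2 x^2 + 2 b\<^sub>4 x + b\<^sub>6\<close>, whose rational roots are the abscissae of the nontrivial
  rational two-torsion points (\<open>lattes_map_2\<close>). For all but finitely many primes \<open>p\<close>,
  \<open>L\<^sub>2\<close> permutes the projective line over the field with \<open>p\<close> elements if and only if \<open>\<psi>\<close> has no
  root modulo \<open>p\<close>. A root and the point at infinity have the same image, infinity. Conversely,
  \<open>L\<^sub>2(x) = L\<^sub>2(y)\<close> with \<open>x \<noteq> y\<close> says that two points of the curve with these abscissae differ by a
  two-torsion point up to sign; the abscissa \<open>e\<close> of that point then satisfies
  \<open>4 (x - e) (y - e) = \<psi>'(e)\<close>, a quadratic equation over the prime field, which is impossible for
  a root of a cubic that is irreducible there (\<open>root_of_duplication_collision\<close>).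

  A rational root of \<open>\<psi>\<close> gives a root modulo almost all primes, so one implication is immediate.
  The other one needs the fact that an irreducible cubic has no root modulo infinitely many primes
  (\<open>cubic_no_root_mod_infinitely_many_primes\<close>). This is an instance of the Chebotarev density
  theorem, but the following elementary count suffices. Let \<open>F\<close> be the cubic, made monic, integral
  and homogeneous, \<open>D\<close> its discriminant, \<open>N\<^sub>p\<close> the number of its roots modulo \<open>p\<close>, and \<open>\<rho>\<^sub>p\<close> the number of
  roots of \<open>t^2 - D\<close> modulo \<open>p\<close>. If \<open>N\<^sub>p \<ge> 1\<close> for almost all \<open>p\<close>, then \<open>N\<^sub>p \<ge> 1 + \<rho>\<^sub>p\<close> for almost all
  \<open>p\<close>, because a cubic with a root splits completely as soon as its discriminant is a square. This
  contradicts three estimates for sums over the primes \<open>p \<le> M^2\<close> weighted by \<open>ln p / p\<close>: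
  the constant \<open>1\<close> contributes at least \<open>2 ln M\<close>, and \<open>\<rho>\<^sub>p\<close> at least \<open>4/3 ln M\<close>, while \<open>N\<^sub>p\<close> contributes
  at most \<open>(3 + \<epsilon>) ln M\<close>, all up to bounded errors.

  The first estimate is Mertens' theorem (\<open>sum_ln_div_primes_ge\<close>). The other two come from adding
  up \<open>ln \<bar>F(v)\<bar>\<close>, respectively \<open>ln \<bar>x^2 - D y^2\<bar>\<close>, over the integral points \<open>v = (x, y)\<close> of a square
  of side \<open>N\<close>, and sorting the result by the primes that divide the values. A prime \<open>p\<close> and a
  root \<open>r\<close> contribute \<open>ln p\<close> for each point of the lattice \<open>x \<equiv> r y (mod p)\<close> in the square, roughly
  \<open>N^2 / p\<close> points. A value of \<open>F\<close> has size about \<open>N^3\<close>, and the count of lattice points is correct on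
  average for \<open>p\<close> up to a small multiple of \<open>N^2\<close>: it could only fail for lattices with short vectors,
  and these are rare, since a short vector \<open>w\<close> belongs to such lattices only for the few primes that
  divide \<open>F(w) \<noteq> 0\<close>. So \<open>N\<^sub>p\<close> contributes at most \<open>3 ln N\<close> over the primes up to about \<open>N^2\<close>
  (\<open>cubic_sum_roots_le\<close>). A value of \<open>x^2 - D y^2\<close> also has size about \<open>N^2\<close>, so all of its prime
  factors are within the range of the count, and their contributions must add up to \<open>2 ln N\<close>; this
  bounds the contribution of \<open>\<rho>\<^sub>p\<close> from below (\<open>quadratic_sum_roots_ge\<close>). A generous factor
  \<open>3/2\<close> in the count of lattice points turns \<open>2\<close> into \<open>4/3\<close>, which is still enough.
\<close>

section \<open>Sums over primes\<close>

definition primes_upto :: "nat \<Rightarrow> nat set" where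
  "primes_upto n = {p. prime p \<and> p \<le> n}"

lemma finite_primes_upto [simp, intro]: "finite (primes_upto n)"
  by (auto simp: primes_upto_def)

lemma sum_ln_prime_powers_le:
  fixes n :: nat
  assumes "n > 0" "finite S" "\<And>p. p \<in> S \<Longrightarrow> prime p \<and> p ^ e p dvd n"
  shows "(\<Sum>p\<in>S. real (e p) * ln (real p)) \<le> ln (real n)"
proof -
  have "(\<Prod>p\<in>S. p ^ e p) dvd n"
    using assms(2,3)
  proof (induction S rule: finite_induct)
    case (insert q S)
    have "coprime (q ^ e q) (\<Prod>p\<in>S. p ^ e p)"
    proof (rule prod_coprime_right)
      fix p assume "p \<in> S"
      then have "q \<noteq> p" "prime p" "prime q" using insert by auto
      then show "coprime (q ^ e q) (p ^ e p)" by (simp add: primes_coprime)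
    qed
    moreover have "(\<Prod>p\<in>S. p ^ e p) dvd n" using insert by auto
    moreover have "q ^ e q dvd n" using insert by auto
    ultimately show ?case using insert by (simp add: divides_mult)
  qed simp
  then have le: "(\<Prod>p\<in>S. p ^ e p) \<le> n" using assms(1) by (simp add: dvd_imp_le)
  have pos: "p > 0" if "p \<in> S" for p using assms(3)[OF that] prime_gt_0_nat by auto
  have "(\<Sum>p\<in>S. real (e p) * ln (real p)) = (\<Sum>p\<in>S. ln (real p ^ e p))"
    using pos by (intro sum.cong) (auto simp: ln_realpow)
  also have "\<dots> = ln (\<Prod>p\<in>S. real p ^ e p)"
    using pos assms(2) by (intro ln_prod [symmetric]) auto
  also have "\<dots> = ln (real (\<Prod>p\<in>S. p ^ e p))" by simp
  also have "\<dots> \<le> ln (real n)"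
  proof (subst ln_le_cancel_iff)
    show "0 < real (\<Prod>p\<in>S. p ^ e p)" using pos by (simp add: prod_pos)
    show "real (\<Prod>p\<in>S. p ^ e p) \<le> real n" using le by (rule of_nat_mono)
  qed (use assms(1) in simp)
  finally show ?thesis .
qed

definition chebyshev_theta :: "nat \<Rightarrow> real" where
  "chebyshev_theta n = (\<Sum>p\<in>primes_upto n. ln (real p))"

text \<open>
  The primes between \<open>n\<close> and \<open>2 n\<close> divide the central binomial coefficient, which is at most \<open>4^n\<close>;
  the factor \<open>2\<close> is an upper bound for \<open>ln 4\<close>.
\<close>
lemma chebyshev_theta_double: "chebyshev_theta (2 * n) \<le> chebyshev_theta n + real n * 2"
proof -
  let ?S = "{p. prime p \<and> n < p \<and> p \<le> 2 * n}"
  have fin: "finite ?S" by (rule finite_subset[of _ "{..2*n}"]) auto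
  have "(\<Sum>p\<in>?S. real 1 * ln (real p)) \<le> ln (real ((2 * n) choose n))"
  proof (rule sum_ln_prime_powers_le)
    fix p assume p: "p \<in> ?S"
    have "p dvd fact (2 * n)" using p by (simp add: prime_dvd_fact_iff)
    also have "(fact (2 * n) :: nat) = fact n * fact n * ((2 * n) choose n)"
      using binomial_fact_lemma[of n "2*n"] by (simp add: mult_2)
    finally have "p dvd (2 * n) choose n"
      using p by (auto simp: prime_dvd_mult_iff prime_dvd_fact_iff)
    then show "prime p \<and> p ^ 1 dvd (2 * n) choose n" using p by simp
  qed (use fin in \<open>auto simp: zero_less_binomial\<close>)
  also have "\<dots> \<le> ln (2 ^ (2 * n))"
  proof -
    have "real ((2 * n) choose n) \<le> real (2 ^ (2 * n))"
      using binomial_le_pow2[of "2*n" n] by (rule of_nat_mono)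
    then show ?thesis by (subst ln_le_cancel_iff) (auto simp: zero_less_binomial)
  qed
  also have "\<dots> = 2 * real n * ln 2" by (simp add: ln_realpow)
  also have "\<dots> \<le> 2 * real n * 1" using ln_2_less_1 by (intro mult_left_mono) auto
  finally have 1: "(\<Sum>p\<in>?S. ln (real p)) \<le> real n * 2" by simp
  have "primes_upto (2 * n) = primes_upto n \<union> ?S" by (auto simp: primes_upto_def)
  moreover have "primes_upto n \<inter> ?S = {}" by (auto simp: primes_upto_def)
  ultimately have "chebyshev_theta (2 * n) = chebyshev_theta n + (\<Sum>p\<in>?S. ln (real p))"
    unfolding chebyshev_theta_def using fin by (simp add: sum.union_disjoint)
  with 1 show ?thesis by simp
qed

lemma chebyshev_theta_Suc_le: "chebyshev_theta (Suc n) \<le> chebyshev_theta n + ln (real (Suc n))"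
proof -
  have "primes_upto (Suc n) \<subseteq> insert (Suc n) (primes_upto n)"
    by (auto simp: primes_upto_def le_Suc_eq)
  then have "chebyshev_theta (Suc n) \<le> (\<Sum>p\<in>insert (Suc n) (primes_upto n). ln (real p))"
    unfolding chebyshev_theta_def by (intro sum_mono2) (auto simp: primes_upto_def)
  also have "\<dots> = chebyshev_theta n + ln (real (Suc n))"
    unfolding chebyshev_theta_def by (subst sum.insert) (auto simp: primes_upto_def)
  finally show ?thesis .
qed

lemma chebyshev_theta_le: "chebyshev_theta n \<le> 4 * real n"
proof (induction n rule: less_induct)
  case (less n)
  consider "n = 0" | m where "n = 2 * m" "m > 0" | m where "n = Suc (2 * m)"
    by (metis oddE evenE Suc_eq_plus1 gr0I mult_0_right)
  then show ?case
  proof cases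
    case 1
    then show ?thesis by (auto simp: chebyshev_theta_def primes_upto_def)
  next
    case 2
    then have "chebyshev_theta n \<le> chebyshev_theta m + real m * 2" using chebyshev_theta_double by simp
    also have "chebyshev_theta m \<le> 4 * real m" using less 2 by simp
    finally show ?thesis using 2 by simp
  next
    case 3
    have "chebyshev_theta n \<le> chebyshev_theta (2 * m) + ln (real n)" using chebyshev_theta_Suc_le[of "2*m"] 3 by simp
    also have "ln (real n) \<le> real (2 * m)" using ln_le_minus_one[of "real n"] 3 by simp
    also have "chebyshev_theta (2 * m) \<le> chebyshev_theta m + real m * 2" by (rule chebyshev_theta_double)
    also have "chebyshev_theta m \<le> 4 * real m" using less 3 by simp
    finally show ?thesis using 3 by simp
  qed
qed

lemma summable_ln_powr:
  fixes s :: real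
  assumes "s > 1"
  shows "summable (\<lambda>n. ln (real n) * real n powr - s)"
proof -
  have "(\<lambda>n. ln (real n) * real n powr - s) \<in> O(\<lambda>n. real n powr - ((1 + s) / 2))"
    using assms by real_asymp
  moreover have "summable (\<lambda>n. norm (real n powr - ((1 + s) / 2)))"
    using assms by (simp add: summable_real_powr_iff)
  ultimately show ?thesis by (metis summable_comparison_test_bigo)
qed

lemma sum_ln_powr_bounded:
  fixes s :: real
  assumes "s > 1"
  obtains c where "\<And>A :: nat set. finite A \<Longrightarrow> (\<Sum>n\<in>A. ln (real n) * real n powr - s) \<le> c"
proof
  fix A :: "nat set" assume "finite A"
  then show "(\<Sum>n\<in>A. ln (real n) * real n powr - s) \<le> (\<Sum>n. ln (real n) * real n powr - s)"
  proof (intro sum_le_suminf summable_ln_powr assms ballI)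
    fix n :: nat
    show "0 \<le> ln (real n) * real n powr - s" by (cases "n = 0") auto
  qed auto
qed

text \<open>
  A sum over prime powers splits into primes, squares of primes, and higher powers. The higher powers
  will form a convergent sum even with the weight \<open>1 / sqrt q\<close>; for squares that sum would
  diverge, so they have to be kept apart.
\<close>
lemma sum_mangoldt_le:
  fixes f :: "nat \<Rightarrow> real"
  assumes "\<And>q. f q \<ge> 0"
  shows "(\<Sum>q\<in>{1..X}. mangoldt q * f q)
    \<le> (\<Sum>p\<in>primes_upto X. ln (real p) * f p)
      + (\<Sum>p | p \<in> primes_upto X \<and> p ^ 2 \<le> X. ln (real p) * f (p ^ 2))
      + (\<Sum>p\<in>primes_upto X. \<Sum>k | 3 \<le> k \<and> p ^ k \<le> X. ln (real p) * f (p ^ k))"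
proof -
  let ?K = "\<lambda>p. {k. 1 \<le> k \<and> p ^ k \<le> X}"
  let ?K3 = "\<lambda>p. {k. 3 \<le> k \<and> p ^ k \<le> X}"
  have finK: "finite (?K p)" if "p \<in> primes_upto X" for p
  proof (rule finite_subset)
    have "k \<le> X" if "p ^ k \<le> X" for k
    proof -
      have "k < p ^ k" using \<open>p \<in> primes_upto X\<close> prime_gt_Suc_0_nat[of p]
        by (intro power_gt_expt) (auto simp: primes_upto_def)
      then show ?thesis using that by linarith
    qed
    then show "?K p \<subseteq> {..X}" by auto
  qed auto
  have "(\<Sum>q\<in>{1..X}. mangoldt q * f q) = (\<Sum>q | q \<in> {1..X} \<and> primepow q. mangoldt q * f q)"
    by (intro sum.mono_neutral_right) (auto simp: mangoldt_def)
  also have "{q. q \<in> {1..X} \<and> primepow q} = (\<lambda>(p,k). p ^ k) ` Sigma (primes_upto X) ?K"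
  proof (intro equalityI subsetI)
    fix q assume "q \<in> {q. q \<in> {1..X} \<and> primepow q}"
    then obtain p k where "prime p" "k > 0" "q = p ^ k" "q \<le> X"
      by (auto simp: primepow_def)
    moreover from this have "p \<le> p ^ k"
      using prime_gt_0_nat[of p] by (simp add: self_le_power)
    ultimately show "q \<in> (\<lambda>(p,k). p ^ k) ` Sigma (primes_upto X) ?K"
      by (intro image_eqI[of _ _ "(p,k)"]) (auto simp: primes_upto_def)
  next
    fix q assume "q \<in> (\<lambda>(p,k). p ^ k) ` Sigma (primes_upto X) ?K"
    then obtain p k where pk: "prime p" "k \<ge> 1" "q = p ^ k" "p ^ k \<le> X"
      by (auto simp: primes_upto_def)
    then have "p ^ k > 0" using prime_gt_0_nat[of p] by simp
    with pk show "q \<in> {q. q \<in> {1..X} \<and> primepow q}"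
      by (simp add: Suc_leI)
  qed
  also have "(\<Sum>q\<in>\<dots>. mangoldt q * f q)
      = (\<Sum>(p,k)\<in>Sigma (primes_upto X) ?K. mangoldt (p ^ k) * f (p ^ k))"
  proof (subst sum.reindex)
    show "inj_on (\<lambda>(p,k). p ^ k) (Sigma (primes_upto X) ?K)"
    proof (rule inj_onI, clarify)
      fix p k q l assume *: "p \<in> primes_upto X" "q \<in> primes_upto X" "1 \<le> k" "1 \<le> l" "p ^ k = q ^ l"
      then have "prime p" "prime q" "k \<noteq> 0" "l \<noteq> 0" by (auto simp: primes_upto_def)
      then show "p = q \<and> k = l" using prime_power_inj''[of p q k l] * by auto
    qed
  qed (simp add: case_prod_unfold)
  also have "\<dots> = (\<Sum>p\<in>primes_upto X. \<Sum>k\<in>?K p. mangoldt (p ^ k) * f (p ^ k))"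
    using finK by (subst sum.Sigma) auto
  also have "\<dots> = (\<Sum>p\<in>primes_upto X. \<Sum>k\<in>?K p. ln (real p) * f (p ^ k))"
    by (intro sum.cong) (auto simp: primes_upto_def mangoldt_primepow)
  also have "\<dots> \<le> (\<Sum>p\<in>primes_upto X. ln (real p) * f p
       + (if p ^ 2 \<le> X then ln (real p) * f (p ^ 2) else 0)
       + (\<Sum>k\<in>?K3 p. ln (real p) * f (p ^ k)))"
  proof (rule sum_mono)
    fix p assume p: "p \<in> primes_upto X"
    let ?g = "\<lambda>k. ln (real p) * f (p ^ k)"
    have eq: "?K p = {1} \<union> ((if p ^ 2 \<le> X then {2} else {}) \<union> ?K3 p)" (is "_ = ?R")
    proof (intro equalityI subsetI)
      fix k assume k: "k \<in> ?K p"
      consider "k = 1" | "k = 2" | "k \<ge> 3" using k by fastforce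
      then show "k \<in> ?R" using k by cases auto
    qed (use p in \<open>auto simp: primes_upto_def split: if_splits\<close>)
    have fin3: "finite (?K3 p)" using finK[OF p] by (rule finite_subset[rotated]) auto
    have "(\<Sum>k\<in>?K p. ?g k) = ?g 1 + ((\<Sum>k\<in>(if p ^ 2 \<le> X then {2} else {}). ?g k) + (\<Sum>k\<in>?K3 p. ?g k))"
      unfolding eq using fin3 by (subst sum.union_disjoint; (subst sum.union_disjoint)?) auto
    then show "(\<Sum>k\<in>?K p. ?g k) \<le> ln (real p) * f p
       + (if p ^ 2 \<le> X then ln (real p) * f (p ^ 2) else 0) + (\<Sum>k\<in>?K3 p. ?g k)"
      by (auto split: if_splits)
  qed
  also have "\<dots> = (\<Sum>p\<in>primes_upto X. ln (real p) * f p)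
      + (\<Sum>p\<in>primes_upto X. if p ^ 2 \<le> X then ln (real p) * f (p ^ 2) else 0)
      + (\<Sum>p\<in>primes_upto X. \<Sum>k\<in>?K3 p. ln (real p) * f (p ^ k))"
    by (simp add: sum.distrib)
  also have "(\<Sum>p\<in>primes_upto X. if p ^ 2 \<le> X then ln (real p) * f (p ^ 2) else 0)
      = (\<Sum>p | p \<in> primes_upto X \<and> p ^ 2 \<le> X. ln (real p) * f (p ^ 2))"
    by (subst sum.inter_filter [symmetric]) auto
  finally show ?thesis .
qed

lemma geometric_tail_le:
  fixes x :: real
  assumes "0 \<le> x" "x \<le> 1 / sqrt 2" "finite A" "\<And>k. k \<in> A \<Longrightarrow> k \<ge> 3"
  shows "(\<Sum>k\<in>A. x ^ k) \<le> 4 * x ^ 3"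
proof -
  have s2: "1 / sqrt 2 \<le> (3/4::real)"
    by (rule power2_le_imp_le) (auto simp: power_divide power2_eq_square)
  then have x: "x \<le> 3/4" using assms by linarith
  have "(\<Sum>k\<in>A. x ^ k) = (\<Sum>k\<in>(\<lambda>k. k - 3) ` A. x ^ 3 * x ^ k)"
  proof (subst sum.reindex)
    show "inj_on (\<lambda>k. k - 3) A" using assms(4) by (intro inj_onI) (metis le_add_diff_inverse)
    show "(\<Sum>k\<in>A. x ^ k) = sum ((\<lambda>k. x ^ 3 * x ^ k) \<circ> (\<lambda>k. k - 3)) A"
      using assms(4) by (intro sum.cong refl) (simp add: power_add [symmetric])
  qed
  also have "\<dots> = x ^ 3 * (\<Sum>k\<in>(\<lambda>k. k - 3) ` A. x ^ k)" by (simp add: sum_distrib_left)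
  also have "\<dots> \<le> x ^ 3 * 4"
  proof (rule mult_left_mono)
    have "(\<Sum>k\<in>(\<lambda>k. k - 3) ` A. x ^ k) \<le> (\<Sum>k. x ^ k)"
      using assms x by (intro sum_le_suminf summable_geometric) auto
    also have "(\<Sum>k. x ^ k) = 1 / (1 - x)" using assms x by (intro suminf_geometric) auto
    also have "1 / (1 - x) \<le> 4" using x by (simp add: field_simps)
    finally show "(\<Sum>k\<in>(\<lambda>k. k - 3) ` A. x ^ k) \<le> 4" .
  qed (use assms in simp)
  finally show ?thesis using assms by simp
qed

text \<open>
  For fixed \<open>p\<close> the inner sum is the tail of a geometric series of ratio \<open>1 / sqrt p\<close> and of order
  \<open>p^(-3/2)\<close>.
\<close>
lemma sum_prime_cubes_bounded:
  obtains c where "\<And>X :: nat. (\<Sum>p\<in>primes_upto X. \<Sum>k | 3 \<le> k \<and> p ^ k \<le> X.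
    ln (real p) * (1 / sqrt (real (p ^ k)))) \<le> c"
proof -
  obtain c where c: "\<And>A :: nat set. finite A \<Longrightarrow> (\<Sum>n\<in>A. ln (real n) * real n powr - (3/2)) \<le> c"
    using sum_ln_powr_bounded[of "3/2"] by auto
  have "(\<Sum>p\<in>primes_upto X. \<Sum>k | 3 \<le> k \<and> p ^ k \<le> X.
    ln (real p) * (1 / sqrt (real (p ^ k)))) \<le> 4 * c" for X
  proof -
    have "(\<Sum>k | 3 \<le> k \<and> p ^ k \<le> X. ln (real p) * (1 / sqrt (real (p ^ k))))
        \<le> 4 * (ln (real p) * real p powr - (3/2))" if "p \<in> primes_upto X" for p
    proof -
      have p: "p \<ge> 2" using that prime_ge_2_nat by (auto simp: primes_upto_def)
      have fin: "finite {k. 3 \<le> k \<and> p ^ k \<le> X}"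
      proof (rule finite_subset)
        show "{k. 3 \<le> k \<and> p ^ k \<le> X} \<subseteq> {..X}"
        proof safe
          fix k assume "p ^ k \<le> X"
          moreover have "k < p ^ k" using p by (intro power_gt_expt) auto
          ultimately show "k \<le> X" by linarith
        qed
      qed auto
      have "(\<Sum>k | 3 \<le> k \<and> p ^ k \<le> X. ln (real p) * (1 / sqrt (real (p ^ k))))
          = ln (real p) * (\<Sum>k | 3 \<le> k \<and> p ^ k \<le> X. (1 / sqrt (real p)) ^ k)"
        by (simp add: sum_distrib_left real_sqrt_power power_divide)
      also have "\<dots> \<le> ln (real p) * (4 * (1 / sqrt (real p)) ^ 3)"
        using p fin by (intro mult_left_mono geometric_tail_le) (auto simp: field_simps)
      also have "(1 / sqrt (real p)) ^ 3 = real p powr - (3/2)"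
      proof -
        have "(1 / sqrt (real p)) ^ 3 = (real p powr - (1/2)) powr 3"
          using p by (simp add: powr_half_sqrt powr_minus field_simps)
        also have "\<dots> = real p powr - (3/2)" by (simp only: powr_powr) simp
        finally show ?thesis .
      qed
      finally show ?thesis by simp
    qed
    then have "(\<Sum>p\<in>primes_upto X. \<Sum>k | 3 \<le> k \<and> p ^ k \<le> X.
      ln (real p) * (1 / sqrt (real (p ^ k)))) \<le> (\<Sum>p\<in>primes_upto X. 4 * (ln (real p) * real p powr - (3/2)))"
      by (intro sum_mono) auto
    also have "\<dots> = 4 * (\<Sum>p\<in>primes_upto X. ln (real p) * real p powr - (3/2))"
      by (simp add: sum_distrib_left)
    also have "\<dots> \<le> 4 * c" using c[of "primes_upto X"] by simp
    finally show ?thesis .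
  qed
  then show ?thesis using that by blast
qed

lemma sum_ln_div_square_bounded:
  obtains c where "\<And>A :: nat set. finite A \<Longrightarrow> (\<Sum>n\<in>A. ln (real n) / real n ^ 2) \<le> c"
proof -
  obtain c where c: "\<And>A :: nat set. finite A \<Longrightarrow> (\<Sum>n\<in>A. ln (real n) * real n powr - 2) \<le> c"
    using sum_ln_powr_bounded[of 2] by auto
  have "(\<Sum>n\<in>A. ln (real n) / real n ^ 2) \<le> c" if "finite A" for A :: "nat set"
  proof -
    have eq: "real n powr - 2 = 1 / real n ^ 2" for n
      using powr_minus[of "real n" 2] by (cases "n = 0") (auto simp: field_simps)
    show ?thesis using c[OF that] unfolding eq by simp
  qed
  then show ?thesis using that by blast
qed

lemma ln_fact_ge: "n \<ge> 1 \<Longrightarrow> (\<Sum>k\<in>{1..n}. ln (real k)) \<ge> real n * ln (real n) - real n"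
proof (induction n rule: nat_induct_at_least)
  case (Suc n)
  have "1 + 1 / real n = real (Suc n) / real n" using Suc.hyps by (simp add: field_simps)
  then have "ln (real (Suc n)) - ln (real n) = ln (1 + 1 / real n)"
    using Suc.hyps by (simp add: ln_div)
  also have "\<dots> \<le> 1 / real n" using Suc.hyps by (intro ln_add_one_self_le_self) auto
  finally have "real n * (ln (real (Suc n)) - ln (real n)) \<le> 1"
    using Suc.hyps by (simp add: field_simps)
  then have "real (Suc n) * ln (real (Suc n)) - real (Suc n)
      \<le> real n * ln (real n) - real n + ln (real (Suc n))"
    by (simp add: algebra_simps)
  with Suc.IH show ?case by simp
qed simp

lemma card_multiples_le: "real (card {n \<in> {1..N}. d dvd n}) \<le> real N / real d" if "d > 0" for d N :: nat
proof -
  have "{n \<in> {1..N}. d dvd n} \<subseteq> (\<lambda>k. d * k) ` {1..N div d}"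
  proof safe
    fix n assume "n \<in> {1..N}" "d dvd n"
    then obtain k where "n = d * k" by auto
    with \<open>n \<in> {1..N}\<close> that show "n \<in> (\<lambda>k. d * k) ` {1..N div d}"
      by (auto simp: less_eq_div_iff_mult_less_eq mult.commute)
  qed
  then have "card {n \<in> {1..N}. d dvd n} \<le> card ((\<lambda>k. d * k) ` {1..N div d})"
    by (intro card_mono) auto
  also have "\<dots> \<le> N div d" using card_image_le[of "{1..N div d}" "\<lambda>k. d * k"] by simp
  finally have "real (card {n \<in> {1..N}. d dvd n}) \<le> real (N div d)" by simp
  also have "\<dots> \<le> real N / real d" by (rule of_nat_div_le_of_nat)
  finally show ?thesis .
qed

text \<open>
  Mertens' lower bound: \<open>ln (n!)\<close> is the sum of \<open>\<Lambda>(d) \<lfloor>n / d\<rfloor>\<close>, where \<open>\<Lambda>\<close> is the von Mangoldt function, and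
  proper prime powers contribute a bounded amount after division by \<open>n\<close>.
\<close>
lemma sum_ln_div_primes_ge:
  obtains c where "\<And>n :: nat. n \<ge> 1 \<Longrightarrow> (\<Sum>p\<in>primes_upto n. ln (real p) / real p) \<ge> ln (real n) - c"
proof -
  obtain c2 where c2: "\<And>A :: nat set. finite A \<Longrightarrow> (\<Sum>n\<in>A. ln (real n) / real n ^ 2) \<le> c2"
    using sum_ln_div_square_bounded by auto
  obtain c3 where c3: "\<And>X :: nat. (\<Sum>p\<in>primes_upto X. \<Sum>k | 3 \<le> k \<and> p ^ k \<le> X.
    ln (real p) * (1 / sqrt (real (p ^ k)))) \<le> c3"
    using sum_prime_cubes_bounded by auto
  have "(\<Sum>p\<in>primes_upto n. ln (real p) / real p) \<ge> ln (real n) - (1 + c2 + c3)"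
    if n: "n \<ge> 1" for n
  proof -
    have "real n * ln (real n) - real n \<le> (\<Sum>k\<in>{1..n}. ln (real k))"
      using ln_fact_ge n by simp
    also have "\<dots> = (\<Sum>k\<in>{1..n}. \<Sum>d | d dvd k. mangoldt d)"
      using mangoldt_sum[where 'a = real] by (intro sum.cong) auto
    also have "\<dots> = (\<Sum>k\<in>{1..n}. \<Sum>d | d \<in> {1..n} \<and> d dvd k. mangoldt d)"
      by (intro sum.cong refl) (auto dest: dvd_imp_le intro: Suc_leI Nat.gr0I)
    also have "\<dots> = (\<Sum>d\<in>{1..n}. \<Sum>k | k \<in> {1..n} \<and> d dvd k. mangoldt d)"
      by (rule sum.swap_restrict) auto
    also have "\<dots> = (\<Sum>d\<in>{1..n}. mangoldt d * real (card {k \<in> {1..n}. d dvd k}))"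
      by (simp add: mult.commute)
    also have "\<dots> \<le> (\<Sum>d\<in>{1..n}. mangoldt d * (real n / real d))"
      by (intro sum_mono mult_left_mono card_multiples_le mangoldt_nonneg) auto
    also have "\<dots> = real n * (\<Sum>d\<in>{1..n}. mangoldt d * (1 / real d))"
      by (simp add: sum_distrib_left mult_ac)
    finally have "real n * (ln (real n) - 1) \<le> real n * (\<Sum>d\<in>{1..n}. mangoldt d * (1 / real d))"
      by (simp add: algebra_simps)
    then have "ln (real n) - 1 \<le> (\<Sum>d\<in>{1..n}. mangoldt d * (1 / real d))"
      using n by simp
    also have "\<dots> \<le> (\<Sum>p\<in>primes_upto n. ln (real p) * (1 / real p))
      + (\<Sum>p | p \<in> primes_upto n \<and> p ^ 2 \<le> n. ln (real p) * (1 / real (p ^ 2)))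
      + (\<Sum>p\<in>primes_upto n. \<Sum>k | 3 \<le> k \<and> p ^ k \<le> n. ln (real p) * (1 / real (p ^ k)))"
      by (rule sum_mangoldt_le) auto
    also have "(\<Sum>p | p \<in> primes_upto n \<and> p ^ 2 \<le> n. ln (real p) * (1 / real (p ^ 2))) \<le> c2"
      using c2[of "{p. p \<in> primes_upto n \<and> p ^ 2 \<le> n}"] by simp
    also have "(\<Sum>p\<in>primes_upto n. \<Sum>k | 3 \<le> k \<and> p ^ k \<le> n. ln (real p) * (1 / real (p ^ k)))
       \<le> (\<Sum>p\<in>primes_upto n. \<Sum>k | 3 \<le> k \<and> p ^ k \<le> n. ln (real p) * (1 / sqrt (real (p ^ k))))"
    proof (intro sum_mono mult_left_mono)
      fix p k assume "p \<in> primes_upto n"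
      then have p: "p \<ge> 1" using prime_ge_1_nat by (auto simp: primes_upto_def)
      then have "1 \<le> real (p ^ k)" by (simp del: of_nat_power)
      then have "sqrt (real (p ^ k)) \<le> real (p ^ k)"
        using real_sqrt_le_mono[of "real (p ^ k)" "real (p ^ k) ^ 2"] 
        by (auto simp: self_le_power simp del: of_nat_power)
      moreover have "0 < real (p ^ k)" using p by simp
      ultimately show "1 / real (p ^ k) \<le> 1 / sqrt (real (p ^ k))"
        by (intro divide_left_mono mult_pos_pos) (auto simp del: of_nat_power)
      show "0 \<le> ln (real p)" using p by simp
    qed
    also note c3[of n]
    finally show ?thesis by simp
  qed
  then show ?thesis using that by blast
qed

section \<open>Points of plane lattices in squares\<close>

text \<open>
  Thue's lemma. The pigeonhole principle gives a nonzero vector with both coordinates at most \<open>sqrt p\<close>;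
  the greatest common divisor of the coordinates is prime to \<open>p\<close>, so it can be divided out.
\<close>
lemma short_lattice_vector:
  fixes r :: int
  assumes "prime p"
  obtains a b :: int where "coprime a b" "int p dvd a - r * b" "(max \<bar>a\<bar> \<bar>b\<bar>) ^ 2 \<le> int p"
proof -
  have p2: "p \<ge> 2" using assms by (rule prime_ge_2_nat)
  define k where "k = (LEAST k. p < (k + 1) ^ 2)"
  have k1: "p < (k + 1) ^ 2"
    unfolding k_def by (rule LeastI[of _ p]) (simp add: power2_eq_square)
  have k2: "k ^ 2 \<le> p"
  proof (cases k)
    case (Suc j)
    then have "\<not> p < (j + 1) ^ 2" using not_less_Least[of j "\<lambda>k. p < (k + 1) ^ 2"] by (simp add: k_def)
    then show ?thesis using Suc by simp
  qed auto
  define f where "f = (\<lambda>(x, y). (x - r * y) mod int p)"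
  let ?A = "{0..int k} \<times> {0..int k}"
  have "\<not> inj_on f ?A"
  proof (rule pigeonhole)
    have "f ` ?A \<subseteq> {0..<int p}" using p2 by (auto simp: f_def)
    then have "card (f ` ?A) \<le> card {0..<int p}" by (intro card_mono) auto
    also have "\<dots> < card ?A" using k1 by (simp add: power2_eq_square card_cartesian_product nat_add_distrib)
    finally show "card (f ` ?A) < card ?A" .
  qed
  then obtain x y x' y' where *: "x \<in> {0..int k}" "y \<in> {0..int k}" "x' \<in> {0..int k}" "y' \<in> {0..int k}"
    "f (x, y) = f (x', y')" "(x, y) \<noteq> (x', y')"
    by (auto simp: inj_on_def)
  define A B where "A = x - x'" and "B = y - y'"
  have AB: "\<bar>A\<bar> \<le> int k" "\<bar>B\<bar> \<le> int k" "A \<noteq> 0 \<or> B \<noteq> 0" using * by (auto simp: A_def B_def)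
  have "int p dvd (x - r * y) - (x' - r * y')"
    using *(5) by (simp add: f_def mod_eq_dvd_iff)
  then have dvd: "int p dvd A - r * B" by (simp add: A_def B_def algebra_simps)
  let ?g = "gcd A B"
  have g0: "?g \<noteq> 0" "?g > 0" using AB by auto
  obtain a b where ab: "A = a * ?g" "B = b * ?g" "coprime a b"
    using gcd_coprime_exists[OF g0(1)] by blast
  have gk: "?g \<le> int k"
  proof (cases "A = 0")
    case True
    then have "?g \<le> \<bar>B\<bar>" by simp
    then show ?thesis using AB by linarith
  next
    case False
    then have "?g \<le> \<bar>A\<bar>" by (intro zdvd_imp_le) auto
    then show ?thesis using AB by linarith
  qed
  have "\<not> int p dvd ?g"
  proof
    assume "int p dvd ?g"
    then have "int p \<le> int k" using g0 gk by (meson order_trans zdvd_imp_le)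
    then have "p ^ 2 \<le> k ^ 2" by (intro power_mono) auto
    then have "p * p \<le> p" using k2 by (metis order_trans power2_eq_square)
    then show False using p2 by simp
  qed
  moreover have "A - r * B = ?g * (a - r * b)" using ab(1,2) by (metis mult.assoc mult.commute right_diff_distrib)
  ultimately have "int p dvd a - r * b"
    using dvd assms prime_dvd_multD[of "int p" ?g "a - r * b"]
    by (metis prime_nat_int_transfer)
  moreover have "\<bar>a\<bar> \<le> int k" "\<bar>b\<bar> \<le> int k"
  proof -
    have "\<bar>a\<bar> * 1 \<le> \<bar>a\<bar> * ?g" "\<bar>b\<bar> * 1 \<le> \<bar>b\<bar> * ?g"
      using mult_left_mono[of 1 ?g "\<bar>a\<bar>"] mult_left_mono[of 1 ?g "\<bar>b\<bar>"] g0(2) by linarith+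
    moreover have "\<bar>A\<bar> = \<bar>a\<bar> * ?g" "\<bar>B\<bar> = \<bar>b\<bar> * ?g"
      using ab(1,2) g0(2) by (metis abs_mult abs_of_pos)+
    ultimately show "\<bar>a\<bar> \<le> int k" "\<bar>b\<bar> \<le> int k" using AB by linarith+
  qed
  then have "(max \<bar>a\<bar> \<bar>b\<bar>) ^ 2 \<le> int k ^ 2" by (intro power_mono) auto
  then have "(max \<bar>a\<bar> \<bar>b\<bar>) ^ 2 \<le> int p" using k2 by (metis of_nat_mono of_nat_power order_trans)
  ultimately show ?thesis using that ab(3) by blast
qed

text \<open>
  The coefficient of larger absolute value serves as the modulus for the variable of the other one.
\<close>
lemma linear_congruence_bounded_solution:
  fixes a b c P :: int
  assumes "coprime a b" "\<bar>b\<bar> \<le> \<bar>a\<bar>" "a \<noteq> 0" "\<bar>c\<bar> \<le> P"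
  obtains X Y where "a * Y = c + b * X" "\<bar>X\<bar> \<le> P div \<bar>a\<bar> + \<bar>a\<bar>" "\<bar>Y\<bar> \<le> P div \<bar>a\<bar> + \<bar>a\<bar>"
proof -
  obtain u v where uv: "u * a + v * b = 1" using bezout_int[of a b] assms(1) by auto
  define X where "X = (- c * v) mod \<bar>a\<bar>"
  have X: "0 \<le> X" "X < \<bar>a\<bar>" using assms(3) by (auto simp: X_def)
  have "a dvd X - (- c * v)" by (metis X_def abs_dvd_iff dvd_minus_mod dvd_diff_commute)
  then have "a dvd b * (X - (- c * v)) + (c * u) * a" by simp
  also have "b * (X - (- c * v)) + (c * u) * a = b * X + c * (u * a + v * b)" by (simp add: algebra_simps)
  also have "\<dots> = c + b * X" using uv by simp
  finally obtain Y where Y: "c + b * X = a * Y" by auto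
  have P0: "P \<ge> 0" using assms(4) by linarith
  have "\<bar>a\<bar> * \<bar>Y\<bar> = \<bar>c + b * X\<bar>" using Y by (simp add: abs_mult)
  also have "\<dots> \<le> P + \<bar>b\<bar> * X" using assms(4) X abs_triangle_ineq[of c "b * X"] by (simp add: abs_mult)
  also have "\<bar>b\<bar> * X \<le> \<bar>a\<bar> * \<bar>a\<bar>" using X assms by (intro mult_mono) auto
  finally have "(\<bar>Y\<bar> - \<bar>a\<bar>) * \<bar>a\<bar> \<le> P" by (simp add: algebra_simps)
  then have "(\<bar>Y\<bar> - \<bar>a\<bar>) * \<bar>a\<bar> div \<bar>a\<bar> \<le> P div \<bar>a\<bar>" using assms(3) by (intro zdiv_mono1) auto
  then have "\<bar>Y\<bar> - \<bar>a\<bar> \<le> P div \<bar>a\<bar>" using assms(3) by simp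
  moreover have "P div \<bar>a\<bar> \<ge> 0" using P0 by (simp add: div_int_pos_iff)
  ultimately show ?thesis using that[of Y X] Y X by auto
qed

text \<open>
  The lattice \<open>x \<equiv> r y (mod p)\<close> has index \<open>p\<close> and contains the primitive vector \<open>(a, b)\<close> of sup norm
  \<open>s\<close>, so its covering radius is about \<open>p / s\<close>. Concretely, the coset \<open>X - r Y \<equiv> i\<close> is
  described by \<open>a Y - b X \<equiv> - b i\<close>, and for a representative \<open>c\<close> of \<open>- b i\<close> between \<open>0\<close> and
  \<open>p\<close> the equation \<open>a Y - b X = c\<close> has a solution of the required size, because \<open>a\<close> and \<open>b\<close> are
  coprime.
\<close>
lemma bounded_coset_representative:
  fixes r i :: int
  assumes p: "prime p" and ab: "coprime a b" "int p dvd a - r * b"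
    and s: "s = max \<bar>a\<bar> \<bar>b\<bar>" "s ^ 2 \<le> int p"
  obtains X Y :: int where "int p dvd X - r * Y - i"
    "\<bar>X\<bar> \<le> int p div s + s" "\<bar>Y\<bar> \<le> int p div s + s"
proof -
  have p2: "p \<ge> 2" using p by (rule prime_ge_2_nat)
  have sp: "s < int p"
  proof (rule ccontr)
    assume "\<not> s < int p"
    then have "int p ^ 2 \<le> s ^ 2" by (intro power_mono) auto
    then have "int p * int p \<le> int p * 1" using s(2) by (simp add: power2_eq_square)
    then show False using p2 by simp
  qed
  have nz: "a \<noteq> 0 \<or> b \<noteq> 0" using ab(1) by auto
  have b: "\<not> int p dvd b"
  proof
    assume "int p dvd b"
    then have "int p dvd a - r * b + r * b" using ab(2) by (intro dvd_add) auto
    then have "int p dvd a" by simp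
    with \<open>int p dvd b\<close> nz sp s show False
      by (auto dest!: zdvd_imp_le[of "int p" "\<bar>a\<bar>", simplified] zdvd_imp_le[of "int p" "\<bar>b\<bar>", simplified])
  qed
  define c where "c = (- b * i) mod int p"
  have c: "\<bar>c\<bar> \<le> int p" using p2 by (simp add: c_def less_imp_le)
  have cdvd: "int p dvd c + b * i"
    by (simp add: c_def mod_eq_0_iff_dvd [symmetric] mod_simps)
  have key: "int p dvd X - r * Y - i" if "a * Y = c + b * X" for X Y
  proof -
    have "b * (X - r * Y - i) = (a - r * b) * Y - (c + b * i)" using that by (simp add: algebra_simps)
    then have "int p dvd b * (X - r * Y - i)" using ab(2) cdvd by simp
    then show ?thesis using b p prime_dvd_multD[of "int p"] by auto
  qed
  show ?thesis
  proof (cases "\<bar>b\<bar> \<le> \<bar>a\<bar>")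
    case True
    then have "a \<noteq> 0" using nz by auto
    obtain X Y where "a * Y = c + b * X" "\<bar>X\<bar> \<le> int p div \<bar>a\<bar> + \<bar>a\<bar>" "\<bar>Y\<bar> \<le> int p div \<bar>a\<bar> + \<bar>a\<bar>"
      by (rule linear_congruence_bounded_solution[OF ab(1) True \<open>a \<noteq> 0\<close> c])
    then show ?thesis using key that True s by auto
  next
    case False
    then have *: "coprime b a" "\<bar>a\<bar> \<le> \<bar>b\<bar>" "b \<noteq> 0" "\<bar>- c\<bar> \<le> int p"
      using ab(1) c by (auto simp: coprime_commute)
    obtain Y X where "b * X = - c + a * Y" "\<bar>Y\<bar> \<le> int p div \<bar>b\<bar> + \<bar>b\<bar>" "\<bar>X\<bar> \<le> int p div \<bar>b\<bar> + \<bar>b\<bar>"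
      by (rule linear_congruence_bounded_solution[OF *])
    moreover from this have "a * Y = c + b * X" by simp
    moreover have "s = \<bar>b\<bar>" using False s by simp
    ultimately show ?thesis using key[of Y X] that[of X Y] by simp
  qed
qed

definition int_square :: "int \<Rightarrow> int \<Rightarrow> int \<Rightarrow> (int \<times> int) set" where
  "int_square x0 y0 N = {x0<..x0 + N} \<times> {y0<..y0 + N}"

definition cong_lattice :: "nat \<Rightarrow> int \<Rightarrow> (int \<times> int) set" where
  "cong_lattice q r = {(x, y). int q dvd x - r * y}"

lemma finite_int_square [simp, intro]: "finite (int_square x0 y0 N)"
  by (simp add: int_square_def)

lemma card_int_square: "N \<ge> 0 \<Longrightarrow> card (int_square x0 y0 N) = nat N ^ 2"
  by (simp add: int_square_def card_cartesian_product power2_eq_square)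

lemma card_residue_class_le:
  fixes a z :: int
  assumes "q > 0"
  shows "real (card {x \<in> {a<..a + int N}. int q dvd x - z}) \<le> real N / real q + 1"
proof -
  let ?lo = "(a - z) div int q" and ?hi = "(a + int N - z) div int q"
  have "{x \<in> {a<..a + int N}. int q dvd x - z} \<subseteq> (\<lambda>k. z + int q * k) ` {?lo<..?hi}"
  proof safe
    fix x assume x: "x \<in> {a<..a + int N}" "int q dvd x - z"
    then obtain k where k: "x - z = int q * k" by auto
    have "a - z < k * int q" "k * int q \<le> a + int N - z" using x k by (auto simp: mult.commute)
    moreover have "?lo * int q \<le> a - z" "a + int N - z < (?hi + 1) * int q"
      using pos_mod_sign[of "int q" "a - z"] pos_mod_bound[of "int q" "a + int N - z"] assms
        div_mult_mod_eq[of "a - z" "int q"] div_mult_mod_eq[of "a + int N - z" "int q"]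
      unfolding distrib_right by linarith+
    ultimately have "?lo * int q < k * int q" "k * int q < (?hi + 1) * int q" by linarith+
    then have "?lo < k" "k < ?hi + 1" using assms by (auto simp: mult_less_cancel_right)
    then show "x \<in> (\<lambda>k. z + int q * k) ` {?lo<..?hi}" using k by (intro image_eqI[of _ _ k]) auto
  qed
  then have "card {x \<in> {a<..a + int N}. int q dvd x - z} \<le> card ((\<lambda>k. z + int q * k) ` {?lo<..?hi})"
    by (intro card_mono) auto
  also have "\<dots> \<le> card {?lo<..?hi}" by (rule card_image_le) auto
  also have "\<dots> = nat (?hi - ?lo)" by simp
  finally have "real (card {x \<in> {a<..a + int N}. int q dvd x - z}) \<le> real (nat (?hi - ?lo))" by simp
  also have "\<dots> \<le> real N / real q + 1"
  proof -
    have "?hi * int q \<le> a + int N - z" "a - z < ?lo * int q + int q"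
      using pos_mod_bound[of "int q" "a - z"] pos_mod_sign[of "int q" "a + int N - z"] assms
        div_mult_mod_eq[of "a - z" "int q"] div_mult_mod_eq[of "a + int N - z" "int q"]
      by linarith+
    then have "(?hi - ?lo) * int q \<le> int N + int q" unfolding left_diff_distrib by linarith
    then have "real_of_int ((?hi - ?lo) * int q) \<le> real_of_int (int N + int q)" by (simp only: of_int_le_iff)
    then have "real_of_int (?hi - ?lo) * real q \<le> real N + real q" by simp
    then have "real_of_int (?hi - ?lo) \<le> real N / real q + 1"
      using assms by (simp add: field_simps)
    moreover have "0 \<le> real N / real q + 1" by simp
    ultimately show ?thesis by (cases "?hi - ?lo \<ge> 0") auto
  qed
  finally show ?thesis .
qed

lemma card_lattice_box_le:
  assumes "q > 0"
  shows "real (card (cong_lattice q r \<inter> int_square x0 y0 (int N))) \<le> real N * (real N / real q + 1)"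
proof -
  have "cong_lattice q r \<inter> int_square x0 y0 (int N) =
    (\<Union>y\<in>{y0<..y0 + int N}. (\<lambda>x. (x, y)) ` {x \<in> {x0<..x0 + int N}. int q dvd x - r * y})"
    by (auto simp: cong_lattice_def int_square_def)
  then have "card (cong_lattice q r \<inter> int_square x0 y0 (int N))
     \<le> (\<Sum>y\<in>{y0<..y0 + int N}. card ((\<lambda>x. (x, y)) ` {x \<in> {x0<..x0 + int N}. int q dvd x - r * y}))"
    by (simp add: card_UN_le)
  also have "\<dots> = (\<Sum>y\<in>{y0<..y0 + int N}. card {x \<in> {x0<..x0 + int N}. int q dvd x - r * y})"
    by (intro sum.cong refl card_image) (auto simp: inj_on_def)
  finally have "real (card (cong_lattice q r \<inter> int_square x0 y0 (int N)))
     \<le> (\<Sum>y\<in>{y0<..y0 + int N}. real (card {x \<in> {x0<..x0 + int N}. int q dvd x - r * y}))"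
    by (simp flip: of_nat_sum)
  also have "\<dots> \<le> (\<Sum>y\<in>{y0<..y0 + int N}. real N / real q + 1)"
    by (intro sum_mono card_residue_class_le assms)
  finally show ?thesis by simp
qed

text \<open>
  If every coset has a representative of sup norm at most \<open>d\<close>, then the representatives form a
  fundamental domain of \<open>q\<close> points and diameter about \<open>2 d\<close>. Its translates by the lattice points of a
  square cover the square shrunk by \<open>d\<close> on each side, and they are disjoint and stay
  within the square enlarged by \<open>d\<close>.
\<close>
lemma lattice_box_fundamental_domain:
  fixes d :: int
  assumes q: "q > 0" and d: "d \<ge> 0"
    and rep: "\<And>i. \<exists>X Y. int q dvd X - r * Y - i \<and> \<bar>X\<bar> \<le> d \<and> \<bar>Y\<bar> \<le> d"
  shows "real (card (cong_lattice q r \<inter> int_square x0 y0 (int N))) * real q \<le> (real N + 2 * real_of_int d) ^ 2" (is ?upper)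
    and "real N ^ 2 - 4 * real N * real_of_int d \<le> real (card (cong_lattice q r \<inter> int_square x0 y0 (int N))) * real q" (is ?lower)
proof -
  from rep have "\<exists>t. \<forall>i. int q dvd fst (t i) - r * snd (t i) - i \<and> \<bar>fst (t i)\<bar> \<le> d \<and> \<bar>snd (t i)\<bar> \<le> d"
    by (intro choice) (metis fst_conv snd_conv)
  then obtain t where t: "\<And>i. int q dvd fst (t i) - r * snd (t i) - i"
    "\<And>i. \<bar>fst (t i)\<bar> \<le> d" "\<And>i. \<bar>snd (t i)\<bar> \<le> d" by blast
  let ?L = "cong_lattice q r \<inter> int_square x0 y0 (int N)"
  have finL: "finite ?L" by auto
  have card: "card (?L \<times> {0..<int q}) = card ?L * q" by (simp add: card_cartesian_product)
  show ?upper
  proof -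
    let ?f = "\<lambda>(v, i). (fst v + fst (t i), snd v + snd (t i))"
    have "inj_on ?f (?L \<times> {0..<int q})"
    proof (rule inj_onI)
      fix u v assume uv: "u \<in> ?L \<times> {0..<int q}" "v \<in> ?L \<times> {0..<int q}" "?f u = ?f v"
      obtain x y i x' y' j where [simp]: "u = ((x, y), i)" "v = ((x', y'), j)"
        by (metis surj_pair)
      have *: "(x, y) \<in> cong_lattice q r" "(x', y') \<in> cong_lattice q r" "i \<in> {0..<int q}" "j \<in> {0..<int q}"
        "x + fst (t i) = x' + fst (t j)" "y + snd (t i) = y' + snd (t j)"
        using uv by auto
      have "int q dvd (x - r * y) + (fst (t i) - r * snd (t i) - i) - (x' - r * y') - (fst (t j) - r * snd (t j) - j)"
        using * by (intro dvd_diff[OF dvd_diff[OF dvd_add]] t(1)) (auto simp: cong_lattice_def)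
      also have "\<dots> = j - i + ((x + fst (t i)) - (x' + fst (t j))) - r * ((y + snd (t i)) - (y' + snd (t j)))"
        by (simp add: algebra_simps)
      also have "\<dots> = j - i" using *(5,6) by simp
      finally have "i = j" using *(3,4) by (auto simp: mod_eq_dvd_iff[symmetric])
      with *(5,6) show "u = v" by simp
    qed
    then have "card (?L \<times> {0..<int q}) = card (?f ` (?L \<times> {0..<int q}))" by (simp add: card_image)
    also have "\<dots> \<le> card (int_square (x0 - d) (y0 - d) (int N + 2 * d))"
    proof (rule card_mono)
      show "?f ` (?L \<times> {0..<int q}) \<subseteq> int_square (x0 - d) (y0 - d) (int N + 2 * d)"
      proof clarify
        fix x y i assume "(x, y) \<in> int_square x0 y0 (int N)"
        then show "(fst (x, y) + fst (t i), snd (x, y) + snd (t i)) \<in> int_square (x0 - d) (y0 - d) (int N + 2 * d)"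
          using t(2)[of i] t(3)[of i] by (auto simp: int_square_def)
      qed
    qed auto
    also have "\<dots> = nat (int N + 2 * d) ^ 2" using d by (intro card_int_square) auto
    finally have "real (card ?L * q) \<le> real (nat (int N + 2 * d) ^ 2)" unfolding card by (rule of_nat_mono)
    then show ?thesis using d by simp
  qed
  show ?lower
  proof (cases "2 * d \<le> int N")
    case False
    then have "real N \<le> 4 * real_of_int d" using d by linarith
    then have "real N * real N \<le> real N * (4 * real_of_int d)" by (intro mult_left_mono) auto
    then have "real N ^ 2 - 4 * real N * real_of_int d \<le> 0" by (simp add: power2_eq_square)
    also have "0 \<le> real (card ?L) * real q" by simp
    finally show ?thesis .
  next
    case True
    let ?i = "\<lambda>v. (fst v - r * snd v) mod int q"
    let ?f = "\<lambda>v. ((fst v - fst (t (?i v)), snd v - snd (t (?i v))), ?i v)"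
    let ?B = "int_square (x0 + d) (y0 + d) (int N - 2 * d)"
    have "nat (int N - 2 * d) ^ 2 = card ?B" using True by (intro card_int_square [symmetric]) auto
    also have "\<dots> \<le> card (?L \<times> {0..<int q})"
    proof (rule card_inj_on_le)
      show "inj_on ?f ?B"
        by (rule inj_onI) (auto simp: prod_eq_iff)
      show "?f ` ?B \<subseteq> ?L \<times> {0..<int q}"
      proof (clarify, intro conjI SigmaI IntI)
        fix x y assume B: "(x, y) \<in> ?B"
        let ?j = "?i (x, y)"
        have "int q dvd (x - r * y - ?j) - (fst (t ?j) - r * snd (t ?j) - ?j)"
          by (rule dvd_diff[OF _ t(1)]) (use dvd_minus_mod[of "int q" "x - r * y"] in simp)
        then show "(fst (x, y) - fst (t ?j), snd (x, y) - snd (t ?j)) \<in> cong_lattice q r"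
          by (simp add: cong_lattice_def algebra_simps)
        show "(fst (x, y) - fst (t ?j), snd (x, y) - snd (t ?j)) \<in> int_square x0 y0 (int N)"
          using B t(2)[of ?j] t(3)[of ?j] by (auto simp: int_square_def)
        show "?j \<in> {0..<int q}" using q by auto
      qed
    qed (use finL in auto)
    also note card
    finally have "real (nat (int N - 2 * d) ^ 2) \<le> real (card ?L * q)" by (rule of_nat_mono)
    then have "(real N - 2 * real_of_int d) ^ 2 \<le> real (card ?L) * real q" using True by simp
    moreover have "real N ^ 2 - 4 * real N * real_of_int d \<le> (real N - 2 * real_of_int d) ^ 2"
      by (simp add: power2_eq_square algebra_simps)
    ultimately show ?thesis by linarith
  qed
qed

text \<open>
  Combines Thue's lemma with the covering radius \<open>p / s + s \<le> 2 p / s\<close> of the lattice: both errors in the count are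
  governed by the sup norm \<open>s\<close> of a single short vector, so that an error is large only if the lattice
  contains an exceptionally short vector. In the upper bound, the mixed term of \<open>(N + 2 d)^2\<close> is
  absorbed into a factor \<open>3/2\<close> of the main term.
\<close>
lemma short_vector_counts_lattice:
  fixes r :: int
  assumes "prime p"
  obtains a b :: int where "coprime a b" "int p dvd a - r * b" "1 \<le> max \<bar>a\<bar> \<bar>b\<bar>"
    "(max \<bar>a\<bar> \<bar>b\<bar>) ^ 2 \<le> int p"
    "\<And>x0 y0 N. real (card (cong_lattice p r \<inter> int_square x0 y0 (int N)))
        \<le> 3/2 * real N ^ 2 / real p + 48 * real p / real_of_int (max \<bar>a\<bar> \<bar>b\<bar>) ^ 2"
    "\<And>x0 y0 N. real N ^ 2 / real p - 8 * real N / real_of_int (max \<bar>a\<bar> \<bar>b\<bar>)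
        \<le> real (card (cong_lattice p r \<inter> int_square x0 y0 (int N)))"
proof -
  have p0: "p > 0" using assms prime_gt_0_nat by blast
  obtain a b :: int where ab: "coprime a b" "int p dvd a - r * b" "(max \<bar>a\<bar> \<bar>b\<bar>) ^ 2 \<le> int p"
    by (rule short_lattice_vector[OF assms])
  define s where "s = max \<bar>a\<bar> \<bar>b\<bar>"
  have s1: "s \<ge> 1" using ab(1) by (cases "b = 0"; cases "a = 0") (auto simp: s_def)
  define d where "d = int p div s + s"
  have d0: "d \<ge> 0" using s1 by (auto simp: d_def pos_imp_zdiv_nonneg_iff)
  have rep: "\<exists>X Y. int p dvd X - r * Y - i \<and> \<bar>X\<bar> \<le> d \<and> \<bar>Y\<bar> \<le> d" for i
    using bounded_coset_representative[OF assms ab(1,2) s_def] ab(3) unfolding d_def s_def by metis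
  have ds: "real_of_int d \<le> 2 * real p / real_of_int s"
  proof -
    have "int p div s * s \<le> int p" using s1 div_mult_mod_eq[of "int p" s] pos_mod_sign[of s "int p"] by linarith
    then have "d * s \<le> 2 * int p" using ab(3) by (simp add: d_def s_def power2_eq_square distrib_right)
    then have "real_of_int (d * s) \<le> real_of_int (2 * int p)" by (simp only: of_int_le_iff)
    then show ?thesis using s1 by (simp add: field_simps)
  qed
  note dom = lattice_box_fundamental_domain[OF p0 d0 rep]
  have up: "real (card (cong_lattice p r \<inter> int_square x0 y0 (int N))) \<le> 3/2 * real N ^ 2 / real p + 48 * real p / real_of_int s ^ 2" for x0 y0 N
  proof -
    have "real (card (cong_lattice p r \<inter> int_square x0 y0 (int N))) * real p \<le> (real N + 2 * real_of_int d) ^ 2"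
      by (rule dom)
    also have "\<dots> \<le> 3/2 * real N ^ 2 + 12 * real_of_int d ^ 2"
      using zero_le_power2[of "real N - 4 * real_of_int d"] by (simp add: power2_eq_square algebra_simps)
    also have "\<dots> \<le> 3/2 * real N ^ 2 + 12 * (2 * real p / real_of_int s) ^ 2"
      using ds d0 by (intro add_left_mono mult_left_mono power_mono) auto
    finally show ?thesis using p0 s1 by (simp add: field_simps power2_eq_square)
  qed
  have lo: "real N ^ 2 / real p - 8 * real N / real_of_int s \<le> real (card (cong_lattice p r \<inter> int_square x0 y0 (int N)))" for x0 y0 N
  proof -
    have "real N ^ 2 - 4 * real N * (2 * real p / real_of_int s) \<le> real N ^ 2 - 4 * real N * real_of_int d"
      using ds by (intro diff_left_mono mult_left_mono) auto
    also have "\<dots> \<le> real (card (cong_lattice p r \<inter> int_square x0 y0 (int N))) * real p" by (rule dom)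
    finally show ?thesis using p0 s1 by (simp add: field_simps)
  qed
  show ?thesis using that[OF ab(1,2) _ ab(3)] s1 up lo unfolding s_def by blast
qed

section \<open>Roots of an irreducible cubic: an upper bound on average\<close>

definition cubic_form :: "int \<Rightarrow> int \<Rightarrow> int \<Rightarrow> int \<Rightarrow> int \<Rightarrow> int" where
  "cubic_form A B C x y = x^3 + A * x^2 * y + B * x * y^2 + C * y^3"

definition roots_mod :: "nat \<Rightarrow> (int \<Rightarrow> int) \<Rightarrow> int set" where
  "roots_mod q f = {r \<in> {0..<int q}. int q dvd f r}"

lemma finite_roots_mod [simp, intro]: "finite (roots_mod q f)"
  unfolding roots_mod_def by (rule finite_subset[of _ "{0..<int q}"]) auto

text \<open>
  A rational root of a monic integral polynomial is an integer.
\<close>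
lemma cubic_form_nonzero:
  assumes noroot: "\<And>z. cubic_form A B C z 1 \<noteq> 0" and "(x, y) \<noteq> (0, 0)"
  shows "cubic_form A B C x y \<noteq> 0"
proof
  assume 0: "cubic_form A B C x y = 0"
  have g: "gcd x y \<noteq> 0" using assms(2) by auto
  then obtain a b where ab: "x = a * gcd x y" "y = b * gcd x y" "coprime a b"
    using gcd_coprime_exists by blast
  have "cubic_form A B C (a * g) (b * g) = g ^ 3 * cubic_form A B C a b" for g
    by (simp add: cubic_form_def algebra_simps power2_eq_square power3_eq_cube)
  then have "gcd x y ^ 3 * cubic_form A B C a b = 0" using 0 ab(1,2) by metis
  then have 1: "cubic_form A B C a b = 0" using g by (metis mult_eq_0_iff power_eq_0_iff)
  then have "a ^ 3 = b * (- A * a^2 - B * a * b - C * b^2)"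
    by (simp add: cubic_form_def algebra_simps power2_eq_square power3_eq_cube)
  then have "b dvd a ^ 3" by simp
  moreover have "coprime b (a ^ 3)" using ab(3) by (simp add: coprime_commute)
  ultimately have "is_unit b" by (metis coprime_absorb_left)
  then have "b = 1 \<or> b = -1" by auto
  then show False
  proof
    assume "b = 1" then show False using 1 noroot by simp
  next
    assume "b = -1"
    then have "cubic_form A B C (- a) 1 = 0" using 1
      by (simp add: cubic_form_def algebra_simps power2_eq_square power3_eq_cube)
    then show False using noroot by blast
  qed
qed

lemma abs_cubic_form_le:
  assumes "\<bar>x\<bar> \<le> s" "\<bar>y\<bar> \<le> s"
  shows "\<bar>cubic_form A B C x y\<bar> \<le> (1 + \<bar>A\<bar> + \<bar>B\<bar> + \<bar>C\<bar>) * s ^ 3"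
proof -
  have s: "s \<ge> 0" using assms by linarith
  have "u * v * w \<le> s * s * s" if "0 \<le> u" "u \<le> s" "0 \<le> v" "v \<le> s" "0 \<le> w" "w \<le> s" for u v w :: int
    using that s by (intro mult_mono) auto
  then have 1: "\<bar>x\<bar> * \<bar>x\<bar> * \<bar>x\<bar> \<le> s * s * s" "\<bar>x\<bar> * \<bar>x\<bar> * \<bar>y\<bar> \<le> s * s * s"
    "\<bar>x\<bar> * \<bar>y\<bar> * \<bar>y\<bar> \<le> s * s * s" "\<bar>y\<bar> * \<bar>y\<bar> * \<bar>y\<bar> \<le> s * s * s"
    by (meson abs_ge_zero assms)+
  have "\<bar>cubic_form A B C x y\<bar> \<le> \<bar>x^3\<bar> + \<bar>A * x^2 * y\<bar> + \<bar>B * x * y^2\<bar> + \<bar>C * y^3\<bar>"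
    unfolding cubic_form_def by linarith
  also have "\<dots> = \<bar>x\<bar> * \<bar>x\<bar> * \<bar>x\<bar> + \<bar>A\<bar> * (\<bar>x\<bar> * \<bar>x\<bar> * \<bar>y\<bar>) + \<bar>B\<bar> * (\<bar>x\<bar> * \<bar>y\<bar> * \<bar>y\<bar>) + \<bar>C\<bar> * (\<bar>y\<bar> * \<bar>y\<bar> * \<bar>y\<bar>)"
    by (simp add: abs_mult power2_eq_square power3_eq_cube algebra_simps)
  also have "\<dots> \<le> s * s * s + \<bar>A\<bar> * (s * s * s) + \<bar>B\<bar> * (s * s * s) + \<bar>C\<bar> * (s * s * s)"
    using 1 by (intro add_mono mult_left_mono) auto
  also have "\<dots> = (1 + \<bar>A\<bar> + \<bar>B\<bar> + \<bar>C\<bar>) * s ^ 3" by (simp add: power3_eq_cube algebra_simps)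
  finally show ?thesis .
qed

lemma dvd_cubic_form_lattice:
  assumes "int p dvd cubic_form A B C r 1" "int p dvd x - r * y"
  shows "int p dvd cubic_form A B C x y"
proof -
  have "cubic_form A B C x y = y^3 * cubic_form A B C r 1
     + (x - r * y) * (x^2 + x * (r * y) + (r * y)^2 + A * y * (x + r * y) + B * y^2)"
    by (simp add: cubic_form_def algebra_simps power2_eq_square power3_eq_cube)
  then show ?thesis using assms by simp
qed

text \<open>
  Divided differences: two distinct roots give a relation of degree two, three give
  \<open>r\<^sub>1 + r\<^sub>2 + r\<^sub>3 + A \<equiv> 0\<close>, so a third root is determined by the first two.
\<close>
lemma card_roots_mod_cubic_le:
  assumes "prime p"
  shows "card (roots_mod p (\<lambda>r. cubic_form A B C r 1)) \<le> 3"
proof (rule ccontr)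
  let ?R = "roots_mod p (\<lambda>r. cubic_form A B C r 1)"
  assume "\<not> card ?R \<le> 3"
  then obtain T where T: "T \<subseteq> ?R" "card T = 4" 
    using obtain_subset_with_card_n[of 4 ?R] by auto
  then obtain r1 r2 r3 r4 where r: "T = {r1, r2, r3, r4}" "distinct [r1, r2, r3, r4]"
    by (auto simp: card_Suc_eq numeral_eq_Suc)
  have P: "prime (int p)" using assms by simp
  have cancel: "int p dvd z" if "int p dvd (u - v) * z" "u \<in> ?R" "v \<in> ?R" "u \<noteq> v" for u v z
  proof -
    have "\<not> int p dvd u - v" using that by (auto simp: roots_mod_def mod_eq_dvd_iff[symmetric])
    then show ?thesis using that(1) P prime_dvd_multD by blast
  qed
  have quad: "int p dvd u^2 + u * v + v^2 + A * (u + v) + B" if "u \<in> ?R" "v \<in> ?R" "u \<noteq> v" for u v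
  proof -
    have "int p dvd cubic_form A B C u 1 - cubic_form A B C v 1" using that by (auto simp: roots_mod_def)
    also have "\<dots> = (u - v) * (u^2 + u * v + v^2 + A * (u + v) + B)"
      by (simp add: cubic_form_def algebra_simps power2_eq_square power3_eq_cube)
    finally show ?thesis using cancel that by blast
  qed
  have lin: "int p dvd u + v + w + A" if "u \<in> ?R" "v \<in> ?R" "w \<in> ?R" "u \<noteq> v" "u \<noteq> w" "v \<noteq> w" for u v w
  proof -
    have "int p dvd (u^2 + u * v + v^2 + A * (u + v) + B) - (u^2 + u * w + w^2 + A * (u + w) + B)"
      using quad that by (intro dvd_diff) auto
    also have "\<dots> = (v - w) * (u + v + w + A)" by (simp add: algebra_simps power2_eq_square)
    finally show ?thesis using cancel that by blast
  qed
  have "int p dvd (r1 + r2 + r3 + A) - (r1 + r2 + r4 + A)"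
    using r T by (intro dvd_diff lin) auto
  then have "int p dvd (r3 - r4) * 1" by simp
  moreover have "r3 \<in> ?R" "r4 \<in> ?R" "r3 \<noteq> r4" using r T by auto
  ultimately have "int p dvd 1" by (rule cancel)
  then show False using P by auto
qed

text \<open>
  A vector not divisible by \<open>p\<close> lies in at most one of the lattices \<open>x \<equiv> r y\<close>, and then \<open>p\<close>
  divides the value of the form. A vector divisible by \<open>p\<close> may lie in all of them, but there are at most
  three roots and \<open>p^3\<close> divides the value.
\<close>
lemma sum_roots_ln_le_ln_cubic_form:
  assumes "cubic_form A B C x y \<noteq> 0" "finite S" "\<And>p. p \<in> S \<Longrightarrow> prime p"
  shows "(\<Sum>p\<in>S. real (card {r \<in> roots_mod p (\<lambda>r. cubic_form A B C r 1). (x, y) \<in> cong_lattice p r}) * ln (real p))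
    \<le> ln (real_of_int \<bar>cubic_form A B C x y\<bar>)"
proof -
  let ?R = "\<lambda>p. roots_mod p (\<lambda>r. cubic_form A B C r 1)"
  let ?e = "\<lambda>p. card {r \<in> ?R p. (x, y) \<in> cong_lattice p r}"
  have "int p ^ ?e p dvd cubic_form A B C x y" if "p \<in> S" for p
  proof (cases "int p dvd y")
    case y: True
    show ?thesis
    proof (cases "?e p = 0")
      case False
      then have "{r \<in> ?R p. (x, y) \<in> cong_lattice p r} \<noteq> {}" by (metis card.empty)
      then obtain r where "int p dvd x - r * y" by (auto simp: cong_lattice_def)
      then have "int p dvd (x - r * y) + r * y" using y by (intro dvd_add) auto
      then have x: "int p dvd x" by simp
      from x y obtain a b where "x = int p * a" "y = int p * b" by (auto elim!: dvdE)
      then have "cubic_form A B C x y = int p ^ 3 * cubic_form A B C a b"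
        by (simp add: cubic_form_def algebra_simps power2_eq_square power3_eq_cube)
      then have "int p ^ 3 dvd cubic_form A B C x y" by simp
      moreover have "?e p \<le> card (?R p)" by (intro card_mono) auto
      then have "?e p \<le> 3" using card_roots_mod_cubic_le[of p A B C] assms(3)[OF that] by linarith
      ultimately show ?thesis by (meson dvd_trans le_imp_power_dvd)
    qed (simp only: power_0 one_dvd)
  next
    case y: False
    have P: "prime (int p)" using assms(3)[OF that] by simp
    have "?e p \<le> 1"
    proof (rule card_le_Suc0_iff_eq[THEN iffD2, unfolded One_nat_def[symmetric]], safe)
      fix r r' assume *: "r \<in> ?R p" "r' \<in> ?R p" "(x, y) \<in> cong_lattice p r" "(x, y) \<in> cong_lattice p r'"
      then have "int p dvd (x - r' * y) - (x - r * y)"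
        by (intro dvd_diff[of _ "x - r' * y" "x - r * y"]) (auto simp: cong_lattice_def)
      then have "int p dvd (r - r') * y" by (simp add: algebra_simps)
      then have "int p dvd r - r'" using y P prime_dvd_multD by blast
      then show "r = r'" using * by (auto simp: roots_mod_def mod_eq_dvd_iff[symmetric])
    qed auto
    then consider "?e p = 0" | "?e p = 1" by linarith
    then show ?thesis
    proof cases
      case 2
      then have "{r \<in> ?R p. (x, y) \<in> cong_lattice p r} \<noteq> {}" by (metis card.empty zero_neq_one)
      then obtain r where "int p dvd x - r * y" "int p dvd cubic_form A B C r 1"
        by (auto simp: cong_lattice_def roots_mod_def)
      then show ?thesis using 2 dvd_cubic_form_lattice by simp
    qed (simp only: power_0 one_dvd)
  qed
  then have "(\<Sum>p\<in>S. real (?e p) * ln (real p)) \<le> ln (real (nat \<bar>cubic_form A B C x y\<bar>))"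
    using assms
    by (intro sum_ln_prime_powers_le) (auto simp: nat_dvd_iff simp flip: of_nat_power of_nat_dvd_iff[where 'a = int])
  then show ?thesis by simp
qed

text \<open>
  At most \<open>12 k\<close> vectors have sup norm \<open>k\<close>.
\<close>
lemma sum_inverse_sup_norm_le:
  fixes M :: nat
  shows "(\<Sum>(a,b)\<in>{-int M..int M} \<times> {-int M..int M} - {(0,0)}. 1 / real_of_int (max \<bar>a\<bar> \<bar>b\<bar>)) \<le> 12 * real M"
proof -
  let ?S = "{-int M..int M} \<times> {-int M..int M} - {(0,0)}"
  let ?n = "\<lambda>(a, b). max \<bar>a\<bar> \<bar>b\<bar> :: int"
  have "(\<Sum>(a,b)\<in>?S. 1 / real_of_int (max \<bar>a\<bar> \<bar>b\<bar>)) = (\<Sum>w\<in>?S. 1 / real_of_int (?n w))"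
    by (intro sum.cong) auto
  also have "\<dots> = (\<Sum>k\<in>{1..int M}. \<Sum>w | w \<in> ?S \<and> ?n w = k. 1 / real_of_int (?n w))"
    by (rule sum.group [symmetric]) auto
  also have "\<dots> = (\<Sum>k\<in>{1..int M}. real (card {w. w \<in> ?S \<and> ?n w = k}) / real_of_int k)"
    by (intro sum.cong refl) simp
  also have "\<dots> \<le> (\<Sum>k\<in>{1..int M}. 12)"
  proof (rule sum_mono)
    fix k assume k: "k \<in> {1..int M}"
    have "card {w. w \<in> ?S \<and> ?n w = k} \<le> card ({k, -k} \<times> {-k..k} \<union> {-k..k} \<times> {k, -k})"
      by (intro card_mono) (auto simp: max_def split: if_splits)
    also have "\<dots> \<le> card ({k, -k} \<times> {-k..k}) + card ({-k..k} \<times> {k, -k})" by (rule card_Un_le)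
    also have "\<dots> = 2 * (card {k, -k} * card {-k..k})" by (simp add: card_cartesian_product)
    also have "\<dots> \<le> 2 * (2 * nat (2 * k + 1))"
      by (intro mult_left_mono mult_mono) (auto simp: card_insert_if)
    finally have "card {w. w \<in> ?S \<and> ?n w = k} \<le> 4 * nat (2 * k + 1)" by simp
    also have "\<dots> \<le> 12 * nat k" using k by auto
    finally have "real (card {w. w \<in> ?S \<and> ?n w = k}) \<le> real (12 * nat k)" by (rule of_nat_mono)
    then show "real (card {w. w \<in> ?S \<and> ?n w = k}) / real_of_int k \<le> 12"
      using k by (simp add: field_simps)
  qed
  also have "\<dots> = 12 * real M" by simp
  finally show ?thesis .
qed

text \<open>
  The sum of \<open>ln \<bar>F(v)\<bar>\<close> over the square of side \<open>N = K M\<close> is at most \<open>N^2 (3 ln N + c)\<close>, and it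
  dominates the sum of \<open>ln p\<close> over all triples of a prime \<open>p \<le> M^2\<close>, a root \<open>r\<close> and a point of the
  corresponding lattice. The main terms \<open>N^2 / p\<close> of the lattice counts give the left-hand side.
  The errors \<open>8 N / s\<close> are sorted by the short vectors \<open>w\<close> that determine them: a given \<open>w\<close>
  occurs for primes dividing \<open>F(w)\<close> only, and at most once for each, so it accounts for at most
  \<open>ln \<bar>F(w)\<bar> \<le> 3 ln M + c\<close>. As \<open>w\<close> has sup norm at most \<open>M = N / K\<close>, the errors are smaller than the
  main terms by a factor of order \<open>1 / K\<close>; here \<open>96 = 8 * 12\<close>.
\<close>
lemma cubic_sum_roots_le:
  assumes noroot: "\<And>z. cubic_form A B C z 1 \<noteq> 0"
  obtains c where "\<And>K M :: nat. K \<ge> 1 \<Longrightarrow> M \<ge> 1 \<Longrightarrow>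
    (\<Sum>p\<in>primes_upto (M^2). real (card (roots_mod p (\<lambda>r. cubic_form A B C r 1))) * (ln (real p) / real p))
      \<le> 3 * ln (real (K * M)) + c + 96 / real K * (3 * ln (real M) + c)"
proof -
  define c0 where "c0 = 1 + \<bar>A\<bar> + \<bar>B\<bar> + \<bar>C\<bar>"
  let ?F = "cubic_form A B C"
  let ?R = "\<lambda>p. roots_mod p (\<lambda>r. cubic_form A B C r 1)"
  have lnF: "ln (real_of_int \<bar>?F x y\<bar>) \<le> 3 * ln (real n) + ln (real_of_int c0)"
    if "\<bar>x\<bar> \<le> int n" "\<bar>y\<bar> \<le> int n" "n \<ge> 1" "(x, y) \<noteq> (0, 0)" for x y n
  proof -
    have "?F x y \<noteq> 0" using cubic_form_nonzero[OF noroot that(4)] .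
    moreover have "real_of_int \<bar>?F x y\<bar> \<le> real_of_int (c0 * int n ^ 3)"
      using abs_cubic_form_le[OF that(1,2), of A B C] unfolding c0_def by (simp only: of_int_le_iff)
    ultimately have "ln (real_of_int \<bar>?F x y\<bar>) \<le> ln (real_of_int c0 * real n ^ 3)"
      by (intro ln_mono) auto
    also have "\<dots> = 3 * ln (real n) + ln (real_of_int c0)"
      using that(3) by (simp add: ln_mult ln_realpow c0_def)
    finally show ?thesis .
  qed
  have "(\<Sum>p\<in>primes_upto (M^2). real (card (?R p)) * (ln (real p) / real p))
      \<le> 3 * ln (real (K * M)) + ln c0 + 96 / real K * (3 * ln (real M) + ln c0)"
    if K: "K \<ge> 1" and M: "M \<ge> 1" for K M :: nat
  proof -
    define N where "N = K * M"
    have N: "N \<ge> 1" using K M by (simp add: N_def Suc_leI)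
    define P where "P = primes_upto (M^2)"
    have finP: "finite P" and primeP: "\<And>p. p \<in> P \<Longrightarrow> prime p" and leP: "\<And>p. p \<in> P \<Longrightarrow> p \<le> M^2"
      by (auto simp: P_def primes_upto_def)
    have lnP: "ln (real p) \<ge> 0" if "p \<in> P" for p using primeP[OF that] prime_ge_1_nat[of p] by simp
    let ?B = "int_square 0 0 (int N)"
    \<comment> \<open>the possible short vectors: their length is at most \<open>sqrt p \<le> M\<close>\<close>
    define S where "S = {-int M..int M} \<times> {-int M..int M} - {(0,0)}"
    define T where "T = Sigma P ?R"
    have finT: "finite T" using finP by (auto simp: T_def)
    have finS: "finite S" by (auto simp: S_def)
    define nrm :: "int \<times> int \<Rightarrow> real" where "nrm w = real_of_int (max \<bar>fst w\<bar> \<bar>snd w\<bar>)" for w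
    have "\<exists>w. w \<in> S \<and> \<not> int p dvd snd w \<and> w \<in> cong_lattice p r \<and>
        real N ^ 2 / real p - 8 * real N / nrm w \<le> real (card (cong_lattice p r \<inter> ?B))" if pP: "p \<in> P" for p r
    proof -
      obtain a b :: int where ab: "coprime a b" "int p dvd a - r * b" "1 \<le> max \<bar>a\<bar> \<bar>b\<bar>"
        "(max \<bar>a\<bar> \<bar>b\<bar>) ^ 2 \<le> int p"
        "\<And>x0 y0 N. real N ^ 2 / real p - 8 * real N / real_of_int (max \<bar>a\<bar> \<bar>b\<bar>)
          \<le> real (card (cong_lattice p r \<inter> int_square x0 y0 (int N)))"
        using short_vector_counts_lattice[OF primeP[OF pP]] by metis
      have "(max \<bar>a\<bar> \<bar>b\<bar>) ^ 2 \<le> int M ^ 2" using ab(4) leP[OF pP] by (simp flip: of_nat_power)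
      then have m: "max \<bar>a\<bar> \<bar>b\<bar> \<le> int M" by (rule power2_le_imp_le) auto
      have "\<not> int p dvd b"
      proof
        assume b: "int p dvd b"
        then have "int p dvd (a - r * b) + r * b" using ab(2) by (intro dvd_add) auto
        then have "int p dvd a" by simp
        with b ab(1) have "is_unit (int p)" by (rule coprime_common_divisor[rotated -1])
        then show False using primeP[OF that] by auto
      qed
      moreover have "(a, b) \<in> S" using m ab(3) by (auto simp: S_def)
      ultimately show ?thesis using ab by (intro exI[of _ "(a, b)"]) (auto simp: nrm_def cong_lattice_def)
    qed
    then obtain W where W: "\<And>p r. p \<in> P \<Longrightarrow> W p r \<in> S" "\<And>p r. p \<in> P \<Longrightarrow> \<not> int p dvd snd (W p r)"
      "\<And>p r. p \<in> P \<Longrightarrow> W p r \<in> cong_lattice p r"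
      "\<And>p r. p \<in> P \<Longrightarrow> real N ^ 2 / real p - 8 * real N / nrm (W p r) \<le> real (card (cong_lattice p r \<inter> ?B))"
      by metis
    \<comment> \<open>the sum of \<open>ln p\<close> over all incidences, exchanged and compared with \<open>ln \<bar>F(v)\<bar>\<close>\<close>
    have "(\<Sum>p\<in>P. \<Sum>r\<in>?R p. ln (real p) * real (card (cong_lattice p r \<inter> ?B)))
       = (\<Sum>p\<in>P. \<Sum>r\<in>?R p. \<Sum>v | v \<in> ?B \<and> v \<in> cong_lattice p r. ln (real p))"
      by (intro sum.cong refl) (simp add: Int_def conj_commute)
    also have "\<dots> = (\<Sum>p\<in>P. \<Sum>v\<in>?B. \<Sum>r | r \<in> ?R p \<and> v \<in> cong_lattice p r. ln (real p))"
      by (intro sum.cong refl sum.swap_restrict) auto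
    also have "\<dots> = (\<Sum>v\<in>?B. \<Sum>p\<in>P. \<Sum>r | r \<in> ?R p \<and> v \<in> cong_lattice p r. ln (real p))"
      by (rule sum.swap)
    also have "\<dots> \<le> (\<Sum>v\<in>?B. 3 * ln (real N) + ln (real_of_int c0))"
    proof (rule sum_mono)
      fix v assume v: "v \<in> ?B"
      obtain x y where xy: "v = (x, y)" by (cases v)
      have "(\<Sum>p\<in>P. \<Sum>r | r \<in> ?R p \<and> v \<in> cong_lattice p r. ln (real p))
         = (\<Sum>p\<in>P. real (card {r \<in> ?R p. (x, y) \<in> cong_lattice p r}) * ln (real p))"
        by (simp add: xy)
      also have "\<dots> \<le> ln (real_of_int \<bar>?F x y\<bar>)"
        using v finP primeP by (intro sum_roots_ln_le_ln_cubic_form cubic_form_nonzero[OF noroot]) (auto simp: xy int_square_def)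
      also have "\<dots> \<le> 3 * ln (real N) + ln (real_of_int c0)"
        using v N by (intro lnF) (auto simp: xy int_square_def)
      finally show "(\<Sum>p\<in>P. \<Sum>r | r \<in> ?R p \<and> v \<in> cong_lattice p r. ln (real p)) \<le> 3 * ln (real N) + ln (real_of_int c0)" .
    qed
    also have "\<dots> = real N ^ 2 * (3 * ln (real N) + ln (real_of_int c0))"
      by (simp add: card_int_square)
    finally have upper: "(\<Sum>p\<in>P. \<Sum>r\<in>?R p. ln (real p) * real (card (cong_lattice p r \<inter> ?B)))
       \<le> real N ^ 2 * (3 * ln (real N) + ln (real_of_int c0))" .
    have "(\<Sum>(p,r)\<in>T. ln (real p) / nrm (W p r))
        = (\<Sum>w\<in>S. \<Sum>t | t \<in> T \<and> W (fst t) (snd t) = w. ln (real (fst t)) / nrm (W (fst t) (snd t)))"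
      using finT finS W(1) by (subst sum.group) (auto simp: T_def case_prod_unfold)
    also have "\<dots> \<le> (\<Sum>w\<in>S. (3 * ln (real M) + ln (real_of_int c0)) * (1 / nrm w))"
    proof (rule sum_mono)
      fix w assume w: "w \<in> S"
      obtain a b where ab: "w = (a, b)" by (cases w)
      let ?T = "{t. t \<in> T \<and> W (fst t) (snd t) = w}"
      have inj: "inj_on fst ?T"
      proof (rule inj_onI, clarify)
        fix p r p' r'
        assume *: "(p, r) \<in> T" "(p', r') \<in> T" "fst (p, r) = fst (p', r')"
          "W (fst (p', r')) (snd (p', r')) = W (fst (p, r)) (snd (p, r))" "w = W (fst (p, r)) (snd (p, r))"
        then have p: "p' = p" "p \<in> P" and r: "r \<in> ?R p" "r' \<in> ?R p" and "W p r = w" "W p r' = w" 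
          by (auto simp: T_def)
        then have "(a, b) \<in> cong_lattice p r" "(a, b) \<in> cong_lattice p r'" "\<not> int p dvd b" using W ab by (metis snd_conv)+
        then have "int p dvd (a - r' * b) - (a - r * b)"
          by (intro dvd_diff[of _ "a - r' * b" "a - r * b"]) (auto simp: cong_lattice_def)
        then have "int p dvd (r - r') * b" by (simp add: algebra_simps)
        then have "int p dvd r - r'" using \<open>\<not> int p dvd b\<close> primeP[OF p(2)] prime_dvd_multD[of "int p"] 
          by (metis prime_nat_int_transfer)
        then have "r = r'" using r by (auto simp: roots_mod_def mod_eq_dvd_iff[symmetric])
        then show "p = p' \<and> r = r'" using p by simp
      qed
      have "(\<Sum>t\<in>?T. ln (real (fst t))) = (\<Sum>p\<in>fst ` ?T. ln (real p))"
        using inj by (simp add: sum.reindex)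
      also have "\<dots> \<le> (\<Sum>p\<in>fst ` ?T. real (card {r \<in> ?R p. (a, b) \<in> cong_lattice p r}) * ln (real p))"
      proof (rule sum_mono)
        fix p assume "p \<in> fst ` ?T"
        then obtain r where "p \<in> P" "r \<in> ?R p" "W p r = w" by (auto simp: T_def)
        then have "r \<in> {r \<in> ?R p. (a, b) \<in> cong_lattice p r}" using W(3)[of p r] ab by auto
        then have "card {r \<in> ?R p. (a, b) \<in> cong_lattice p r} > 0" by (subst card_gt_0_iff) auto
        then have "real (card {r \<in> ?R p. (a, b) \<in> cong_lattice p r}) \<ge> 1" by simp
        then have "1 * ln (real p) \<le> real (card {r \<in> ?R p. (a, b) \<in> cong_lattice p r}) * ln (real p)"
          using lnP[OF \<open>p \<in> P\<close>] by (intro mult_right_mono)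
        then show "ln (real p) \<le> real (card {r \<in> ?R p. (a, b) \<in> cong_lattice p r}) * ln (real p)" by simp
      qed
      also have "\<dots> \<le> ln (real_of_int \<bar>?F a b\<bar>)"
        using w finT primeP by (intro sum_roots_ln_le_ln_cubic_form cubic_form_nonzero[OF noroot])
          (auto simp: ab S_def T_def)
      also have "\<dots> \<le> 3 * ln (real M) + ln (real_of_int c0)"
        using w M by (intro lnF) (auto simp: ab S_def)
      finally have "(\<Sum>t\<in>?T. ln (real (fst t))) * (1 / nrm w) \<le> (3 * ln (real M) + ln (real_of_int c0)) * (1 / nrm w)"
        by (intro mult_right_mono) (auto simp: nrm_def)
      then show "(\<Sum>t | t \<in> T \<and> W (fst t) (snd t) = w. ln (real (fst t)) / nrm (W (fst t) (snd t)))
          \<le> (3 * ln (real M) + ln (real_of_int c0)) * (1 / nrm w)"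
        by (simp add: sum_divide_distrib)
    qed
    also have "\<dots> = (3 * ln (real M) + ln (real_of_int c0)) * (\<Sum>w\<in>S. 1 / nrm w)"
      by (simp only: sum_distrib_left)
    also have "\<dots> \<le> (3 * ln (real M) + ln (real_of_int c0)) * (12 * real M)"
      using sum_inverse_sup_norm_le[of M] M
      by (intro mult_left_mono) (auto simp: S_def nrm_def case_prod_unfold c0_def)
    finally have short: "(\<Sum>(p,r)\<in>T. ln (real p) / nrm (W p r)) \<le> (3 * ln (real M) + ln (real_of_int c0)) * (12 * real M)" .
    have "real N ^ 2 * (\<Sum>p\<in>P. real (card (?R p)) * (ln (real p) / real p))
      = (\<Sum>p\<in>P. \<Sum>r\<in>?R p. ln (real p) * (real N ^ 2 / real p))"
      by (simp add: sum_distrib_left mult_ac)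
    also have "\<dots> \<le> (\<Sum>p\<in>P. \<Sum>r\<in>?R p. ln (real p) * real (card (cong_lattice p r \<inter> ?B)) + 8 * real N * (ln (real p) / nrm (W p r)))"
    proof (intro sum_mono)
      fix p r assume p: "p \<in> P"
      have "ln (real p) * (real N ^ 2 / real p - 8 * real N / nrm (W p r)) \<le> ln (real p) * real (card (cong_lattice p r \<inter> ?B))"
        using W(4)[OF p] lnP[OF p] by (intro mult_left_mono) auto
      then show "ln (real p) * (real N ^ 2 / real p)
        \<le> ln (real p) * real (card (cong_lattice p r \<inter> ?B)) + 8 * real N * (ln (real p) / nrm (W p r))"
        by (simp add: right_diff_distrib mult_ac)
    qed
    also have "\<dots> = (\<Sum>p\<in>P. \<Sum>r\<in>?R p. ln (real p) * real (card (cong_lattice p r \<inter> ?B)))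
       + 8 * real N * (\<Sum>(p,r)\<in>T. ln (real p) / nrm (W p r))"
      using finP by (simp add: sum.distrib sum_distrib_left T_def sum.Sigma case_prod_unfold)
    also have "\<dots> \<le> real N ^ 2 * (3 * ln (real N) + ln (real_of_int c0))
       + 8 * real N * ((3 * ln (real M) + ln (real_of_int c0)) * (12 * real M))"
      using upper short by (intro add_mono mult_left_mono) auto
    also have "\<dots> = real N ^ 2 * (3 * ln (real N) + ln (real_of_int c0)
       + 96 / real K * (3 * ln (real M) + ln (real_of_int c0)))"
      using K by (simp add: N_def field_simps power2_eq_square)
    finally have "(\<Sum>p\<in>P. real (card (?R p)) * (ln (real p) / real p))
      \<le> 3 * ln (real N) + ln (real_of_int c0) + 96 / real K * (3 * ln (real M) + ln (real_of_int c0))"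
      using N by simp
    then show ?thesis by (simp add: P_def N_def)
  qed
  then show ?thesis using that by blast
qed

section \<open>Roots of a quadratic: a lower bound on average\<close>

text \<open>
  For a root \<open>r\<^sub>0\<close>, any other root \<open>r\<close> has \<open>p^k\<close> dividing \<open>(r - r\<^sub>0) (r + r\<^sub>0)\<close>. A power of \<open>p\<close>, at
  most \<open>p^k\<close>, that divides both factors also divides \<open>4 D\<close>, hence \<open>r\<close> is congruent to \<open>r\<^sub>0\<close> or \<open>- r\<^sub>0\<close> modulo \<open>p^k\<close>
  up to the part of \<open>p\<close> in \<open>4 D\<close>. What matters is a bound independent of \<open>k\<close>, for the primes
  dividing \<open>2 D\<close> too.
\<close>
lemma card_roots_mod_square_le:
  fixes D :: int
  assumes p: "prime p" and D: "D \<noteq> 0"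
  shows "card (roots_mod (p ^ k) (\<lambda>r. r^2 - D)) \<le> 8 * nat \<bar>D\<bar> + 2"
proof -
  let ?R = "roots_mod (p ^ k) (\<lambda>r. r^2 - D)"
  have P: "prime (int p)" "prime_elem (int p)" using p by auto
  have pp: "p > 0" using p prime_gt_0_nat by blast
  show ?thesis
  proof (cases "p ^ k \<le> 4 * nat \<bar>D\<bar>")
    case True
    have "card ?R \<le> card {0..<int (p ^ k)}" by (intro card_mono) (auto simp: roots_mod_def)
    then have "card ?R \<le> p ^ k" by (simp del: of_nat_power)
    then show ?thesis using True by linarith
  next
    case big: False
    define j where "j = multiplicity (int p) (4 * D)"
    have j1: "int p ^ j dvd 4 * D" unfolding j_def by (rule multiplicity_dvd)
    have j2: "\<not> int p ^ Suc j dvd 4 * D"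
      unfolding j_def using D P by (subst power_dvd_iff_le_multiplicity) auto
    have "int p ^ j \<le> \<bar>4 * D\<bar>" using j1 D by (intro zdvd_imp_le) auto
    then have pj: "p ^ j \<le> 4 * nat \<bar>D\<bar>" by (simp flip: of_nat_power)
    then have "p ^ j < p ^ k" using big by linarith
    then have jk: "j < k" using pp by (meson nat_power_less_imp_less)
    show ?thesis
    proof (cases "?R = {}")
      case False
      then obtain r0 where r0: "r0 \<in> ?R" by auto
      have claim: "int p ^ (k - j) dvd r - r0 \<or> int p ^ (k - j) dvd r - (- r0)" if r: "r \<in> ?R" for r
      proof (rule ccontr)
        assume neg: "\<not> ?thesis"
        have "int p ^ k dvd (r^2 - D) - (r0^2 - D)" using r r0
          by (intro dvd_diff[of _ "r^2 - D" "r0^2 - D"]) (auto simp: roots_mod_def)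
        also have "\<dots> = (r - r0) * (r - (- r0))" by (simp add: algebra_simps power2_eq_square)
        finally have 1: "int p ^ k dvd (r - r0) * (r - (- r0))" .
        have ab: "(k - j) + Suc j = Suc k" using jk by simp
        have "int p ^ Suc j dvd r - (- r0)"
          using prime_elem_power_dvd_cases[OF 1 ab P(2)] neg by blast
        moreover have "int p ^ Suc j dvd r - r0"
          using prime_elem_power_dvd_cases[OF 1[unfolded mult.commute[of "r - r0"]] ab P(2)] neg by blast
        ultimately have "int p ^ Suc j dvd (r - (- r0)) - (r - r0)" by (rule dvd_diff)
        moreover have "(r - (- r0)) - (r - r0) = 2 * r0" by simp
        ultimately have "int p ^ Suc j dvd 2 * r0 * (2 * r0)" by (metis dvd_mult2)
        moreover have "int p ^ Suc j dvd 4 * (r0 ^ 2 - D)"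
        proof -
          have "int p ^ Suc j dvd int p ^ k" using jk by (intro le_imp_power_dvd) auto
          also have "int p ^ k dvd r0 ^ 2 - D" using r0 by (auto simp: roots_mod_def)
          finally show ?thesis by (rule dvd_mult)
        qed
        ultimately have "int p ^ Suc j dvd 2 * r0 * (2 * r0) - 4 * (r0 ^ 2 - D)" by (rule dvd_diff)
        then show False using j2 by (simp add: power2_eq_square algebra_simps)
      qed
      let ?S = "\<lambda>z. {x \<in> {-1<..-1 + int (p ^ k)}. int (p ^ (k - j)) dvd x - z}"
      have "?R \<subseteq> ?S r0 \<union> ?S (- r0)"
      proof
        fix r assume r: "r \<in> ?R"
        then have "r \<in> {-1<..-1 + int (p ^ k)}" by (auto simp: roots_mod_def)
        then show "r \<in> ?S r0 \<union> ?S (- r0)" using claim[OF r] by auto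
      qed
      moreover have fin: "finite (?S z)" for z by (rule finite_subset[of _ "{-1<..-1 + int (p ^ k)}"]) auto
      ultimately have "card ?R \<le> card (?S r0 \<union> ?S (- r0))" by (intro card_mono finite_UnI fin)
      also have "\<dots> \<le> card (?S r0) + card (?S (- r0))" by (rule card_Un_le)
      finally have *: "card ?R \<le> card (?S r0) + card (?S (- r0))" .
      have **: "real (card (?S z)) \<le> real (p ^ j) + 1" for z
      proof -
        have "real (card (?S z)) \<le> real (p ^ k) / real (p ^ (k - j)) + 1"
          using pp by (intro card_residue_class_le) auto
        also have "real (p ^ k) / real (p ^ (k - j)) = real (p ^ j)"
        proof -
          have "real (p ^ k) = real (p ^ j) * real (p ^ (k - j))"
            using jk by (simp flip: power_add of_nat_mult)
          then show ?thesis using pp by simp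
        qed
        finally show ?thesis .
      qed
      have "real (card ?R) \<le> real (card (?S r0) + card (?S (- r0)))" using * by (rule of_nat_mono)
      also have "\<dots> = real (card (?S r0)) + real (card (?S (- r0)))" by (rule of_nat_add)
      also have "\<dots> \<le> (real (p ^ j) + 1) + (real (p ^ j) + 1)" by (intro add_mono **)
      also have "\<dots> = real (2 * (p ^ j + 1))" by simp
      finally have "card ?R \<le> 2 * (p ^ j + 1)" by (simp only: of_nat_le_iff)
      also have "\<dots> \<le> 8 * nat \<bar>D\<bar> + 2" using pj by simp
      finally show ?thesis .
    qed auto
  qed
qed

text \<open>
  At most \<open>(2 N / k)^2\<close> points are divisible by a given \<open>k \<le> N\<close>, and the sum of \<open>ln k / k^2\<close> converges.
  The square starts at height \<open>0\<close>, which keeps the greatest common divisors at most \<open>N\<close>.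
\<close>
lemma sum_ln_gcd_bounded:
  obtains c where "\<And>x0 (N::nat). (\<Sum>(x,y)\<in>int_square x0 0 (int N). ln (real_of_int (gcd x y))) \<le> c * real N ^ 2"
proof -
  obtain c where c: "\<And>A :: nat set. finite A \<Longrightarrow> (\<Sum>n\<in>A. ln (real n) / real n ^ 2) \<le> c"
    using sum_ln_div_square_bounded by auto
  have "(\<Sum>(x,y)\<in>int_square x0 0 (int N). ln (real_of_int (gcd x y))) \<le> (4 * c) * real N ^ 2" for x0 and N :: nat
  proof -
    let ?B = "int_square x0 0 (int N)"
    let ?g = "\<lambda>v. nat (gcd (fst v) (snd v))"
    have g: "?g v \<in> {1..N}" if v: "v \<in> ?B" for v
    proof -
      obtain x y where xy: "v = (x, y)" by (cases v)
      have y: "0 < y" "y \<le> int N" using v by (auto simp: xy int_square_def)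
      have "gcd x y \<le> y" using y by (intro zdvd_imp_le) auto
      moreover have "gcd x y > 0" using y by auto
      ultimately have "1 \<le> nat (gcd x y) \<and> nat (gcd x y) \<le> N" using y by linarith
      then show ?thesis by (simp add: xy)
    qed
    have "(\<Sum>(x,y)\<in>?B. ln (real_of_int (gcd x y))) = (\<Sum>v\<in>?B. ln (real (?g v)))"
      by (intro sum.cong) auto
    also have "\<dots> = (\<Sum>k\<in>{1..N}. \<Sum>v | v \<in> ?B \<and> ?g v = k. ln (real (?g v)))"
      using g by (intro sum.group [symmetric]) auto
    also have "\<dots> = (\<Sum>k\<in>{1..N}. real (card {v. v \<in> ?B \<and> ?g v = k}) * ln (real k))"
      by (intro sum.cong refl) simp
    also have "\<dots> \<le> (\<Sum>k\<in>{1..N}. (2 * real N / real k) ^ 2 * ln (real k))"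
    proof (intro sum_mono mult_right_mono)
      fix k assume k: "k \<in> {1..N}"
      let ?X = "{x \<in> {x0<..x0 + int N}. int k dvd x - 0}" and ?Y = "{y \<in> {0<..0 + int N}. int k dvd y - 0}"
      have fin: "finite ?X" "finite ?Y" by (rule finite_subset[of _ "{x0<..x0 + int N}"], auto)
         (rule finite_subset[of _ "{0<..int N}"], auto)
      have "card {v. v \<in> ?B \<and> ?g v = k} \<le> card (?X \<times> ?Y)"
        using fin by (intro card_mono) (auto simp: int_square_def)
      then have "real (card {v. v \<in> ?B \<and> ?g v = k}) \<le> real (card ?X * card ?Y)"
        unfolding card_cartesian_product by (rule of_nat_mono)
      also have "\<dots> = real (card ?X) * real (card ?Y)" by simp
      also have "\<dots> \<le> (real N / real k + 1) * (real N / real k + 1)"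
        using k by (intro mult_mono card_residue_class_le) auto
      also have "\<dots> \<le> (2 * real N / real k) * (2 * real N / real k)"
        using k by (intro mult_mono) (auto simp: field_simps)
      finally show "real (card {v. v \<in> ?B \<and> ?g v = k}) \<le> (2 * real N / real k) ^ 2"
        by (simp add: power2_eq_square)
    qed auto
    also have "\<dots> = 4 * real N ^ 2 * (\<Sum>k\<in>{1..N}. ln (real k) / real k ^ 2)"
      by (simp add: sum_distrib_left power_divide mult_ac power_mult_distrib)
    also have "\<dots> \<le> 4 * real N ^ 2 * c" using c[of "{1..N}"] by (intro mult_left_mono) auto
    finally show ?thesis by (simp add: mult_ac)
  qed
  then show ?thesis using that by blast
qed

lemma square_form_nonzero:
  fixes D x y :: int
  assumes "\<And>z. z ^ 2 \<noteq> D" "(x, y) \<noteq> (0, 0)"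
  shows "x^2 - D * y^2 \<noteq> 0"
proof
  assume *: "x^2 - D * y^2 = 0"
  then have "y \<noteq> 0" using assms(2) by auto
  have "y^2 dvd x^2" using * by simp
  then have "y dvd x" by simp
  then obtain z where "x = y * z" by auto
  then have "y^2 * (z^2 - D) = 0" using * by (simp add: algebra_simps power2_eq_square)
  then show False using \<open>y \<noteq> 0\<close> assms(1)[of z] by simp
qed

text \<open>
  The logarithm of the value at the primitive vector \<open>(a, b)\<close> below \<open>(x, y)\<close> is a sum over the prime
  powers \<open>q\<close> dividing it. As \<open>b\<close> is invertible modulo such a \<open>q\<close>, the quotient \<open>a / b\<close> is a root of \<open>r^2 - D\<close>
  modulo \<open>q\<close>, and the lattice that belongs to it contains \<open>(a, b)\<close>, hence also \<open>(x, y)\<close>.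
\<close>
lemma ln_square_form_le:
  fixes D x y :: int
  assumes x: "x^2 - D * y^2 > 0" and X: "x^2 - D * y^2 \<le> int X"
  shows "ln (real_of_int (x^2 - D * y^2)) \<le> 2 * ln (real_of_int (gcd x y))
    + (\<Sum>q\<in>{1..X}. mangoldt q * real (card {r \<in> roots_mod q (\<lambda>r. r^2 - D). (x, y) \<in> cong_lattice q r}))"
proof -
  let ?R = "\<lambda>q. {r \<in> roots_mod q (\<lambda>r. r^2 - D). (x, y) \<in> cong_lattice q r}"
  have g0: "gcd x y \<noteq> 0" using x by auto
  then have gpos: "gcd x y > 0" by (simp add: less_le)
  obtain a b where ab: "x = a * gcd x y" "y = b * gcd x y" "coprime a b"
    using gcd_coprime_exists[OF g0] by blast
  have "(a * g)^2 - D * (b * g)^2 = g ^ 2 * (a^2 - D * b^2)" for g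
    by (simp add: algebra_simps power2_eq_square)
  then have eq: "x^2 - D * y^2 = gcd x y ^ 2 * (a^2 - D * b^2)" using ab(1,2) by metis
  then have Q0: "a^2 - D * b^2 > 0" using x g0 by (simp add: zero_less_mult_iff)
  define n where "n = nat (a^2 - D * b^2)"
  have n: "n > 0" "int n = a^2 - D * b^2" using Q0 by (auto simp: n_def)
  have nX: "n \<le> X"
  proof -
    have "1 * (a^2 - D * b^2) \<le> gcd x y ^ 2 * (a^2 - D * b^2)"
      using Q0 gpos by (intro mult_right_mono) (auto simp: int_one_le_iff_zero_less)
    then have "a^2 - D * b^2 \<le> x^2 - D * y^2" unfolding eq by simp
    then have "int n \<le> int X" using X n by linarith
    then show ?thesis by simp
  qed
  have "ln (real n) = (\<Sum>q | q dvd n. mangoldt q)" using mangoldt_sum[of n, where 'a = real] n by simp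
  also have "\<dots> \<le> (\<Sum>q | q dvd n. mangoldt q * real (card (?R q)))"
  proof (rule sum_mono)
    fix q assume q: "q \<in> {q. q dvd n}"
    show "mangoldt q \<le> mangoldt q * real (card (?R q))"
    proof (cases "primepow q")
      case True
      then obtain p k where p: "prime p" "k > 0" "q = p ^ k" by (auto simp: primepow_def)
      have P: "prime (int p)" using p by simp
      have q0: "q > 0" using p prime_gt_0_nat by auto
      have qn: "int q dvd a^2 - D * b^2" using q n(2) by (metis mem_Collect_eq of_nat_dvd_iff)
      have "\<not> int p dvd b"
      proof
        assume b: "int p dvd b"
        have "int p dvd int q" using p by (simp add: dvd_power)
        then have "int p dvd (a^2 - D * b^2) + D * b^2" using qn b by (intro dvd_add) (auto intro: dvd_trans simp: power2_eq_square)
        then have "int p dvd a" using P by (simp add: prime_dvd_power_iff)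
        with b ab(3) have "is_unit (int p)" by (rule coprime_common_divisor[rotated -1])
        then show False using P by auto
      qed
      then have "coprime b (int q)" using P p(3) 
        by (metis coprime_commute coprime_power_left_iff of_nat_power prime_imp_coprime)
      then obtain b' where b': "[b * b' = 1] (mod int q)" using cong_solve_coprime_int by blast
      define r where "r = (a * b') mod int q"
      have r: "[r = a * b'] (mod int q)" by (simp add: r_def cong_def)
      have rb: "[r * b = a] (mod int q)"
      proof -
        have "[r * b = a * b' * b] (mod int q)" using r by (intro cong_mult cong_refl)
        also have "a * b' * b = a * (b * b')" by (simp add: mult_ac)
        also have "[a * (b * b') = a * 1] (mod int q)" using b' by (intro cong_mult cong_refl)
        finally show ?thesis by simp
      qed
      have "[b^2 * (r^2 - D) = 0] (mod int q)"
      proof -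
        have "b^2 * (r^2 - D) = (r * b)^2 - D * b^2" by (simp add: algebra_simps power2_eq_square)
        also have "[\<dots> = a^2 - D * b^2] (mod int q)" using rb by (intro cong_diff cong_pow cong_refl)
        also have "[a^2 - D * b^2 = 0] (mod int q)" using qn by (simp add: cong_0_iff)
        finally show ?thesis .
      qed
      then have "int q dvd r^2 - D" using \<open>coprime b (int q)\<close>
        by (simp add: cong_0_iff coprime_dvd_mult_right_iff coprime_commute)
      then have "r \<in> roots_mod q (\<lambda>r. r^2 - D)" using q0 by (simp add: roots_mod_def r_def)
      moreover have "(x, y) \<in> cong_lattice q r"
      proof -
        have "int q dvd a - r * b" using rb by (simp add: cong_iff_dvd_diff dvd_diff_commute)
        then have "int q dvd gcd x y * (a - r * b)" by simp
        also have "gcd x y * (a - r * b) = x - r * y" using ab(1,2) by (metis mult.assoc mult.commute right_diff_distrib)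
        finally show ?thesis by (simp add: cong_lattice_def)
      qed
      ultimately have "card (?R q) > 0" by (subst card_gt_0_iff) auto
      then have "1 \<le> real (card (?R q))" by simp
      then have "mangoldt q * 1 \<le> mangoldt q * real (card (?R q))" by (intro mult_left_mono mangoldt_nonneg)
      then show ?thesis by simp
    qed (simp add: mangoldt_def)
  qed
  also have "\<dots> \<le> (\<Sum>q\<in>{1..X}. mangoldt q * real (card (?R q)))"
  proof (intro sum_mono2 mult_nonneg_nonneg mangoldt_nonneg)
    show "{q. q dvd n} \<subseteq> {1..X}"
    proof
      fix q assume "q \<in> {q. q dvd n}"
      then have "q \<noteq> 0" "q \<le> n" using n(1) by (auto intro!: Nat.gr0I dvd_imp_le)
      then show "q \<in> {1..X}" using nX by auto
    qed
  qed auto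
  finally have "ln (real n) \<le> (\<Sum>q\<in>{1..X}. mangoldt q * real (card (?R q)))" .
  moreover have "ln (real_of_int (x^2 - D * y^2)) = 2 * ln (real_of_int (gcd x y)) + ln (real n)"
  proof -
    have "real_of_int (x^2 - D * y^2) = real_of_int (gcd x y) ^ 2 * real n"
      using eq n(2) by (metis of_int_mult of_int_of_nat_eq of_int_power)
    then show ?thesis using gpos n(1) by (simp add: ln_mult ln_realpow)
  qed
  ultimately show ?thesis by linarith
qed

text \<open>
  The values of \<open>x^2 - D y^2\<close> on a suitable square of side \<open>N\<close> lie between \<open>N^2\<close> and \<open>C N^2\<close>. The
  sum of their logarithms, at least \<open>2 N^2 ln N\<close>, is distributed over the lattices of the
  prime powers \<open>q \<le> C N^2\<close>. The greatest common divisors and the proper prime powers take up only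
  \<open>O(N^2)\<close>, so the primes account for the rest. For a prime, a nonzero vector
  \<open>(a, b)\<close> of the lattice satisfies \<open>p \<le> \<bar>a^2 - D b^2\<bar>\<close>, because the right-hand side is divisible by
  \<open>p\<close> and \<open>D\<close> is not a square. So short vectors have length of order \<open>sqrt p\<close>, and the lattice has at most
  \<open>3/2 N^2 / p + O(1)\<close> points in the square; the bounded terms add up to \<open>O(N^2)\<close> by Chebyshev's estimate.
\<close>
lemma quadratic_sum_roots_ge_nonsquare:
  fixes D :: int
  assumes D: "\<And>z. z^2 \<noteq> D"
  obtains c and C :: nat where "C \<ge> 1"
    "\<And>N :: nat. N \<ge> 1 \<Longrightarrow> 4 / 3 * ln (real N) - c \<le>
      (\<Sum>p\<in>primes_upto ((C * N)^2). real (card (roots_mod p (\<lambda>r. r^2 - D))) * (ln (real p) / real p))"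
proof -
  let ?R = "\<lambda>q. roots_mod q (\<lambda>r. r^2 - D)"
  have D0: "D \<noteq> 0" using D[of 0] by auto
  define d where "d = nat \<bar>D\<bar>"
  \<comment> \<open>With \<open>x > k0 N\<close> and \<open>0 < y \<le> N\<close> the term \<open>x^2\<close> dominates \<open>\<bar>D\<bar> y^2\<close>, even for positive \<open>D\<close>.\<close>
  define k0 where "k0 = d + 1"
  define C where "C = (k0 + 1)^2 + d"
  define c1 where "c1 = real (8 * d + 2)"
  have C1: "C \<ge> 1" by (simp add: C_def power2_eq_square)
  obtain cg where cg: "\<And>x0 (N::nat). (\<Sum>(x,y)\<in>int_square x0 0 (int N). ln (real_of_int (gcd x y))) \<le> cg * real N ^ 2"
    using sum_ln_gcd_bounded by auto
  obtain c2 where c2: "\<And>A :: nat set. finite A \<Longrightarrow> (\<Sum>n\<in>A. ln (real n) / real n ^ 2) \<le> c2"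
    using sum_ln_div_square_bounded by auto
  obtain c3 where c3: "\<And>X :: nat. (\<Sum>p\<in>primes_upto X. \<Sum>k | 3 \<le> k \<and> p ^ k \<le> X.
    ln (real p) * (1 / sqrt (real (p ^ k)))) \<le> c3"
    using sum_prime_cubes_bounded by auto
  have cardR: "real (card (?R (p ^ k))) \<le> c1" if "prime p" for p k
    using card_roots_mod_square_le[OF that D0, of k] by (simp add: c1_def d_def)
  have c1pos: "c1 \<ge> 0" by (simp add: c1_def)
  define c where "c = 2 * cg + 48 * (1 + real d) * c1 * 4 * real C + c1 * (c2 + 4 * real C) + c1 * (1 + real C) * c3"
  have main: "2 * ln (real N) - c \<le> 3 / 2 * (\<Sum>p\<in>primes_upto ((C * N)^2). real (card (?R p)) * (ln (real p) / real p))"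
    if N: "N \<ge> 1" for N :: nat
  proof -
    let ?B = "int_square (int (k0 * N)) 0 (int N)"
    define X where "X = C * N ^ 2"
    have XCN: "X \<le> (C * N) ^ 2"
    proof -
      have "C * 1 \<le> C * C" using C1 by (intro mult_left_mono) auto
      then have "C * N ^ 2 \<le> (C * C) * N ^ 2" by (intro mult_right_mono) auto
      then show ?thesis by (simp add: X_def power2_eq_square mult_ac)
    qed
    have range: "int N ^ 2 \<le> x^2 - D * y^2 \<and> x^2 - D * y^2 \<le> int X" if "(x, y) \<in> ?B" for x y
    proof -
      have xy: "int (k0 * N) \<le> x" "x \<le> int ((k0 + 1) * N)" "0 \<le> y" "y \<le> int N"
        using that by (auto simp: int_square_def algebra_simps)
      have x0: "0 \<le> x" using xy(1) by (rule order_trans[rotated]) simp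
      have "int (k0 * N) ^ 2 \<le> x ^ 2" using xy(1) by (intro power_mono) auto
      moreover have "x ^ 2 \<le> int ((k0 + 1) * N) ^ 2" using xy(2) x0 by (intro power_mono) auto
      moreover have "\<bar>D * y^2\<bar> \<le> int d * int N ^ 2"
        using xy by (auto simp: abs_mult d_def intro!: mult_left_mono power_mono)
      moreover have "int (k0 * N) ^ 2 - int d * int N ^ 2 \<ge> int N ^ 2"
      proof -
        have "int (k0 * N) ^ 2 - int d * int N ^ 2 = int N ^ 2 + (int d * int d + int d) * int N ^ 2"
          by (simp add: k0_def power2_eq_square algebra_simps)
        then show ?thesis by simp
      qed
      moreover have "int ((k0 + 1) * N) ^ 2 + int d * int N ^ 2 = int X"
        by (simp add: X_def C_def power2_eq_square algebra_simps)
      ultimately show ?thesis by (auto simp: abs_le_iff)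
    qed
    define f where "f q = (\<Sum>r\<in>?R q. real (card (cong_lattice q r \<inter> ?B)))" for q
    have fpos: "f q \<ge> 0" for q by (auto simp: f_def intro: sum_nonneg)
    have triv: "f (p ^ k) \<le> c1 * (real N * (real N / real (p ^ k) + 1))" if "prime p" for p k
    proof -
      have "f (p ^ k) \<le> (\<Sum>r\<in>?R (p ^ k). real N * (real N / real (p ^ k) + 1))"
        unfolding f_def using that prime_gt_0_nat by (intro sum_mono card_lattice_box_le) auto
      also have "\<dots> = real (card (?R (p ^ k))) * (real N * (real N / real (p ^ k) + 1))" by simp
      also have "\<dots> \<le> c1 * (real N * (real N / real (p ^ k) + 1))"
        using cardR[OF that] by (intro mult_right_mono) auto
      finally show ?thesis .
    qed
    have fprime: "f p \<le> real (card (?R p)) * (3 / 2 * real N ^ 2 / real p) + c1 * (48 * (1 + real d))" if p: "prime p" for p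
    proof -
      have p0: "p > 0" using p prime_gt_0_nat by blast
      have "f p \<le> (\<Sum>r\<in>?R p. 3 / 2 * real N ^ 2 / real p + 48 * (1 + real d))"
        unfolding f_def
      proof (rule sum_mono)
        fix r assume r: "r \<in> ?R p"
        obtain a b :: int where ab: "int p dvd a - r * b" "1 \<le> max \<bar>a\<bar> \<bar>b\<bar>"
          "\<And>x0 y0 N. real (card (cong_lattice p r \<inter> int_square x0 y0 (int N)))
            \<le> 3/2 * real N ^ 2 / real p + 48 * real p / real_of_int (max \<bar>a\<bar> \<bar>b\<bar>) ^ 2"
          using short_vector_counts_lattice[OF p] by metis
        define s where "s = max \<bar>a\<bar> \<bar>b\<bar>"
        have "int p dvd (a - r * b) * (a + r * b) + b^2 * (r^2 - D)"
          using ab(1) r by (intro dvd_add) (auto simp: roots_mod_def)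
        also have "\<dots> = a^2 - D * b^2" by (simp add: algebra_simps power2_eq_square)
        finally have "int p dvd a^2 - D * b^2" .
        moreover have "(a, b) \<noteq> (0, 0)" using ab(2) by auto
        then have "a^2 - D * b^2 \<noteq> 0" by (rule square_form_nonzero[OF D])
        ultimately have "int p \<le> \<bar>a^2 - D * b^2\<bar>" by (intro zdvd_imp_le) auto
        also have "\<dots> \<le> \<bar>a\<bar>^2 + \<bar>D\<bar> * \<bar>b\<bar>^2" using abs_triangle_ineq4[of "a^2" "D * b^2"] by (simp add: abs_mult)
        also have "\<dots> \<le> s^2 + \<bar>D\<bar> * s^2" by (intro add_mono mult_left_mono power_mono) (auto simp: s_def)
        also have "\<dots> = (1 + int d) * s^2" by (simp add: d_def algebra_simps)
        finally have "real_of_int (int p) \<le> real_of_int ((1 + int d) * s^2)" by (simp only: of_int_le_iff)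
        then have "48 * real p / real_of_int s ^ 2 \<le> 48 * (1 + real d)"
          using ab(2) by (simp add: s_def[symmetric] field_simps)
        then show "real (card (cong_lattice p r \<inter> ?B)) \<le> 3 / 2 * real N ^ 2 / real p + 48 * (1 + real d)"
          using ab(3)[of "int (k0 * N)" 0 N] unfolding s_def by linarith
      qed
      also have "\<dots> = real (card (?R p)) * (3 / 2 * real N ^ 2 / real p) + real (card (?R p)) * (48 * (1 + real d))"
        by (simp add: distrib_left)
      also have "\<dots> \<le> real (card (?R p)) * (3 / 2 * real N ^ 2 / real p) + c1 * (48 * (1 + real d))"
        using cardR[OF p, of 1] by (intro add_left_mono mult_right_mono) auto
      finally show ?thesis .
    qed
    let ?rho = "\<Sum>p\<in>primes_upto ((C * N)^2). real (card (?R p)) * (ln (real p) / real p)"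
    have lnP: "ln (real p) \<ge> 0" if "p \<in> primes_upto n" for p n
      using that prime_ge_1_nat[of p] by (auto simp: primes_upto_def)
    have "real N ^ 2 * (2 * ln (real N)) = (\<Sum>v\<in>?B. ln (real N ^ 2))"
      using N by (simp add: card_int_square ln_realpow)
    also have "\<dots> \<le> (\<Sum>v\<in>?B. 2 * ln (real_of_int (gcd (fst v) (snd v)))
       + (\<Sum>q\<in>{1..X}. mangoldt q * real (card {r \<in> ?R q. v \<in> cong_lattice q r})))"
    proof (rule sum_mono)
      fix v assume v: "v \<in> ?B"
      obtain x y where xy: "v = (x, y)" by (cases v)
      have r: "int N ^ 2 \<le> x^2 - D * y^2" "x^2 - D * y^2 \<le> int X" using range v xy by auto
      have "0 < int N ^ 2" using N by simp
      then have pos: "x^2 - D * y^2 > 0" using r(1) by linarith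
      have "real_of_int (int N ^ 2) \<le> real_of_int (x^2 - D * y^2)" using r(1) by (simp only: of_int_le_iff)
      then have "ln (real N ^ 2) \<le> ln (real_of_int (x^2 - D * y^2))" using N by (intro ln_mono) auto
      also note ln_square_form_le[OF pos r(2)]
      finally show "ln (real N ^ 2) \<le> 2 * ln (real_of_int (gcd (fst v) (snd v)))
       + (\<Sum>q\<in>{1..X}. mangoldt q * real (card {r \<in> ?R q. v \<in> cong_lattice q r}))"
        by (simp add: xy)
    qed
    also have "\<dots> = 2 * (\<Sum>(x,y)\<in>?B. ln (real_of_int (gcd x y)))
      + (\<Sum>v\<in>?B. \<Sum>q\<in>{1..X}. mangoldt q * real (card {r \<in> ?R q. v \<in> cong_lattice q r}))"
      by (simp add: sum.distrib sum_distrib_left case_prod_unfold)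
    also have "(\<Sum>v\<in>?B. \<Sum>q\<in>{1..X}. mangoldt q * real (card {r \<in> ?R q. v \<in> cong_lattice q r}))
      = (\<Sum>q\<in>{1..X}. mangoldt q * f q)"
    proof -
      have "(\<Sum>v\<in>?B. \<Sum>q\<in>{1..X}. mangoldt q * real (card {r \<in> ?R q. v \<in> cong_lattice q r}))
        = (\<Sum>q\<in>{1..X}. mangoldt q * (\<Sum>v\<in>?B. \<Sum>r | r \<in> ?R q \<and> v \<in> cong_lattice q r. 1))"
        by (subst sum.swap) (simp add: sum_distrib_left)
      also have "\<dots> = (\<Sum>q\<in>{1..X}. mangoldt q * (\<Sum>r\<in>?R q. \<Sum>v | v \<in> ?B \<and> v \<in> cong_lattice q r. 1))"
        by (subst sum.swap_restrict) auto
      also have "\<dots> = (\<Sum>q\<in>{1..X}. mangoldt q * f q)"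
        unfolding f_def by (intro sum.cong refl arg_cong2[where f = "(*)"]) (simp add: Int_def conj_commute)
      finally show ?thesis .
    qed
    also have "(\<Sum>q\<in>{1..X}. mangoldt q * f q) \<le> (\<Sum>p\<in>primes_upto X. ln (real p) * f p)
      + (\<Sum>p | p \<in> primes_upto X \<and> p ^ 2 \<le> X. ln (real p) * f (p ^ 2))
      + (\<Sum>p\<in>primes_upto X. \<Sum>k | 3 \<le> k \<and> p ^ k \<le> X. ln (real p) * f (p ^ k))"
      by (rule sum_mangoldt_le) (rule fpos)
    also have "(\<Sum>(x,y)\<in>?B. ln (real_of_int (gcd x y))) \<le> cg * real N ^ 2" by (rule cg)
    also have "(\<Sum>p\<in>primes_upto X. ln (real p) * f p) \<le> 3 / 2 * real N ^ 2 * ?rho + 48 * (1 + real d) * c1 * 4 * real C * real N ^ 2"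
    proof -
      have "(\<Sum>p\<in>primes_upto X. ln (real p) * f p)
        \<le> (\<Sum>p\<in>primes_upto X. ln (real p) * (real (card (?R p)) * (3 / 2 * real N ^ 2 / real p) + c1 * (48 * (1 + real d))))"
        using lnP by (intro sum_mono mult_left_mono fprime) (auto simp: primes_upto_def)
      also have "\<dots> = 3 / 2 * real N ^ 2 * (\<Sum>p\<in>primes_upto X. real (card (?R p)) * (ln (real p) / real p)) + c1 * (48 * (1 + real d)) * chebyshev_theta X"
      proof -
        have "(\<Sum>p\<in>primes_upto X. ln (real p) * (real (card (?R p)) * (3 / 2 * real N ^ 2 / real p) + e))
          = 3 / 2 * real N ^ 2 * (\<Sum>p\<in>primes_upto X. real (card (?R p)) * (ln (real p) / real p)) + e * chebyshev_theta X" for e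
          by (simp add: chebyshev_theta_def sum_distrib_left sum.distrib distrib_left mult_ac)
        then show ?thesis .
      qed
      also have "\<dots> \<le> 3 / 2 * real N ^ 2 * ?rho + c1 * (48 * (1 + real d)) * (4 * real X)"
        using XCN c1pos lnP chebyshev_theta_le[of X]
        by (intro add_mono mult_left_mono sum_mono2) (auto simp: primes_upto_def)
      also have "c1 * (48 * (1 + real d)) * (4 * real X) = 48 * (1 + real d) * c1 * 4 * real C * real N ^ 2"
        by (simp add: X_def algebra_simps)
      finally show ?thesis .
    qed
    also have "(\<Sum>p | p \<in> primes_upto X \<and> p ^ 2 \<le> X. ln (real p) * f (p ^ 2)) \<le> c1 * (c2 + 4 * real C) * real N ^ 2"
    proof -
      let ?P = "{p. p \<in> primes_upto X \<and> p ^ 2 \<le> X}"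
      have finP: "finite ?P" by (rule finite_subset[of _ "primes_upto X"]) auto
      have sub: "?P \<subseteq> primes_upto (C * N)"
      proof safe
        fix p assume "p \<in> primes_upto X" "p ^ 2 \<le> X"
        moreover from this(2) have "p ^ 2 \<le> (C * N) ^ 2" using XCN by (rule order_trans)
        then have "p \<le> C * N" by (rule power2_le_imp_le) simp
        ultimately show "p \<in> primes_upto (C * N)" by (simp add: primes_upto_def)
      qed
      have "(\<Sum>p\<in>?P. ln (real p) * f (p ^ 2)) \<le> (\<Sum>p\<in>?P. ln (real p) * (c1 * (real N * (real N / real (p ^ 2) + 1))))"
        using lnP by (intro sum_mono mult_left_mono triv) (auto simp: primes_upto_def)
      also have "\<dots> = c1 * (real N ^ 2 * (\<Sum>p\<in>?P. ln (real p) / real p ^ 2) + real N * (\<Sum>p\<in>?P. ln (real p)))"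
        by (simp add: sum_distrib_left sum.distrib algebra_simps power2_eq_square)
      also have "\<dots> \<le> c1 * (real N ^ 2 * c2 + real N * chebyshev_theta (C * N))"
        unfolding chebyshev_theta_def using c1pos c2[OF finP] sub lnP
        by (intro mult_left_mono add_mono sum_mono2) auto
      also have "\<dots> \<le> c1 * (real N ^ 2 * c2 + real N * (4 * real (C * N)))"
        using c1pos by (intro mult_left_mono add_mono chebyshev_theta_le) auto
      finally show ?thesis by (simp add: algebra_simps power2_eq_square)
    qed
    also have "(\<Sum>p\<in>primes_upto X. \<Sum>k | 3 \<le> k \<and> p ^ k \<le> X. ln (real p) * f (p ^ k)) \<le> c1 * (1 + real C) * c3 * real N ^ 2"
    proof -
      have "(\<Sum>p\<in>primes_upto X. \<Sum>k | 3 \<le> k \<and> p ^ k \<le> X. ln (real p) * f (p ^ k))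
        \<le> (\<Sum>p\<in>primes_upto X. \<Sum>k | 3 \<le> k \<and> p ^ k \<le> X.
            (c1 * (1 + real C) * real N ^ 2) * (ln (real p) * (1 / sqrt (real (p ^ k)))))"
      proof (intro sum_mono)
        fix p k assume p: "p \<in> primes_upto X" and k: "k \<in> {k. 3 \<le> k \<and> p ^ k \<le> X}"
        have prime: "prime p" using p by (simp add: primes_upto_def)
        define q where "q = p ^ k"
        have q: "q \<ge> 1" "q \<le> X" using k prime prime_ge_1_nat[of p] by (auto simp: q_def)
        have sq: "sqrt (real q) > 0" "sqrt (real q) * sqrt (real q) = real q" using q by auto
        have s1: "sqrt (real q) \<ge> 1" using q by simp
        \<comment> \<open>The trivial count \<open>N (N / q + 1)\<close> is at most \<open>(1 + C) N^2 / sqrt q\<close>, as \<open>q \<le> (C N)^2\<close>.\<close>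
        have "sqrt (real q) \<le> real (C * N)"
        proof (rule real_le_lsqrt)
          show "real q \<le> (real (C * N))\<^sup>2" using q(2) XCN by (metis le_trans of_nat_mono of_nat_power)
        qed auto
        then have 1: "1 \<le> real C * real N * (1 / sqrt (real q))" using sq by (simp add: field_simps)
        have "sqrt (real q) * 1 \<le> sqrt (real q) * sqrt (real q)" using s1 by (intro mult_left_mono) auto
        then have "real N * sqrt (real q) \<le> real N * real q" unfolding sq(2) by (intro mult_left_mono) auto
        then have 2: "real N / real q \<le> real N * (1 / sqrt (real q))" using sq q by (simp add: field_simps)
        have "real N / real q + 1 \<le> (1 + real C) * real N * (1 / sqrt (real q))"
          using 1 2 by (simp add: algebra_simps add_divide_distrib)
        then have "c1 * (real N * (real N / real q + 1)) \<le> c1 * (real N * ((1 + real C) * real N * (1 / sqrt (real q))))"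
          using c1pos by (intro mult_left_mono) auto
        then have "f q \<le> c1 * (real N * ((1 + real C) * real N * (1 / sqrt (real q))))"
          using triv[OF prime, of k] unfolding q_def by linarith
        then have "ln (real p) * f q \<le> ln (real p) * (c1 * (real N * ((1 + real C) * real N * (1 / sqrt (real q)))))"
          using lnP[OF p] by (intro mult_left_mono)
        also have "\<dots> = (c1 * (1 + real C) * real N ^ 2) * (ln (real p) * (1 / sqrt (real q)))"
          by (simp add: power2_eq_square)
        finally show "ln (real p) * f (p ^ k) \<le> (c1 * (1 + real C) * real N ^ 2) * (ln (real p) * (1 / sqrt (real (p ^ k))))"
          by (simp only: q_def)
      qed
      also have "\<dots> = (c1 * (1 + real C) * real N ^ 2) * (\<Sum>p\<in>primes_upto X. \<Sum>k | 3 \<le> k \<and> p ^ k \<le> X. ln (real p) * (1 / sqrt (real (p ^ k))))"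
        by (simp only: sum_distrib_left)
      also have "\<dots> \<le> (c1 * (1 + real C) * real N ^ 2) * c3"
        using c3[of X] c1pos by (intro mult_left_mono) auto
      finally show ?thesis by (simp add: mult_ac)
    qed
    finally have "real N ^ 2 * (2 * ln (real N)) \<le> real N ^ 2 * (3 / 2 * ?rho + c)"
      by (simp add: c_def algebra_simps)
    then have "2 * ln (real N) \<le> 3 / 2 * ?rho + c" using N by simp
    then show ?thesis by linarith
  qed
  have "4 / 3 * ln (real N) - 2 / 3 * c \<le>
      (\<Sum>p\<in>primes_upto ((C * N)^2). real (card (?R p)) * (ln (real p) / real p))" if "N \<ge> 1" for N
    using main[OF that] by linarith
  then show ?thesis using that[OF C1] by blast
qed

section \<open>Cubics without roots modulo infinitely many primes\<close>

definition cubic_disc :: "int \<Rightarrow> int \<Rightarrow> int \<Rightarrow> int" where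
  "cubic_disc A B C = A^2 * B^2 - 4 * B^3 - 4 * A^3 * C - 27 * C^2 + 18 * A * B * C"

lemma cubic_form_1: "cubic_form A B C x 1 = x^3 + A * x^2 + B * x + C"
  by (simp add: cubic_form_def)

lemma inverse_mod_prime:
  fixes x :: int
  assumes "prime p" "\<not> int p dvd x"
  obtains y where "int p dvd x * y - 1"
proof -
  have "prime (int p)" using assms(1) by simp
  then have "coprime (int p) x" using assms(2) by (rule prime_imp_coprime)
  then have "coprime x (int p)" by (simp only: coprime_commute)
  then show ?thesis using that cong_solve_coprime_int by (metis cong_iff_dvd_diff)
qed

lemma roots_mod_eqI:
  assumes "u \<in> roots_mod q f" "v \<in> roots_mod q f" "int q dvd u - v"
  shows "u = v"
  using assms by (auto simp: roots_mod_def mod_eq_dvd_iff[symmetric])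

lemma sum_finite_exceptions_le:
  fixes g h :: "nat \<Rightarrow> real"
  assumes "finite S" "finite P" "\<And>p. p \<in> P \<Longrightarrow> p \<notin> S \<Longrightarrow> g p \<le> h p"
    "\<And>p. p \<in> S \<Longrightarrow> 0 \<le> g p" "\<And>p. p \<in> P \<Longrightarrow> 0 \<le> h p"
  shows "(\<Sum>p\<in>P. g p) \<le> (\<Sum>p\<in>P. h p) + (\<Sum>p\<in>S. g p)"
proof -
  have "(\<Sum>p\<in>P. g p) = (\<Sum>p\<in>P - S. g p) + (\<Sum>p\<in>P \<inter> S. g p)"
    using sum.Int_Diff[OF assms(2), of g S] by simp
  also have "\<dots> \<le> (\<Sum>p\<in>P - S. h p) + (\<Sum>p\<in>S. g p)"
    using assms by (intro add_mono sum_mono sum_mono2) auto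
  also have "(\<Sum>p\<in>P - S. h p) \<le> (\<Sum>p\<in>P. h p)"
    using assms by (intro sum_mono2) auto
  finally show ?thesis by simp
qed

lemma finite_prime_divisors: "n \<noteq> 0 \<Longrightarrow> finite {p :: nat. prime p \<and> int p dvd n}"
  by (rule finite_subset[of _ "{..nat \<bar>n\<bar>}"]) (auto dest!: zdvd_imp_le[of _ "\<bar>n\<bar>", simplified])

text \<open>
  If \<open>D\<close> is a nonzero square, almost all primes have two roots and Mertens' theorem gives even
  \<open>4 ln N\<close>.
\<close>
lemma quadratic_sum_roots_ge:
  fixes D :: int
  assumes D: "D \<noteq> 0"
  obtains c and C :: nat where "C \<ge> 1"
    "\<And>N :: nat. N \<ge> 1 \<Longrightarrow> 4 / 3 * ln (real N) - c \<le>
      (\<Sum>p\<in>primes_upto ((C * N)^2). real (card (roots_mod p (\<lambda>r. r^2 - D))) * (ln (real p) / real p))"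
proof (cases "\<exists>z. z^2 = D")
  case False
  then show ?thesis using quadratic_sum_roots_ge_nonsquare[of D] that by blast
next
  case True
  then obtain z where z: "z^2 = D" by blast
  let ?R = "\<lambda>q. roots_mod q (\<lambda>r. r^2 - D)"
  define S where "S = {p :: nat. prime p \<and> int p dvd 2 * z}"
  have finS: "finite S" unfolding S_def using z D by (intro finite_prime_divisors) auto
  obtain c where c: "\<And>n :: nat. n \<ge> 1 \<Longrightarrow> (\<Sum>p\<in>primes_upto n. ln (real p) / real p) \<ge> ln (real n) - c"
    using sum_ln_div_primes_ge by auto
  define b where "b = (\<Sum>p\<in>S. 2 * (ln (real p) / real p))"
  have two: "2 \<le> card (?R p)" if p: "prime p" "p \<notin> S" for p
  proof -
    have p0: "p > 0" using p prime_gt_0_nat by blast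
    have mem: "w mod int p \<in> ?R p" if "w^2 = D" for w
    proof -
      have "[(w mod int p)^2 - D = w^2 - D] (mod int p)" by (intro cong_diff cong_pow cong_refl) (simp add: cong_def)
      then have "[(w mod int p)^2 - D = 0] (mod int p)" using that by simp
      then show ?thesis using p0 by (simp add: roots_mod_def cong_0_iff)
    qed
    have "z mod int p \<noteq> (- z) mod int p"
    proof
      assume "z mod int p = (- z) mod int p"
      then have "int p dvd z - (- z)" by (simp only: mod_eq_dvd_iff)
      then show False using p by (simp add: S_def)
    qed
    then have "2 = card {z mod int p, (- z) mod int p}" by simp
    also have "\<dots> \<le> card (?R p)" using mem[of z] mem[of "- z"] z by (intro card_mono) auto
    finally show ?thesis .
  qed
  have "4 / 3 * ln (real N) - (2 * c + b) \<le>
      (\<Sum>p\<in>primes_upto ((1 * N)^2). real (card (?R p)) * (ln (real p) / real p))" if N: "N \<ge> 1" for N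
  proof -
    have lnP: "ln (real p) / real p \<ge> 0" if "prime p" for p using that prime_ge_1_nat[of p] by simp
    have "4 / 3 * ln (real N) \<le> 4 * ln (real N)" using N by simp
    also have "4 * ln (real N) = 2 * ln (real (N^2))" using N by (simp add: ln_realpow)
    also have "\<dots> \<le> 2 * ((\<Sum>p\<in>primes_upto (N^2). ln (real p) / real p) + c)"
      using c[of "N^2"] N by simp
    also have "\<dots> = (\<Sum>p\<in>primes_upto (N^2). 2 * (ln (real p) / real p)) + 2 * c"
      by (simp add: sum_distrib_left)
    also have "(\<Sum>p\<in>primes_upto (N^2). 2 * (ln (real p) / real p)) \<le>
       (\<Sum>p\<in>primes_upto (N^2). real (card (?R p)) * (ln (real p) / real p)) + b"
      unfolding b_def
    proof (rule sum_finite_exceptions_le)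
      fix p assume "p \<in> primes_upto (N^2)" "p \<notin> S"
      then show "2 * (ln (real p) / real p) \<le> real (card (?R p)) * (ln (real p) / real p)"
        using two[of p] lnP[of p] by (intro mult_right_mono) (auto simp: primes_upto_def)
    next
      fix p assume "p \<in> S"
      then show "0 \<le> 2 * (ln (real p) / real p)" using lnP[of p] by (simp add: S_def)
    next
      fix p assume "p \<in> primes_upto (N^2)"
      then show "0 \<le> real (card (?R p)) * (ln (real p) / real p)"
        using lnP[of p] by (intro mult_nonneg_nonneg) (auto simp: primes_upto_def)
    qed (use finS in auto)
    finally show ?thesis by simp
  qed
  then show ?thesis using that[of 1 "2 * c + b"] by simp
qed

lemma card_roots_mod_square_prime_le:
  assumes "prime p"
  shows "card (roots_mod p (\<lambda>r. r^2 - D)) \<le> 2"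
proof (rule ccontr)
  let ?R = "roots_mod p (\<lambda>r. r^2 - D)"
  assume "\<not> card ?R \<le> 2"
  then obtain T where T: "T \<subseteq> ?R" "card T = 3" using obtain_subset_with_card_n[of 3 ?R] by auto
  then obtain a b c where r: "T = {a, b, c}" "distinct [a, b, c]"
    by (auto simp: card_Suc_eq numeral_eq_Suc)
  have P: "prime (int p)" using assms by simp
  have opp: "int p dvd u + v" if "u \<in> ?R" "v \<in> ?R" "u \<noteq> v" for u v
  proof -
    have "int p dvd (u^2 - D) - (v^2 - D)" using that by (intro dvd_diff[of _ "u^2 - D"]) (auto simp: roots_mod_def)
    also have "\<dots> = (u - v) * (u + v)" by (simp add: algebra_simps power2_eq_square)
    finally show ?thesis using P prime_dvd_multD roots_mod_eqI[OF that(1,2)] that(3) by blast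
  qed
  have "int p dvd (a + b) - (a + c)" using r T by (intro dvd_diff opp) auto
  then have "int p dvd b - c" by simp
  then show False using r T roots_mod_eqI[of b p _ c] by auto
qed

text \<open>
  With a root \<open>e\<close>, the cubic is \<open>(X - e) (X^2 + u X + \<dots>)\<close> with \<open>u = A + e\<close>, and its discriminant is
  \<open>d^2 q\<close>, where \<open>d\<close> is the derivative of the cubic at \<open>e\<close> and \<open>q\<close> is the discriminant of the
  quadratic cofactor. If \<open>s\<close> is a square root of the discriminant, then \<open>s / d\<close> is one of \<open>q\<close>, and the
  cofactor has the two roots \<open>(- u \<plusminus> s / d) / 2\<close>. They are distinct from each other since \<open>s\<close> is
  invertible, and from \<open>e\<close> since \<open>d\<close> is.
\<close>
lemma cubic_roots_ge_quadratic_roots: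
  assumes p: "prime p" and pD: "\<not> int p dvd 2 * cubic_disc A B C"
    and ne: "roots_mod p (\<lambda>r. cubic_form A B C r 1) \<noteq> {}"
  shows "1 + card (roots_mod p (\<lambda>r. r^2 - cubic_disc A B C)) \<le> card (roots_mod p (\<lambda>r. cubic_form A B C r 1))"
proof -
  let ?D = "cubic_disc A B C"
  let ?R = "roots_mod p (\<lambda>r. cubic_form A B C r 1)" and ?S = "roots_mod p (\<lambda>r. r^2 - ?D)"
  have P: "prime (int p)" using p by simp
  have mult: "int p dvd x \<or> int p dvd y" if "int p dvd x * y" for x y using P that prime_dvd_multD by blast
  have p2: "\<not> int p dvd 2" and pD: "\<not> int p dvd ?D" using pD by (auto intro: dvd_mult2 dvd_mult)
  obtain e where e: "e \<in> ?R" using ne by auto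
  then have me: "int p dvd cubic_form A B C e 1" by (auto simp: roots_mod_def)
  define d where "d = 3 * e^2 + 2 * A * e + B"
  define q where "q = A^2 - 2 * A * e - 3 * e^2 - 4 * B"
  define u where "u = A + e"
  have D: "?D = d^2 * q + cubic_form A B C e 1 * (27 * e^3 + 27 * A * e^2 + 27 * B * e - 27 * C + 18 * A * B - 4 * A ^ 3)"
    unfolding cubic_disc_def d_def q_def cubic_form_1 by algebra
  show ?thesis
  proof (cases "?S = {}")
    case True
    have "card ?R > 0" using ne by (simp add: card_gt_0_iff)
    then show ?thesis using True by simp
  next
    case False
    then obtain s where s: "s \<in> ?S" by auto
    then have sD: "int p dvd s^2 - ?D" by (auto simp: roots_mod_def)
    have ps: "\<not> int p dvd s"
    proof
      assume "int p dvd s"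
      then have "int p dvd s^2" by (simp add: power2_eq_square)
      then have "int p dvd s^2 - (s^2 - ?D)" using sD by (rule dvd_diff)
      then show False using pD by simp
    qed
    have pd: "\<not> int p dvd d"
    proof
      assume "int p dvd d"
      then have "int p dvd ?D" unfolding D using me by (intro dvd_add) (auto simp: power2_eq_square)
      then show False using pD by simp
    qed
    obtain h where h: "int p dvd 2 * h - 1" by (rule inverse_mod_prime[OF p p2])
    obtain d' where d': "int p dvd d * d' - 1" by (rule inverse_mod_prime[OF p pd])
    have td: "int p dvd (s * d')^2 - q"
    proof -
      have "int p dvd s^2 * ((d * d' - 1) * (d * d' + 1)) + (s^2 - ?D)
          + cubic_form A B C e 1 * (27 * e^3 + 27 * A * e^2 + 27 * B * e - 27 * C + 18 * A * B - 4 * A ^ 3)"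
        using d' sD me by (intro dvd_add) auto
      also have "\<dots> = d^2 * ((s * d')^2 - q)" unfolding D by algebra
      finally show ?thesis using mult pd by (metis power2_eq_square)
    qed
    have root: "\<exists>x\<in>?R. int p dvd 2 * x + u - t" if "int p dvd t^2 - q" for t
    proof -
      define x where "x = h * (t - u)"
      have 1: "int p dvd 2 * x + u - t"
      proof -
        have "2 * x + u - t = (2 * h - 1) * (t - u)" by (simp add: x_def algebra_simps)
        then show ?thesis using h by simp
      qed
      have "int p dvd (x - e) * ((2 * x + u - t) * (2 * x + u + t) + (t^2 - q)) + 4 * cubic_form A B C e 1"
        by (rule dvd_add[OF dvd_mult[OF dvd_add[OF dvd_mult2[OF 1] that]] dvd_mult[OF me]])
      also have "\<dots> = (2 * 2) * cubic_form A B C x 1"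
        unfolding cubic_form_1 u_def q_def by algebra
      finally have "int p dvd cubic_form A B C x 1" using mult p2 by blast
      moreover define y where "y = x mod int p"
      then have y: "int p dvd y - x" by (metis mod_eq_dvd_iff mod_mod_trivial)
      have "cubic_form A B C y 1 = cubic_form A B C x 1 + (y - x) * (y^2 + y * x + x^2 + A * (y + x) + B)"
        unfolding cubic_form_1 by algebra
      ultimately have "int p dvd cubic_form A B C y 1" using y by simp
      then have "y \<in> ?R" using p prime_gt_0_nat[of p] by (simp add: roots_mod_def y_def)
      moreover have "int p dvd 2 * (y - x) + (2 * x + u - t)" 
        by (rule dvd_add[OF dvd_mult[OF y] 1])
      then have "int p dvd 2 * y + u - t" by (simp add: algebra_simps)
      ultimately show ?thesis by blast
    qed
    define t where "t = s * d'"
    obtain x1 where x1: "x1 \<in> ?R" "int p dvd 2 * x1 + u - t" using root[of t] td by (auto simp: t_def)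
    obtain x2 where x2: "x2 \<in> ?R" "int p dvd 2 * x2 + u - (- t)" using root[of "- t"] td by (auto simp: t_def)
    have pt: "\<not> int p dvd t"
    proof
      assume "int p dvd t"
      then have "int p dvd t * d - s * (d * d' - 1)" using d' by (intro dvd_diff[of _ "t * d"]) auto
      then show False using ps by (simp add: t_def algebra_simps)
    qed
    have "x1 \<noteq> x2"
    proof
      assume "x1 = x2"
      then have "int p dvd (2 * x2 + u - (- t)) - (2 * x1 + u - t)" by (intro dvd_diff x1(2) x2(2))
      then have "int p dvd 2 * t" using \<open>x1 = x2\<close> by simp
      then show False using mult p2 pt by blast
    qed
    moreover have ne: "x \<noteq> e" if "int p dvd 2 * x + u - t'" "int p dvd t'^2 - q" for x t'
    proof
      assume "x = e"
      then have "int p dvd 2 * e + u - t'" using that(1) by simp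
      then have "int p dvd (2 * e + u - t') * (2 * e + u + t') + (t'^2 - q)"
        by (intro dvd_add[OF dvd_mult2 that(2)])
      also have "\<dots> = (2 * 2) * d" unfolding u_def q_def d_def by algebra
      finally show False using mult p2 pd by blast
    qed
    have "x1 \<noteq> e" using ne[OF x1(2)] td by (simp add: t_def)
    moreover have "x2 \<noteq> e" using ne[OF x2(2)] td by (simp add: t_def)
    ultimately have "3 = card {e, x1, x2}" by simp
    also have "\<dots> \<le> card ?R" using e x1 x2 by (intro card_mono) auto
    finally show ?thesis using card_roots_mod_square_prime_le[OF p, of ?D] by linarith
  qed
qed

text \<open>
  If a root existed modulo almost all primes, the three mean values would give
  \<open>2 + 4/3 \<le> 3 + 3 * 96 / K\<close>, up to bounded terms divided by \<open>ln N\<close>; this fails for \<open>K = 1000\<close>.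
\<close>
theorem cubic_no_root_mod_infinitely_many_primes:
  fixes A B C :: int
  assumes noroot: "\<And>z. cubic_form A B C z 1 \<noteq> 0" and D: "cubic_disc A B C \<noteq> 0"
  shows "infinite {p :: nat. prime p \<and> (\<forall>z. \<not> int p dvd cubic_form A B C z 1)}"
proof
  assume fin: "finite {p :: nat. prime p \<and> (\<forall>z. \<not> int p dvd cubic_form A B C z 1)}" (is "finite ?E")
  let ?D = "cubic_disc A B C"
  let ?R = "\<lambda>p. roots_mod p (\<lambda>r. cubic_form A B C r 1)" and ?Q = "\<lambda>p. roots_mod p (\<lambda>r. r^2 - ?D)"
  define S where "S = ?E \<union> {p :: nat. prime p \<and> int p dvd 2 * ?D}"
  have finS: "finite S" using fin D by (auto simp: S_def intro!: finite_prime_divisors)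
  have ge: "1 + card (?Q p) \<le> card (?R p)" if p: "prime p" "p \<notin> S" for p
  proof (rule cubic_roots_ge_quadratic_roots)
    obtain z where z: "int p dvd cubic_form A B C z 1" using p by (auto simp: S_def)
    have "cubic_form A B C (z mod int p) 1 = cubic_form A B C z 1
        + (z mod int p - z) * ((z mod int p)^2 + (z mod int p) * z + z^2 + A * (z mod int p + z) + B)"
      unfolding cubic_form_1 by algebra
    moreover have "int p dvd z mod int p - z" by (metis mod_eq_dvd_iff mod_mod_trivial)
    ultimately have "int p dvd cubic_form A B C (z mod int p) 1" using z by simp
    then have "z mod int p \<in> ?R p" using p prime_gt_0_nat[of p] by (simp add: roots_mod_def)
    then show "?R p \<noteq> {}" by auto
  qed (use p in \<open>auto simp: S_def\<close>)
  obtain c1 where c1: "\<And>K M :: nat. K \<ge> 1 \<Longrightarrow> M \<ge> 1 \<Longrightarrow>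
    (\<Sum>p\<in>primes_upto (M^2). real (card (?R p)) * (ln (real p) / real p))
      \<le> 3 * ln (real (K * M)) + c1 + 96 / real K * (3 * ln (real M) + c1)"
    using cubic_sum_roots_le[OF noroot] by blast
  obtain c2 and k :: nat where k: "k \<ge> 1" and c2: "\<And>N :: nat. N \<ge> 1 \<Longrightarrow> 4 / 3 * ln (real N) - c2 \<le>
      (\<Sum>p\<in>primes_upto ((k * N)^2). real (card (?Q p)) * (ln (real p) / real p))"
    using quadratic_sum_roots_ge[OF D] by blast
  obtain c3 where c3: "\<And>n :: nat. n \<ge> 1 \<Longrightarrow> (\<Sum>p\<in>primes_upto n. ln (real p) / real p) \<ge> ln (real n) - c3"
    using sum_ln_div_primes_ge by auto
  have lnP: "ln (real p) / real p \<ge> 0" if "prime p" for p using that prime_ge_1_nat[of p] by simp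
  define b where "b = (\<Sum>p\<in>S. (1 + real (card (?Q p))) * (ln (real p) / real p))"
  define c where "c = c2 + c3 + b + 3 * ln (real (1000 * k)) + c1 + 96 / 1000 * (3 * ln (real k) + c1)"
  have bound: "(10 / 3 - 3288 / 1000) * ln (real N) \<le> c" if N: "N \<ge> 1" for N :: nat
  proof -
    define M where "M = k * N"
    have M: "M \<ge> 1" using k N by (simp add: M_def Suc_leI)
    let ?P = "primes_upto (M^2)"
    have "2 * ln (real N) \<le> 2 * ln (real M)" using k N by (simp add: M_def)
    also have "\<dots> = ln (real (M^2))" using M by (simp add: ln_realpow)
    also have "\<dots> \<le> (\<Sum>p\<in>?P. ln (real p) / real p) + c3" using c3[of "M^2"] M by simp
    finally have 1: "2 * ln (real N) \<le> (\<Sum>p\<in>?P. ln (real p) / real p) + c3" .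
    have 2: "4 / 3 * ln (real N) \<le> (\<Sum>p\<in>?P. real (card (?Q p)) * (ln (real p) / real p)) + c2"
      using c2[OF N] by (simp add: M_def)
    have "(\<Sum>p\<in>?P. ln (real p) / real p) + (\<Sum>p\<in>?P. real (card (?Q p)) * (ln (real p) / real p))
      = (\<Sum>p\<in>?P. (1 + real (card (?Q p))) * (ln (real p) / real p))"
      by (simp only: sum.distrib distrib_right mult_1)
    also have "\<dots> \<le> (\<Sum>p\<in>?P. real (card (?R p)) * (ln (real p) / real p)) + b"
      unfolding b_def
    proof (rule sum_finite_exceptions_le)
      fix p assume p: "p \<in> ?P" "p \<notin> S"
      then have "real (1 + card (?Q p)) \<le> real (card (?R p))"
        using ge[of p] unfolding of_nat_le_iff by (auto simp: primes_upto_def)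
      then show "(1 + real (card (?Q p))) * (ln (real p) / real p) \<le> real (card (?R p)) * (ln (real p) / real p)"
        using p lnP[of p] by (intro mult_right_mono) (auto simp: primes_upto_def)
    next
      fix p assume "p \<in> S"
      then show "0 \<le> (1 + real (card (?Q p))) * (ln (real p) / real p)"
        using lnP[of p] by (intro mult_nonneg_nonneg) (auto simp: S_def)
    next
      fix p assume "p \<in> ?P"
      then show "0 \<le> real (card (?R p)) * (ln (real p) / real p)"
        using lnP[of p] by (intro mult_nonneg_nonneg) (auto simp: primes_upto_def)
    qed (use finS in auto)
    also have "(\<Sum>p\<in>?P. real (card (?R p)) * (ln (real p) / real p))
      \<le> 3 * ln (real (1000 * M)) + c1 + 96 / real 1000 * (3 * ln (real M) + c1)"
      using c1[of 1000 M] M by simp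
    finally have 3: "(\<Sum>p\<in>?P. ln (real p) / real p) + (\<Sum>p\<in>?P. real (card (?Q p)) * (ln (real p) / real p))
      \<le> 3 * ln (real (1000 * M)) + c1 + 96 / 1000 * (3 * ln (real M) + c1) + b" by simp
    have 4: "ln (real (1000 * M)) = ln (real (1000 * k)) + ln (real N)" "ln (real M) = ln (real k) + ln (real N)"
      using k N by (simp_all add: M_def ln_mult)
    have "(10 / 3 - 3288 / 1000) * l \<le> c2 + c3 + b + 3 * u + c1 + 96 / 1000 * (3 * v + c1)"
      if "2 * l \<le> s1 + c3" "4 / 3 * l \<le> s2 + c2"
        "s1 + s2 \<le> 3 * (u + l) + c1 + 96 / 1000 * (3 * (v + l) + c1) + b" for l s1 s2 u v :: real
      using that by argo
    from this[OF 1 2 3[unfolded 4]] show ?thesis unfolding c_def .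
  qed
  define N where "N = nat \<lceil>exp (\<bar>c\<bar> / (10 / 3 - 3288 / 1000) + 1)\<rceil>"
  have "exp (\<bar>c\<bar> / (10 / 3 - 3288 / 1000) + 1) \<le> real N" unfolding N_def by (rule real_nat_ceiling_ge)
  moreover from this have "N \<ge> 1" by (metis Suc_leI exp_gt_zero less_le_trans of_nat_0_less_iff One_nat_def)
  ultimately have "\<bar>c\<bar> / (10 / 3 - 3288 / 1000) + 1 \<le> ln (real N)" by (simp add: ln_ge_iff)
  then have "\<bar>c\<bar> + (10 / 3 - 3288 / 1000) \<le> (10 / 3 - 3288 / 1000) * ln (real N)" by (simp add: field_simps)
  then show False using bound[OF \<open>N \<ge> 1\<close>] by simp
qed

section \<open>The duplication map modulo a prime\<close>

text \<open>
  Numerator and denominator of the duplication formula, scaled by a factor \<open>c\<close> that is already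
  contained in the other coefficients. The scaling allows the same definition for the monic
  rational form (\<open>c = 1\<close>) and for the integral form in lowest terms.
\<close>
definition dup_num :: "'a::comm_ring_1 \<Rightarrow> 'a \<Rightarrow> 'a \<Rightarrow> 'a \<Rightarrow> 'a poly" where
  "dup_num c b4 b6 b8 = [:- b8, - 2 * b6, - b4, 0, c:]"

definition dup_den :: "'a::comm_ring_1 \<Rightarrow> 'a \<Rightarrow> 'a \<Rightarrow> 'a \<Rightarrow> 'a poly" where
  "dup_den c b2 b4 b6 = [:b6, 2 * b4, b2, 4 * c:]"

text \<open>
  A quarter of the discriminant of the denominator; for \<open>c = 1\<close>, four times the discriminant of the
  curve.
\<close>
definition dup_disc :: "'a::comm_ring_1 \<Rightarrow> 'a \<Rightarrow> 'a \<Rightarrow> 'a \<Rightarrow> 'a" where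
  "dup_disc c b2 b4 b6 = b2^2 * b4^2 - 32 * c * b4^3 - b2^3 * b6 - 108 * c^2 * b6^2 + 36 * c * b2 * b4 * b6"

text \<open>
  Let \<open>m = \<psi> / 4\<close> be the monic cubic, with quadratic coefficient \<open>A\<close>. The identity between the discriminant
  and the cofactor discriminant \<open>q\<close> of a root writes \<open>disc m\<close> as \<open>(m')^2 q\<close> plus a multiple of \<open>m\<close>, and
  the duplication formula gives \<open>(m')^2 = \<phi> + 4 (A + 2 x) m\<close>. Substituting the one into the other and
  clearing denominators leads to the coefficients \<open>u\<close> and \<open>v\<close>.
\<close>
lemma dup_bezout:
  fixes c b2 b4 b6 b8 :: "'a :: {idom, ring_char_0}"
  assumes "4 * c * b8 = b2 * b6 - b4^2"
  obtains u v where "u * dup_num c b4 b6 b8 + v * dup_den c b2 b4 b6 = [:dup_disc c b2 b4 b6:]"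
proof -
  define q where "q = [:b2^2 - 32 * c * b4, - 8 * c * b2, - 48 * c^2:]"
  define u where "u = smult (4 * c) q"
  define v where "v = [:- 108 * c^2 * b6 + 36 * c * b2 * b4 - b2^3, 216 * c^2 * b4, 108 * c^2 * b2, 432 * c^3:]
      + [:b2, 8 * c:] * q"
  have "poly (u * dup_num c b4 b6 b8 + v * dup_den c b2 b4 b6) x = poly [:dup_disc c b2 b4 b6:] x" for x
    using assms unfolding u_def v_def q_def dup_num_def dup_den_def dup_disc_def
    by (simp del: mult_pCons_left mult_pCons_right) algebra
  then have "u * dup_num c b4 b6 b8 + v * dup_den c b2 b4 b6 = [:dup_disc c b2 b4 b6:]"
    using poly_eq_poly_eq_iff by blast
  then show ?thesis by (rule that)
qed

text \<open>
  Take \<open>c = 1\<close> for simplicity. The product of \<open>(x - e) (y - e) - \<psi>'(e) / 4\<close> over the roots \<open>e\<close> of \<open>\<psi>\<close> is a resultant, of \<open>\<psi>\<close> and a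
  quadratic in \<open>e\<close>, and it vanishes modulo \<open>p\<close> whenever \<open>L\<^sub>2(x) = L\<^sub>2(y)\<close> and \<open>x \<noteq> y\<close>. So \<open>\<psi>\<close> and the
  quadratic have a common factor, which can be found over the prime field by one step of the Euclidean
  algorithm: the remainder is the linear polynomial \<open>r\<^sub>1 e + r\<^sub>0\<close>. If it is zero modulo \<open>p\<close>, the quadratic
  divides \<open>\<psi>\<close> and the linear cofactor provides the root; otherwise the root of the remainder does.
\<close>
lemma root_of_duplication_collision:
  fixes c B2 B4 B6 B8 x y :: int
  assumes p: "prime p" "\<not> int p dvd 2 * c" and rel: "4 * c * B8 = B2 * B6 - B4^2"
    and xy: "\<not> int p dvd x - y"
    and eq: "int p dvd poly (dup_num c B4 B6 B8) x * poly (dup_den c B2 B4 B6) y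
      - poly (dup_num c B4 B6 B8) y * poly (dup_den c B2 B4 B6) x"
  shows "\<exists>e. int p dvd poly (dup_den c B2 B4 B6) e"
proof -
  have P: "prime (int p)" using p by simp
  have mult: "int p dvd u \<or> int p dvd v" if "int p dvd u * v" for u v using P that prime_dvd_multD by blast
  have p2: "\<not> int p dvd 2" and pc: "\<not> int p dvd c" using p(2) by (auto intro: dvd_mult2 dvd_mult)
  define s where "s = x + y"
  define w where "w = x * y"
  define r1 where "r1 = 2 * B4 + 4 * c * w + s * (B2 + 2 * c * s)"
  define r0 where "r0 = 2 * B6 + s * (B4 - 2 * c * w)"
  let ?q = "\<lambda>e. 4 * c * e^2 + (B2 + 2 * c * s) * e + (B4 - 2 * c * w)"
  let ?g = "\<lambda>e. poly (dup_den c B2 B4 B6) e" and ?f = "\<lambda>e. poly (dup_num c B4 B6 B8) e"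
  define Res where "Res = 4 * c * r0^2 - (B2 + 2 * c * s) * r1 * r0 + (B4 - 2 * c * w) * r1^2"
  have "(x - y) * Res = - 8 * c * (?f x * ?g y - ?f y * ?g x)"
    using rel unfolding Res_def r0_def r1_def s_def w_def dup_num_def dup_den_def by simp algebra
  then have "int p dvd (x - y) * Res" using eq by simp
  then have Res: "int p dvd Res" using mult xy by blast
  have g: "2 * ?g e = (2 * e - s) * ?q e + (r1 * e + r0)" for e
    unfolding r0_def r1_def dup_den_def by simp algebra
  show ?thesis
  proof (cases "int p dvd r1")
    case False
    obtain t where t: "int p dvd r1 * t - 1" by (rule inverse_mod_prime[OF p(1) False])
    define e where "e = - r0 * t"
    have "r1 * e + r0 = - r0 * (r1 * t - 1)" by (simp add: e_def algebra_simps)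
    then have 1: "int p dvd r1 * e + r0" using t by simp
    have "int p dvd (r1 * e + r0) * (4 * c * (r1 * e - r0) + (B2 + 2 * c * s) * r1) + Res"
      by (rule dvd_add[OF dvd_mult2[OF 1] Res])
    also have "\<dots> = r1 * (r1 * ?q e)" unfolding Res_def by algebra
    finally have "int p dvd ?q e" using mult False by blast
    then have "int p dvd (2 * e - s) * ?q e + (r1 * e + r0)" using 1 by (rule dvd_add[OF dvd_mult])
    then show ?thesis using g mult p2 by metis
  next
    case True
    have "int p dvd Res + r1 * ((B2 + 2 * c * s) * r0 - (B4 - 2 * c * w) * r1)"
      by (rule dvd_add[OF Res dvd_mult2[OF True]])
    also have "\<dots> = 2 * (2 * (c * (r0 * r0)))" unfolding Res_def by algebra
    finally have r0: "int p dvd r0" using mult p2 pc by blast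
    obtain h where h: "int p dvd 2 * h - 1" by (rule inverse_mod_prime[OF p(1) p2])
    have "2 * (h * s) - s = (2 * h - 1) * s" by (simp add: algebra_simps)
    then have "int p dvd 2 * (h * s) - s" using h by simp
    then have "int p dvd (2 * (h * s) - s) * ?q (h * s) + (r1 * (h * s) + r0)"
      using True r0 by (intro dvd_add[OF dvd_mult2 dvd_add[OF dvd_mult2]])
    then show ?thesis using g mult p2 by metis
  qed
qed

lemma hom_values_dup_Infty:
  fixes c :: "'a :: {idom, ring_char_0}"
  assumes "c \<noteq> 0"
  shows "hom_values (dup_num c b4 b6 b8) (dup_den c b2 b4 b6) Infty = (c, 0)"
proof -
  have "degree (dup_num c b4 b6 b8) = 4" "degree (dup_den c b2 b4 b6) = 3"
    using assms by (simp_all add: dup_num_def dup_den_def)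
  then show ?thesis by (simp add: Let_def dup_num_def dup_den_def eval_nat_numeral)
qed

lemma not_permutes_mod_if_root:
  assumes nd: "num_denom L = (dup_num c B4 B6 B8, dup_den c B2 B4 B6)" and c: "c \<noteq> 0"
    and p: "prime p" and z: "int p dvd poly (dup_den c B2 B4 B6) z"
  shows "\<not> permutes_mod L p"
proof
  let ?f = "dup_num c B4 B6 B8" and ?g = "dup_den c B2 B4 B6"
  let ?r = "\<lambda>P. proj_point_mod p (hom_values ?f ?g P)"
  assume "permutes_mod L p"
  then have inj: "inj_on ?r (proj_line_mod p)"
    by (simp add: permutes_mod_def nd bij_betw_def)
  define x where "x = z mod int p"
  have "int p dvd x - z" unfolding x_def by (metis mod_eq_dvd_iff mod_mod_trivial)
  moreover have "x - z dvd poly ?g x - poly ?g z"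
  proof -
    have "poly ?g x - poly ?g z = (x - z) * (4 * c * (x^2 + x * z + z^2) + B2 * (x + z) + 2 * B4)"
      by (simp add: dup_den_def) algebra
    then show ?thesis by simp
  qed
  ultimately have "int p dvd poly ?g x - poly ?g z" by (rule dvd_trans)
  then have "int p dvd (poly ?g x - poly ?g z) + poly ?g z" using z by (rule dvd_add)
  then have "?r (Finite x) = Infty" by (simp add: proj_point_mod_def)
  moreover have "?r Infty = Infty"
    using hom_values_dup_Infty[OF c, of B4 B6 B8 B2] by (simp only: proj_point_mod_def) simp
  moreover have "Finite x \<in> proj_line_mod p" "Infty \<in> proj_line_mod p"
    using p prime_gt_0_nat[of p] by (auto simp: proj_line_mod_def x_def)
  ultimately have "Finite x = Infty" using inj by (metis inj_onD)
  then show False by simp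
qed

text \<open>
  Good reduction follows from the Bezout identity and injectivity from the absence of collisions;
  an injective self-map of a finite set is a bijection.
\<close>
lemma permutes_mod_if_no_root:
  assumes nd: "num_denom L = (dup_num c B4 B6 B8, dup_den c B2 B4 B6)" and c: "c \<noteq> 0"
    and rel: "4 * c * B8 = B2 * B6 - B4^2"
    and p: "prime p" "\<not> int p dvd 2 * c" "\<not> int p dvd dup_disc c B2 B4 B6"
    and nr: "\<And>z. \<not> int p dvd poly (dup_den c B2 B4 B6) z"
  shows "permutes_mod L p"
proof -
  let ?f = "dup_num c B4 B6 B8" and ?g = "dup_den c B2 B4 B6" and ?d = "dup_disc c B2 B4 B6"
  let ?r = "\<lambda>P. proj_point_mod p (hom_values ?f ?g P)"
  have p0: "p > 0" using p(1) prime_gt_0_nat by blast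
  have pc: "\<not> int p dvd c" using p(2) by auto
  have "good_reduction ?f ?g p"
  proof -
    have "(coeff ?f (max (degree ?f) (degree ?g)), coeff ?g (max (degree ?f) (degree ?g))) = (c, 0)"
      using hom_values_dup_Infty[OF c, of B4 B6 B8 B2] by (simp add: Let_def)
    then have 1: "\<not> (int p dvd coeff ?f (max (degree ?f) (degree ?g)) \<and> int p dvd coeff ?g (max (degree ?f) (degree ?g)))"
      using pc by simp
    obtain u v where uv: "u * ?f + v * ?g = [:?d:]" using dup_bezout[OF rel] by blast
    obtain w where w: "int p dvd ?d * w - 1" by (rule inverse_mod_prime[OF p(1,3)])
    have "smult w u * ?f + smult w v * ?g - 1 = smult w (u * ?f + v * ?g) - 1"
      by (simp add: smult_add_right)
    also have "\<dots> = [:?d * w - 1:]" unfolding uv by (simp add: one_pCons mult.commute)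
    finally have eq: "smult w u * ?f + smult w v * ?g - 1 = [:?d * w - 1:]" .
    obtain k where "?d * w - 1 = int p * k" using w by (rule dvdE)
    then have "[:?d * w - 1:] = [:int p:] * [:k:]" by simp
    then have "[:int p:] dvd smult w u * ?f + smult w v * ?g - 1" unfolding eq by (rule dvdI)
    then show ?thesis using 1 unfolding good_reduction_def Let_def by blast
  qed
  moreover have "bij_betw ?r (proj_line_mod p) (proj_line_mod p)"
  proof -
    have fin: "finite (proj_line_mod p)" by (simp add: proj_line_mod_def)
    have rI: "?r Infty = Infty"
      using hom_values_dup_Infty[OF c, of B4 B6 B8 B2] by (simp only: proj_point_mod_def) simp
    have rF: "?r (Finite x) = Finite (poly ?f x * modular_inverse (int p) (poly ?g x) mod int p)" for x
      using nr[of x] by (simp add: proj_point_mod_def)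
    have inv: "int p dvd poly ?g x * modular_inverse (int p) (poly ?g x) - 1" for x
    proof -
      have "coprime (int p) (poly ?g x)" using nr[of x] p(1) by (intro prime_imp_coprime) auto
      then have "[modular_inverse (int p) (poly ?g x) * poly ?g x = 1] (mod int p)"
        by (intro cong_modular_inverse2) (simp add: coprime_commute)
      then show ?thesis by (simp add: cong_iff_dvd_diff mult.commute)
    qed
    have "inj_on ?r (proj_line_mod p)"
    proof (rule inj_onI)
      fix P Q assume PQ: "P \<in> proj_line_mod p" "Q \<in> proj_line_mod p" "?r P = ?r Q"
      show "P = Q"
      proof (cases P; cases Q)
        fix x y assume xy: "P = Finite x" "Q = Finite y"
        show "P = Q"
        proof (rule ccontr)
          assume "P \<noteq> Q"
          then have "\<not> int p dvd x - y" using PQ xy by (auto simp: proj_line_mod_def mod_eq_dvd_iff[symmetric])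
          let ?i = "\<lambda>x. modular_inverse (int p) (poly ?g x)"
          have "int p dvd poly ?f x * ?i x - poly ?f y * ?i y"
            using PQ(3) unfolding xy rF by (simp add: mod_eq_dvd_iff)
          then have "int p dvd poly ?g x * poly ?g y * (poly ?f x * ?i x - poly ?f y * ?i y)
             - poly ?f x * poly ?g y * (poly ?g x * ?i x - 1) + poly ?f y * poly ?g x * (poly ?g y * ?i y - 1)"
            using inv[of x] inv[of y] by (intro dvd_add[OF dvd_diff]) (simp_all add: dvd_mult)
          also have "\<dots> = poly ?f x * poly ?g y - poly ?f y * poly ?g x" by algebra
          finally show False
            using root_of_duplication_collision[OF p(1,2) rel \<open>\<not> int p dvd x - y\<close>] nr by blast
        qed
      qed (use PQ(3) rI rF in auto)
    qed
    moreover have "?r ` proj_line_mod p \<subseteq> proj_line_mod p"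
    proof safe
      fix P assume "P \<in> proj_line_mod p"
      show "?r P \<in> proj_line_mod p"
        using rI rF p0 by (cases P) (auto simp: proj_line_mod_def)
    qed
    ultimately show ?thesis using fin by (simp add: bij_betw_def endo_inj_surj)
  qed
  ultimately show ?thesis by (simp add: permutes_mod_def nd)
qed

section \<open>The second Lattes map\<close>

lemma map_poly_of_int_mult:
  "map_poly of_int (p * q) = map_poly of_int p * (map_poly of_int q :: 'a :: comm_ring_1 poly)"
  by (rule poly_eqI) (simp add: coeff_map_poly coeff_mult)

lemma map_poly_of_int_eq_iff:
  "map_poly of_int p = (map_poly of_int q :: 'a :: ring_char_0 poly) \<longleftrightarrow> p = q"
  by (auto simp: poly_eq_iff coeff_map_poly)

lemma clear_denominators:
  fixes a :: "rat poly"
  obtains k A where "k \<noteq> (0::int)" "map_poly of_int A = smult (of_int k) a"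
proof -
  have "\<exists>k A. k \<noteq> (0::int) \<and> map_poly of_int A = smult (of_int k) a"
  proof (induction a)
    case 0
    show ?case by (intro exI[of _ 1] exI[of _ 0]) simp
  next
    case (pCons r a)
    then obtain k A where k: "k \<noteq> 0" "map_poly of_int A = smult (of_int k) a" by blast
    obtain u w where q: "quotient_of r = (u, w)" by (cases "quotient_of r")
    then have w: "w > 0" "r = of_int u / of_int w" by (auto simp: quotient_of_denom_pos quotient_of_div)
    have "map_poly of_int (pCons (u * k) (smult w A)) = smult (of_int (k * w)) (pCons r a)"
      using w k(2) by (simp add: map_poly_pCons map_poly_smult mult.commute)
    then show ?case using k(1) w(1) by (intro exI[of _ "k * w"] exI) auto
  qed
  then show ?thesis using that by blast
qed

text \<open>
  After clearing denominators, the greatest common divisor in \<open>\<int>[x]\<close> can be divided out.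
\<close>
lemma lowest_terms_num_denom: "lowest_terms r (num_denom r)"
proof -
  obtain a b where r: "r = Fract a b" "b \<noteq> 0" by (rule Fract_cases)
  obtain k A where A: "k \<noteq> 0" "map_poly of_int A = smult (of_int k) a" by (rule clear_denominators)
  obtain l B where B: "l \<noteq> 0" "map_poly of_int B = smult (of_int l) b" by (rule clear_denominators)
  define A1 where "A1 = smult l A"
  define B1 where "B1 = smult k B"
  have A1: "map_poly of_int A1 = smult (of_int (k * l)) a"
    by (simp add: A1_def map_poly_smult A mult.commute)
  have B1: "map_poly of_int B1 = smult (of_int (k * l)) b"
    by (simp add: B1_def map_poly_smult B)
  have "B1 \<noteq> 0"
  proof
    assume "B1 = 0"
    then have "smult (of_int (k * l)) b = 0" using B1 by simp
    then show False using r A B by simp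
  qed
  then have "gcd A1 B1 \<noteq> 0" by simp
  then obtain f g where fg: "A1 = f * gcd A1 B1" "B1 = g * gcd A1 B1" "coprime f g"
    using gcd_coprime_exists by blast
  have g0: "g \<noteq> 0" using fg(2) \<open>B1 \<noteq> 0\<close> by auto
  have "B1 * f = A1 * g" using fg(1,2) by (metis mult.assoc mult.commute)
  then have "map_poly of_int B1 * map_poly of_int f = map_poly of_int A1 * (map_poly of_int g :: rat poly)"
    by (metis map_poly_of_int_mult)
  then have "smult (of_int (k * l)) (b * map_poly of_int f) = smult (of_int (k * l)) (a * map_poly of_int g)"
    by (simp add: A1 B1)
  then have "b * map_poly of_int f = a * map_poly of_int g" using A(1) B(1) by (simp add: poly_eq_iff)
  moreover have "map_poly of_int g \<noteq> (0 :: rat poly)" using g0 map_poly_of_int_eq_iff[of g 0] by simp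
  ultimately have "r = Fract (map_poly of_int f) (map_poly of_int g)"
    using r by (simp add: eq_fract mult.commute)
  then have "lowest_terms r (f, g)" using fg(3) g0 by (simp add: lowest_terms_def)
  then show ?thesis unfolding num_denom_def by (rule someI)
qed

text \<open>
  The polynomials \<open>\<phi>\<close> and \<open>\<psi>\<close> are coprime over the rationals by the Bezout identity, so the
  chosen representation in lowest terms is a constant multiple of \<open>(\<phi>, \<psi>)\<close>. The constant is the
  leading coefficient of the numerator, since \<open>\<phi>\<close> is monic, and hence an integer \<open>c\<close>.
\<close>
lemma num_denom_dup:
  fixes b2 b4 b6 b8 :: rat
  assumes rel: "4 * b8 = b2 * b6 - b4^2" and disc: "dup_disc 1 b2 b4 b6 \<noteq> 0"
  obtains c B2 B4 B6 B8 :: int where "c \<noteq> 0"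
    "num_denom (Fract (dup_num 1 b4 b6 b8) (dup_den 1 b2 b4 b6)) = (dup_num c B4 B6 B8, dup_den c B2 B4 B6)"
    "of_int B2 = of_int c * b2" "of_int B4 = of_int c * b4" "of_int B6 = of_int c * b6" "of_int B8 = of_int c * b8"
proof -
  let ?phi = "dup_num 1 b4 b6 b8" and ?psi = "dup_den 1 b2 b4 b6"
  let ?m = "map_poly of_int :: int poly \<Rightarrow> rat poly"
  obtain f g where fg: "num_denom (Fract ?phi ?psi) = (f, g)" by (cases "num_denom (Fract ?phi ?psi)")
  then have "lowest_terms (Fract ?phi ?psi) (f, g)" using lowest_terms_num_denom by metis
  then have lt: "g \<noteq> 0" "coprime f g" "Fract ?phi ?psi = Fract (?m f) (?m g)"
    by (auto simp: lowest_terms_def)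
  have nz: "?phi \<noteq> 0" "?psi \<noteq> 0" "?m g \<noteq> 0"
    using lt(1) map_poly_of_int_eq_iff[of g 0, where 'a = rat] by (auto simp: dup_num_def dup_den_def)
  have cross: "?phi * ?m g = ?m f * ?psi" using lt(3) nz by (simp add: eq_fract)
  obtain k1 Phi where Phi: "k1 \<noteq> 0" "?m Phi = smult (of_int k1) ?phi" by (rule clear_denominators)
  obtain k2 Psi where Psi: "k2 \<noteq> 0" "?m Psi = smult (of_int k2) ?psi" by (rule clear_denominators)
  have "?m (smult k2 Phi * g) = smult (of_int (k1 * k2)) (?phi * ?m g)"
    by (simp add: map_poly_of_int_mult map_poly_smult Phi mult.commute)
  also have "\<dots> = ?m (f * smult k1 Psi)"
    unfolding cross by (simp add: map_poly_of_int_mult map_poly_smult Psi)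
  finally have eq: "smult k2 Phi * g = f * smult k1 Psi" by (simp only: map_poly_of_int_eq_iff)
  then have "f dvd smult k2 Phi * g" by (metis dvd_triv_left)
  then have "f dvd smult k2 Phi" using coprime_dvd_mult_left_iff[OF lt(2)] by blast
  then obtain h where h: "smult k2 Phi = f * h" by (rule dvdE)
  have "f \<noteq> 0"
  proof
    assume "f = 0"
    then have "?phi * ?m g = 0" using cross by simp
    then show False using nz by simp
  qed
  moreover have "f * (h * g) = f * smult k1 Psi" using eq h by (simp add: mult.assoc)
  ultimately have h': "smult k1 Psi = h * g" by (metis mult_left_cancel)
  have mh: "smult (of_int (k1 * k2)) ?phi = ?m f * ?m h" "smult (of_int (k1 * k2)) ?psi = ?m g * ?m h"
  proof -
    have "smult (of_int (k1 * k2)) ?phi = ?m (smult k2 Phi)" by (simp add: map_poly_smult Phi mult.commute)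
    then show "smult (of_int (k1 * k2)) ?phi = ?m f * ?m h" unfolding h by (simp only: map_poly_of_int_mult)
    have "smult (of_int (k1 * k2)) ?psi = ?m (smult k1 Psi)" by (simp add: map_poly_smult Psi)
    then show "smult (of_int (k1 * k2)) ?psi = ?m g * ?m h"
      unfolding h' by (simp only: map_poly_of_int_mult mult.commute)
  qed
  obtain u v where uv: "u * ?phi + v * ?psi = [:dup_disc 1 b2 b4 b6:]" using dup_bezout[of 1 b8 b2 b6 b4] rel by auto
  have k: "(of_int (k1 * k2) :: rat) \<noteq> 0" using Phi(1) Psi(1) by simp
  have "?m h dvd smult (of_int (k1 * k2)) ?phi" "?m h dvd smult (of_int (k1 * k2)) ?psi" unfolding mh by simp_all
  then have "?m h dvd ?phi" "?m h dvd ?psi" using k by (simp_all add: dvd_smult_iff)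
  then have "?m h dvd u * ?phi + v * ?psi" by simp
  then have "?m h dvd [:dup_disc 1 b2 b4 b6:]" unfolding uv .
  then have "degree (?m h) = 0" using disc dvd_imp_degree_le[of "?m h" "[:dup_disc 1 b2 b4 b6:]"] by simp
  then obtain t where t: "?m h = [:t:]" by (rule degree_eq_zeroE)
  have t0: "t \<noteq> 0" using mh(1) t nz k by auto
  define s where "s = of_int (k1 * k2) / t"
  have f: "?m f = smult s ?phi"
  proof -
    have "smult s ?phi = smult (inverse t) (smult (of_int (k1 * k2)) ?phi)"
      by (simp add: s_def divide_inverse mult.commute)
    also have "\<dots> = ?m f" unfolding mh t using t0 by simp
    finally show ?thesis by simp
  qed
  have g: "?m g = smult s ?psi"
  proof -
    have "smult s ?psi = smult (inverse t) (smult (of_int (k1 * k2)) ?psi)"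
      by (simp add: s_def divide_inverse mult.commute)
    also have "\<dots> = ?m g" unfolding mh t using t0 by simp
    finally show ?thesis by simp
  qed
  define c where "c = coeff f 4"
  have s: "s = of_int c"
  proof -
    have "of_int c = coeff (?m f) 4" by (simp add: c_def coeff_map_poly)
    also have "\<dots> = s" unfolding f by (simp add: dup_num_def eval_nat_numeral)
    finally show ?thesis by simp
  qed
  have c0: "c \<noteq> 0" using s t0 k by (auto simp: s_def)
  define B2 B4 B6 B8 where "B2 = coeff g 2" and "B4 = - coeff f 2" and "B6 = coeff g 0" and "B8 = - coeff f 0"
  have cf: "of_int (coeff f i) = of_int c * coeff ?phi i" and cg: "of_int (coeff g i) = of_int c * coeff ?psi i" for i
  proof -
    have "of_int (coeff f i) = coeff (?m f) i" "of_int (coeff g i) = coeff (?m g) i" by (simp_all add: coeff_map_poly)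
    then show "of_int (coeff f i) = of_int c * coeff ?phi i" "of_int (coeff g i) = of_int c * coeff ?psi i"
      unfolding f g s by simp_all
  qed
  have B: "of_int B2 = of_int c * b2" "of_int B4 = of_int c * b4" "of_int B6 = of_int c * b6" "of_int B8 = of_int c * b8"
    using cg[of 2] cf[of 2] cg[of 0] cf[of 0]
    by (simp_all add: B2_def B4_def B6_def B8_def dup_num_def dup_den_def eval_nat_numeral)
  have "?m f = ?m (dup_num c B4 B6 B8)"
    unfolding f s by (simp add: dup_num_def map_poly_pCons B)
  then have "f = dup_num c B4 B6 B8" by (simp only: map_poly_of_int_eq_iff)
  moreover have "?m g = ?m (dup_den c B2 B4 B6)"
    unfolding g s by (simp add: dup_den_def map_poly_pCons B)
  then have "g = dup_den c B2 B4 B6" by (simp only: map_poly_of_int_eq_iff)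
  ultimately show ?thesis using that c0 B fg by blast
qed

lemma two_torsion_iff:
  fixes x y :: "'a :: field"
  assumes "E = Weierstrass a1 a2 a3 a4 a6"
  shows "point_mult E 2 (Affine x y) = Origin \<longleftrightarrow> 2 * y + a1 * x + a3 = 0"
proof -
  have "2 * y + a1 * x + a3 = y + y + a1 * x + a3" by simp
  then show ?thesis using assms by (simp add: point_mult_def numeral_2_eq_2 Let_def)
qed

text \<open>
  Completing the square in the Weierstrass equation; so \<open>\<psi>\<close> vanishes exactly at the abscissae
  of the affine points that are fixed by negation.
\<close>
lemma completed_square_on_curve:
  fixes x y :: "'a :: field"
  assumes "on_curve (Weierstrass a1 a2 a3 a4 a6) (Affine x y)"
  shows "(2 * y + a1 * x + a3)^2 = poly (dup_den 1 (a1^2 + 4 * a2) (2 * a4 + a1 * a3) (a3^2 + 4 * a6)) x"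
  using assms by (simp add: dup_den_def) algebra

lemma doubling_x:
  fixes x y :: "'a :: field"
  assumes on: "on_curve (Weierstrass a1 a2 a3 a4 a6) (Affine x y)" and w: "2 * y + a1 * x + a3 \<noteq> 0"
  shows "proj (point_mult (Weierstrass a1 a2 a3 a4 a6) 2 (Affine x y)) =
    Finite (poly (dup_num 1 (2 * a4 + a1 * a3) (a3^2 + 4 * a6)
        (a1^2 * a6 + 4 * a2 * a6 - a1 * a3 * a4 + a2 * a3^2 - a4^2)) x
      / poly (dup_den 1 (a1^2 + 4 * a2) (2 * a4 + a1 * a3) (a3^2 + 4 * a6)) x)"
proof -
  define t where "t = 2 * y + a1 * x + a3"
  define n where "n = 3 * x^2 + 2 * a2 * x + a4 - a1 * y"
  define l where "l = n / t"
  have t: "t \<noteq> 0" using w by (simp add: t_def)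
  have "y + y + a1 * x + a3 \<noteq> 0" using w by simp
  then have "proj (point_mult (Weierstrass a1 a2 a3 a4 a6) 2 (Affine x y)) = Finite (l^2 + a1 * l - a2 - x - x)"
    by (simp add: point_mult_def numeral_2_eq_2 Let_def l_def n_def t_def)
  also have "l^2 + a1 * l - a2 - x - x = (n^2 + a1 * n * t - (a2 + 2 * x) * t^2) / t^2"
    using t by (simp add: l_def field_simps power2_eq_square)
  also have "n^2 + a1 * n * t - (a2 + 2 * x) * t^2 = poly (dup_num 1 (2 * a4 + a1 * a3) (a3^2 + 4 * a6)
        (a1^2 * a6 + 4 * a2 * a6 - a1 * a3 * a4 + a2 * a3^2 - a4^2)) x"
    using on by (simp add: dup_num_def n_def t_def) algebra
  also have "t^2 = poly (dup_den 1 (a1^2 + 4 * a2) (2 * a4 + a1 * a3) (a3^2 + 4 * a6)) x"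
    unfolding t_def by (rule completed_square_on_curve[OF on])
  finally show ?thesis .
qed

lemma poly_dup_num_scale: "poly (dup_num c (c * b4) (c * b6) (c * b8)) x = c * poly (dup_num 1 b4 b6 b8) x"
  by (simp add: dup_num_def algebra_simps)

lemma poly_dup_den_scale: "poly (dup_den c (c * b2) (c * b4) (c * b6)) x = c * poly (dup_den 1 b2 b4 b6) x"
  by (simp add: dup_den_def algebra_simps)

text \<open>
  Two representations in lowest terms are compared by cross multiplication, which also covers the
  points where both values are infinite.
\<close>
lemma ratfun_eqI:
  assumes "\<And>x :: complex. eval_ratfun K (Finite x) = eval_ratfun L (Finite x)"
  shows "K = L"
proof -
  obtain f g where fg: "num_denom K = (f, g)" by (cases "num_denom K")
  obtain f' g' where fg': "num_denom L = (f', g')" by (cases "num_denom L")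
  have lt: "g \<noteq> 0" "K = Fract (map_poly of_int f) (map_poly of_int g)"
    "g' \<noteq> 0" "L = Fract (map_poly of_int f') (map_poly of_int g')"
    using lowest_terms_num_denom[of K] lowest_terms_num_denom[of L] by (auto simp: fg fg' lowest_terms_def)
  let ?m = "map_poly of_int :: int poly \<Rightarrow> complex poly"
  have "poly (?m f * ?m g') x = poly (?m f' * ?m g) x" for x
  proof -
    have "proj_point (poly (?m f) x, poly (?m g) x) = proj_point (poly (?m f') x, poly (?m g') x)"
      using assms[of x] by (simp add: eval_ratfun_def fg fg')
    then show ?thesis by (auto simp: proj_point_def field_simps split: if_splits)
  qed
  then have "?m f * ?m g' = ?m f' * ?m g" using poly_eq_poly_eq_iff by blast
  then have "?m (f * g') = ?m (f' * g)" by (simp only: map_poly_of_int_mult)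
  then have "f * g' = f' * g" by (simp only: map_poly_of_int_eq_iff)
  then have "map_poly of_int f * map_poly of_int g' = map_poly of_int f' * (map_poly of_int g :: rat poly)"
    by (metis map_poly_of_int_mult)
  moreover have "map_poly of_int g \<noteq> (0 :: rat poly)" "map_poly of_int g' \<noteq> (0 :: rat poly)"
    using lt map_poly_of_int_eq_iff[of g 0, where 'a = rat] map_poly_of_int_eq_iff[of g' 0, where 'a = rat] by auto
  ultimately show ?thesis unfolding lt(2,4) by (simp add: eq_fract)
qed

text \<open>
  The duplication formula shows that the quotient has the defining property. It is the only such
  function because every complex number is the abscissa of a point on the curve.
\<close>
lemma lattes_map_2:
  fixes a1 a2 a3 a4 a6 :: rat
  defines "b2 \<equiv> a1^2 + 4 * a2" and "b4 \<equiv> 2 * a4 + a1 * a3" and "b6 \<equiv> a3^2 + 4 * a6"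
    and "b8 \<equiv> a1^2 * a6 + 4 * a2 * a6 - a1 * a3 * a4 + a2 * a3^2 - a4^2"
  assumes disc: "dup_disc 1 b2 b4 b6 \<noteq> 0"
  shows "lattes_map (Weierstrass a1 a2 a3 a4 a6) 2 = Fract (dup_num 1 b4 b6 b8) (dup_den 1 b2 b4 b6)"
proof -
  let ?L = "Fract (dup_num 1 b4 b6 b8) (dup_den 1 b2 b4 b6)"
  let ?E = "Weierstrass (of_rat a1) (of_rat a2) (of_rat a3) (of_rat a4) (of_rat a6) :: complex weierstrass"
  have EC: "map_weierstrass of_rat (Weierstrass a1 a2 a3 a4 a6) = ?E" by simp
  have rel: "4 * b8 = b2 * b6 - b4^2" unfolding b2_def b4_def b6_def b8_def by algebra
  obtain c B2 B4 B6 B8 :: int where c: "c \<noteq> 0"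
    and nd: "num_denom ?L = (dup_num c B4 B6 B8, dup_den c B2 B4 B6)"
    and B: "of_int B2 = of_int c * b2" "of_int B4 = of_int c * b4" "of_int B6 = of_int c * b6" "of_int B8 = of_int c * b8"
    by (rule num_denom_dup[OF rel disc])
  define c' where "c' = (of_int c :: complex)"
  have c': "c' \<noteq> 0" using c by (simp add: c'_def)
  have BC: "of_int B2 = c' * of_rat b2" "of_int B4 = c' * of_rat b4" "of_int B6 = c' * of_rat b6" "of_int B8 = c' * of_rat b8"
    using B[THEN arg_cong, of of_rat] by (simp_all add: of_rat_mult c'_def)
  have mf: "map_poly of_int (dup_num c B4 B6 B8) = dup_num c' (c' * of_rat b4) (c' * of_rat b6) (c' * of_rat b8)"
    and mg: "map_poly of_int (dup_den c B2 B4 B6) = dup_den c' (c' * of_rat b2) (c' * of_rat b4) (c' * of_rat b6)"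
    by (simp_all add: dup_num_def dup_den_def map_poly_pCons BC c'_def)
  let ?phi = "dup_num 1 (of_rat b4) (of_rat b6) (of_rat b8) :: complex poly"
  let ?psi = "dup_den 1 (of_rat b2) (of_rat b4) (of_rat b6) :: complex poly"
  have ev: "eval_ratfun ?L (Finite x) = (if poly ?psi x = 0 then Infty else Finite (poly ?phi x / poly ?psi x))" for x
    using c' by (simp add: eval_ratfun_def nd mf mg proj_point_def poly_dup_num_scale poly_dup_den_scale)
  have evI: "eval_ratfun ?L Infty = Infty"
    unfolding eval_ratfun_def nd prod.case Let_def mf mg hom_values_dup_Infty[OF c'] by (simp add: proj_point_def)
  have b: "of_rat b2 = (of_rat a1)^2 + 4 * (of_rat a2 :: complex)" "of_rat b4 = 2 * of_rat a4 + of_rat a1 * (of_rat a3 :: complex)"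
    "of_rat b6 = (of_rat a3)^2 + 4 * (of_rat a6 :: complex)"
    "of_rat b8 = (of_rat a1)^2 * of_rat a6 + 4 * of_rat a2 * of_rat a6 - of_rat a1 * of_rat a3 * of_rat a4
      + of_rat a2 * (of_rat a3)^2 - (of_rat a4 :: complex)^2"
    by (simp_all add: b2_def b4_def b6_def b8_def of_rat_add of_rat_mult of_rat_diff of_rat_power)
  have L: "proj (point_mult ?E 2 P) = eval_ratfun ?L (proj P)" if P: "on_curve ?E P" for P
  proof (cases P)
    case Origin
    then show ?thesis using evI by (simp add: point_mult_def numeral_2_eq_2)
  next
    case (Affine x y)
    let ?w = "2 * y + of_rat a1 * x + of_rat a3"
    have w: "?w ^ 2 = poly ?psi x" using completed_square_on_curve[OF P[unfolded Affine]] by (simp only: b)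
    show ?thesis
    proof (cases "?w = 0")
      case True
      then have "point_mult ?E 2 P = Origin" unfolding Affine by (subst two_torsion_iff[OF refl])
      moreover have "poly ?psi x = 0" using w True by simp
      ultimately show ?thesis using ev[of x] by (simp add: Affine)
    next
      case False
      then have "poly ?psi x \<noteq> 0" using w by (metis power_eq_0_iff)
      then have "eval_ratfun ?L (proj P) = Finite (poly ?phi x / poly ?psi x)" using ev[of x] by (simp add: Affine)
      also have "\<dots> = proj (point_mult ?E 2 P)"
        unfolding Affine doubling_x[OF P[unfolded Affine] False] by (simp only: b)
      finally show ?thesis by simp
    qed
  qed
  have uniq: "K = ?L" if K: "\<And>P. on_curve ?E P \<Longrightarrow> proj (point_mult ?E 2 P) = eval_ratfun K (proj P)" for K
  proof (rule ratfun_eqI)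
    fix x :: complex
    \<comment> \<open>the point above \<open>x\<close> comes from a square root of \<open>\<psi>(x)\<close>\<close>
    define y where "y = (csqrt (poly ?psi x) - of_rat a1 * x - of_rat a3) / 2"
    have "2 * y + of_rat a1 * x + of_rat a3 = csqrt (poly ?psi x)" by (simp add: y_def field_simps)
    then have "(2 * y + of_rat a1 * x + of_rat a3) ^ 2 = poly ?psi x" by simp
    then have "4 * (y^2 + of_rat a1 * x * y + of_rat a3 * y) = 4 * (x^3 + of_rat a2 * x^2 + of_rat a4 * x + of_rat a6)"
      by (simp add: dup_den_def b) algebra
    then have "y^2 + of_rat a1 * x * y + of_rat a3 * y = x^3 + of_rat a2 * x^2 + of_rat a4 * x + of_rat a6"
      by (rule mult_left_cancel[THEN iffD1, rotated]) simp
    then have on: "on_curve ?E (Affine x y)" by simp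
    have "eval_ratfun K (Finite x) = proj (point_mult ?E 2 (Affine x y))" using K[OF on] by simp
    also have "\<dots> = eval_ratfun ?L (Finite x)" using L[OF on] by simp
    finally show "eval_ratfun K (Finite x) = eval_ratfun ?L (Finite x)" .
  qed
  show ?thesis
    unfolding lattes_map_def Let_def EC
  proof (rule the_equality)
    show "\<forall>P. on_curve ?E P \<longrightarrow> proj (point_mult ?E 2 P) = eval_ratfun ?L (proj P)" using L by blast
  qed (use uniq in blast)
qed

theorem proposition16:
  fixes E :: "rat weierstrass"
  assumes "elliptic_curve E"
  shows "arithmetically_exceptional (lattes_map E 2) \<longleftrightarrow>
    \<not> (\<exists>P. on_curve E P \<and> P \<noteq> Origin \<and> point_mult E 2 P = Origin)"
proof -
  obtain a1 a2 a3 a4 a6 where E: "E = Weierstrass a1 a2 a3 a4 a6" by (cases E)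
  define b2 b4 b6 b8 where "b2 = a1^2 + 4 * a2" and "b4 = 2 * a4 + a1 * a3" and "b6 = a3^2 + 4 * a6"
    and "b8 = a1^2 * a6 + 4 * a2 * a6 - a1 * a3 * a4 + a2 * a3^2 - a4^2"
  note b = b2_def b4_def b6_def b8_def
  have rel: "4 * b8 = b2 * b6 - b4^2" unfolding b by algebra
  have "dup_disc 1 b2 b4 b6 = 4 * discriminant E"
    using rel unfolding E discriminant.simps Let_def b[symmetric] by (simp add: dup_disc_def) algebra
  then have disc: "dup_disc 1 b2 b4 b6 \<noteq> 0" using assms by (simp add: elliptic_curve_def)
  let ?L = "lattes_map E 2"
  have L: "?L = Fract (dup_num 1 b4 b6 b8) (dup_den 1 b2 b4 b6)"
    using lattes_map_2[of a1 a2 a4 a3 a6] disc unfolding E b by blast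
  obtain c B2 B4 B6 B8 :: int where c: "c \<noteq> 0"
    and nd: "num_denom ?L = (dup_num c B4 B6 B8, dup_den c B2 B4 B6)"
    and B: "of_int B2 = of_int c * b2" "of_int B4 = of_int c * b4" "of_int B6 = of_int c * b6" "of_int B8 = of_int c * b8"
    using num_denom_dup[OF rel disc] unfolding L by metis
  let ?g = "dup_den c B2 B4 B6"
  have relB: "4 * c * B8 = B2 * B6 - B4^2"
  proof -
    have "of_int (4 * c * B8) = (of_int (B2 * B6 - B4^2) :: rat)" using rel by (simp add: B) algebra
    then show ?thesis by (simp only: of_int_eq_iff)
  qed
  have discB: "dup_disc c B2 B4 B6 \<noteq> 0"
  proof -
    have "of_int (dup_disc c B2 B4 B6) = of_int c ^ 4 * dup_disc 1 b2 b4 b6"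
      by (simp add: dup_disc_def B) algebra
    then show ?thesis using c disc by (metis mult_eq_0_iff of_int_0 of_int_eq_0_iff power_eq_0_iff)
  qed
  have gpoly: "of_int (poly ?g z) = of_int c * poly (dup_den 1 b2 b4 b6) (of_int z)" for z
    by (simp add: dup_den_def B algebra_simps)
  have torsion: "(\<exists>P. on_curve E P \<and> P \<noteq> Origin \<and> point_mult E 2 P = Origin)
      \<longleftrightarrow> (\<exists>x. poly (dup_den 1 b2 b4 b6) x = 0)"
  proof safe
    fix P assume P: "on_curve E P" "P \<noteq> Origin" "point_mult E 2 P = Origin"
    then obtain x y where xy: "P = Affine x y" by (cases P) auto
    have "2 * y + a1 * x + a3 = 0" using P(3) two_torsion_iff[OF E] by (simp only: xy)
    then show "\<exists>x. poly (dup_den 1 b2 b4 b6) x = 0"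
      using completed_square_on_curve[OF P(1)[unfolded E xy]] unfolding b by (intro exI[of _ x]) simp
  next
    fix x assume x: "poly (dup_den 1 b2 b4 b6) x = 0"
    define y where "y = - (a1 * x + a3) / 2"
    have y: "2 * y + a1 * x + a3 = 0" by (simp add: y_def field_simps)
    have "4 * (y^2 + a1 * x * y + a3 * y) = 4 * (x^3 + a2 * x^2 + a4 * x + a6)"
      using x y by (simp add: dup_den_def b) algebra
    then have "y^2 + a1 * x * y + a3 * y = x^3 + a2 * x^2 + a4 * x + a6"
      by (rule mult_left_cancel[THEN iffD1, rotated]) simp
    then have "on_curve E (Affine x y)" by (simp add: E)
    then show "\<exists>P. on_curve E P \<and> P \<noteq> Origin \<and> point_mult E 2 P = Origin"
      using y two_torsion_iff[OF E] by blast
  qed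
  show ?thesis
    unfolding torsion
  proof
    assume exc: "arithmetically_exceptional ?L"
    show "\<not> (\<exists>x. poly (dup_den 1 b2 b4 b6) x = 0)"
    proof
      assume "\<exists>x. poly (dup_den 1 b2 b4 b6) x = 0"
      then obtain x where x: "poly (dup_den 1 b2 b4 b6) x = 0" by blast
      obtain u w where "quotient_of x = (u, w)" by (cases "quotient_of x")
      then have w: "w > 0" "x = of_int u / of_int w" by (auto simp: quotient_of_denom_pos quotient_of_div)
      \<comment> \<open>\<open>w^3 \<psi>(u / w)\<close>, so that \<open>u / w\<close> is a root modulo \<open>p\<close> unless \<open>p\<close> divides \<open>w\<close>\<close>
      define h where "h = 4 * c * u^3 + B2 * u^2 * w + 2 * B4 * u * w^2 + B6 * w^3"
      have "of_int h = of_int c * (of_int w ^ 3 * poly (dup_den 1 b2 b4 b6) x)"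
      proof -
        have "of_int u = x * of_int w" using w by simp
        then show ?thesis by (simp add: h_def dup_den_def B algebra_simps power2_eq_square power3_eq_cube)
      qed
      then have h: "h = 0" using x by simp
      have "p \<in> {p. prime p \<and> int p dvd w}" if p: "prime p" "permutes_mod ?L p" for p
      proof (rule ccontr)
        assume "p \<notin> {p. prime p \<and> int p dvd w}"
        then have pw: "\<not> int p dvd w" using p by simp
        then obtain w' where w': "int p dvd w * w' - 1" using inverse_mod_prime[OF p(1)] by blast
        have "w^3 * poly ?g (u * w') = h + (w * w' - 1) *
            (4 * c * u^3 * ((w * w')^2 + w * w' + 1) + B2 * u^2 * w * (w * w' + 1) + 2 * B4 * u * w^2)"
          unfolding h_def by (simp add: dup_den_def) algebra
        then have "int p dvd w^3 * poly ?g (u * w')" using w' h by simp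
        moreover have "prime (int p)" using p by simp
        ultimately have "int p dvd poly ?g (u * w')" using pw by (metis prime_dvd_multD prime_dvd_power)
        then show False using not_permutes_mod_if_root[OF nd c p(1)] p(2) by blast
      qed
      then have "{p. prime p \<and> permutes_mod ?L p} \<subseteq> {p. prime p \<and> int p dvd w}" by blast
      moreover have "finite {p :: nat. prime p \<and> int p dvd w}" using w by (intro finite_prime_divisors) auto
      ultimately show False using exc unfolding arithmetically_exceptional_def by (meson finite_subset)
    qed
  next
    assume noroot: "\<not> (\<exists>x. poly (dup_den 1 b2 b4 b6) x = 0)"
    \<comment> \<open>\<open>\<psi>\<close> made monic and integral by the substitution \<open>z = 4 c x\<close>\<close>
    let ?F = "\<lambda>z. cubic_form B2 (8 * c * B4) (16 * c^2 * B6) z 1"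
    let ?S = "{p :: nat. prime p \<and> (\<forall>z. \<not> int p dvd ?F z)}"
    let ?T = "{p :: nat. prime p \<and> int p dvd 2 * c * dup_disc c B2 B4 B6}"
    have F: "?F (4 * c * z) = 16 * c^2 * poly ?g z" for z
      unfolding cubic_form_1 by (simp add: dup_den_def) algebra
    have "?F z \<noteq> 0" for z
    proof
      assume "?F z = 0"
      have "of_int (?F z) = 16 * (of_int c ^ 3 * poly (dup_den 1 b2 b4 b6) (of_int z / (4 * of_int c)))"
        using c unfolding cubic_form_1 by (simp add: dup_den_def B field_simps power2_eq_square power3_eq_cube)
      then have "poly (dup_den 1 b2 b4 b6) (of_int z / (4 * of_int c)) = 0" using \<open>?F z = 0\<close> c by simp
      then show False using noroot by blast
    qed
    moreover have "cubic_disc B2 (8 * c * B4) (16 * c^2 * B6) = 64 * c^2 * dup_disc c B2 B4 B6"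
      unfolding cubic_disc_def dup_disc_def by algebra
    then have "cubic_disc B2 (8 * c * B4) (16 * c^2 * B6) \<noteq> 0" using c discB by simp
    ultimately have "infinite ?S" by (rule cubic_no_root_mod_infinitely_many_primes)
    moreover have "finite ?T" using c discB by (intro finite_prime_divisors) auto
    ultimately have "infinite (?S - ?T)" by (rule Diff_infinite_finite[rotated])
    moreover have "?S - ?T \<subseteq> {p. prime p \<and> permutes_mod ?L p}"
    proof safe
      fix p assume p: "prime p" "\<forall>z. \<not> int p dvd ?F z" "\<not> int p dvd 2 * c * dup_disc c B2 B4 B6"
      show "permutes_mod ?L p"
      proof (rule permutes_mod_if_no_root[OF nd c relB p(1)])
        show "\<not> int p dvd 2 * c" "\<not> int p dvd dup_disc c B2 B4 B6" using p(3) by (auto intro: dvd_mult dvd_mult2)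
        fix z show "\<not> int p dvd poly ?g z" using p(2) F[of z] by (metis dvd_mult)
      qed
    qed
    ultimately show "arithmetically_exceptional ?L"
      unfolding arithmetically_exceptional_def by (meson finite_subset)
  qed
qed

end
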